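(* Let $q$ be an odd prime power, and let $C$ be an LCD code over $\mathbb{Z}/q\mathbb{Z}$ with length $n$. For any $i\in\{1,2\}$, let $O_i$ be an orthonormal matrix of size $n$, and let $L_i=O_i(C+q\mathbb{Z}^n)$. Then the lattice isomorphism problem (LIP) for $L_1$ and $L_2$ can be reduced to $\mathbb{Z}$LIP and the graph isomorphism problem (GI) with $2n$ vertices.
   Context: Codes. A linear code of length $n$ over a finite ring $R$ is a submodule $C$ of $R^n$. The dual code is $C^\perp=\{x\in R^n : x\cdot c=0 \text{ for all } c\in C\}$, and $C$ is LCD if $C\cap C^\perp=\{0\}$. Construction A. For a code $C$ over $\mathbb{Z}/q\mathbb{Z}$ of length $n$, $C+q\mathbb{Z}^n=\{x\in\mathbb{Z}^n : (x \bmod q)\in C\}$, with reduction mod $q$ taken coordinatewise. Lattice problems. A lattice is a discrete subgroup of $\mathbb{R}^n$ consisting of the integer linear combinations of some vectors $v_1,\dots,v_m$. Lattices $L_1,L_2$ are isomorphic if there is an orthonormal (i.e. real orthogonal) matrix $O$ with $L_1=OL_2$. LIP means the search version: find the orthonormal matrix that transforms $L_1$ into $L_2$. When $L_2=\mathbb{Z}^n$ the problem is called $\mathbb{Z}$LIP. Graph problem. A graph $(V,E)$ consists of a finite vertex set $V$ and a set $E$ of edges, each a 2-element subset of $V$; with a map $w:E\to\mathbb{R}$ it is a weighted graph $(V,E,w)$. Its adjacency matrix is the $|V|\times|V|$ matrix with $A_{ij}=w(\{i,j\})$ if $\{i,j\}\in E$ and $A_{ij}=0$ otherwise. Weighted graphs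 with adjacency matrices $A_1,A_2$ are isomorphic if $A_1=P^\top A_2P$ for some permutation matrix $P$. GI: distinguish whether two given graphs are isomorphic and, if they are, determine the permutation matrix $P$. *)

theory Defs
  imports
    "Jordan_Normal_Form.VS_Connect"
    "HOL-Number_Theory.Prime_Powers"
    "HOL-Number_Theory.Residues"
    "HOL-Combinatorics.Permutations"
begin
text \<open>
  Residue classes are represented by \<open>0, \<dots>, q - 1\<close>, as in \<^const>\<open>residue_ring\<close>.  The fields \<open>mult\<close> and
  \<open>one\<close> play no role in a module.
\<close>

definition Zq_space :: "nat \<Rightarrow> nat \<Rightarrow> (int, int vec) module" where
  "Zq_space q n =
     \<lparr>carrier = {v \<in> carrier_vec n. \<forall>i<n. v $ i \<in> carrier (residue_ring (int q))},
      monoid.mult = undefined,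
      one = undefined,
      zero = 0\<^sub>v n,
      add = (\<lambda>v w. map_vec (\<lambda>a. a mod int q) (v + w)),
      smult = (\<lambda>a v. map_vec (\<lambda>b. b mod int q) (a \<cdot>\<^sub>v v))\<rparr>"

definition linear_code :: "nat \<Rightarrow> nat \<Rightarrow> int vec set \<Rightarrow> bool" where
  "linear_code q n C \<longleftrightarrow> Module.submodule C (residue_ring (int q)) (Zq_space q n)"

definition dual_code :: "nat \<Rightarrow> nat \<Rightarrow> int vec set \<Rightarrow> int vec set" where
  "dual_code q n C = {x \<in> carrier (Zq_space q n). \<forall>c\<in>C. (x \<bullet> c) mod int q = 0}"

definition LCD_code :: "nat \<Rightarrow> nat \<Rightarrow> int vec set \<Rightarrow> bool" where
  "LCD_code q n C \<longleftrightarrow> linear_code q n C \<and> C \<inter> dual_code q n C = {0\<^sub>v n}"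

definition construction_A :: "nat \<Rightarrow> nat \<Rightarrow> int vec set \<Rightarrow> real vec set" where
  "construction_A q n C =
     map_vec real_of_int ` {x \<in> carrier_vec n. map_vec (\<lambda>a. a mod int q) x \<in> C}"

definition orthonormal_mat :: "nat \<Rightarrow> real mat \<Rightarrow> bool" where
  "orthonormal_mat n Q \<longleftrightarrow> Q \<in> carrier_mat n n \<and> transpose_mat Q * Q = 1\<^sub>m n"

definition mat_image :: "real mat \<Rightarrow> real vec set \<Rightarrow> real vec set" where
  "mat_image Q L = (\<lambda>v. Q *\<^sub>v v) ` L"

definition lattice_iso_by :: "nat \<Rightarrow> real mat \<Rightarrow> real vec set \<Rightarrow> real vec set \<Rightarrow> bool" where
  "lattice_iso_by n Q L1 L2 \<longleftrightarrow> orthonormal_mat n Q \<and> L1 = mat_image Q L2"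

definition Zn :: "nat \<Rightarrow> real vec set" where
  "Zn n = map_vec real_of_int ` carrier_vec n"

definition lattice_basis :: "nat \<Rightarrow> real mat \<Rightarrow> real vec set \<Rightarrow> bool" where
  "lattice_basis n B L \<longleftrightarrow>
     B \<in> carrier_mat n n \<and> det B \<noteq> 0 \<and> vec_module.lattice_of n (cols B) = L"

text \<open>
  The vertex set is \<open>{..<N}\<close>. Edges are 2-element sets, so adjacency matrices are symmetric with
  zero diagonal.
\<close>

definition weighted_graph :: "nat \<Rightarrow> nat set set \<Rightarrow> bool" where
  "weighted_graph N E \<longleftrightarrow> (\<forall>e\<in>E. e \<subseteq> {..<N} \<and> card e = 2)"

definition adjacency_mat :: "nat \<Rightarrow> nat set set \<Rightarrow> (nat set \<Rightarrow> real) \<Rightarrow> real mat" where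
  "adjacency_mat N E w = mat N N (\<lambda>(i, j). if {i, j} \<in> E then w {i, j} else 0)"

definition permutation_mat :: "nat \<Rightarrow> real mat \<Rightarrow> bool" where
  "permutation_mat N P \<longleftrightarrow>
     (\<exists>\<pi>. \<pi> permutes {..<N} \<and> P = mat N N (\<lambda>(i, j). if i = \<pi> j then 1 else 0))"

definition graph_iso_by :: "nat \<Rightarrow> real mat \<Rightarrow> real mat \<Rightarrow> real mat \<Rightarrow> bool" where
  "graph_iso_by N P A1 A2 \<longleftrightarrow> permutation_mat N P \<and> A1 = transpose_mat P * A2 * P"

text \<open>
  An oracle is any function that answers the valid instances of its problem correctly; nothing is
  known about its answers on other arguments.  The search problem is only posed for a lattice that
  is isomorphic to the integer lattice.
\<close>

definition ZLIP_oracle :: "(real mat \<Rightarrow> real mat) \<Rightarrow> bool" where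
  "ZLIP_oracle zl \<longleftrightarrow>
     (\<forall>d B L. lattice_basis d B L \<and> (\<exists>Q. lattice_iso_by d Q L (Zn d)) \<longrightarrow>
        lattice_iso_by d (zl B) L (Zn d))"

definition GI_oracle :: "nat \<Rightarrow> (real mat \<Rightarrow> real mat \<Rightarrow> real mat option) \<Rightarrow> bool" where
  "GI_oracle N gi \<longleftrightarrow>
     (\<forall>E1 E2 w1 w2. weighted_graph N E1 \<and> weighted_graph N E2 \<longrightarrow>
        (let A1 = adjacency_mat N E1 w1; A2 = adjacency_mat N E2 w2
         in case gi A1 A2 of
              None \<Rightarrow> \<not> (\<exists>P. graph_iso_by N P A1 A2)
            | Some P \<Rightarrow> graph_iso_by N P A1 A2))"

text \<open>
  Bases, orthonormal matrices and edge weights are real, so the model of computation is the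
  Blum--Shub--Smale (real RAM) model: exact field arithmetic and comparisons of reals at unit cost,
  integer constants only, no rounding.  It is presented as a while language with natural-number
  variables, which serve as indices, and two-dimensional arrays of reals.  A program is a finite
  object that does not depend on the input, hence the cost of evaluating one of its expressions is
  bounded by a constant and counted as one step.  Division by zero yields zero.
\<close>

type_synonym vname = string
type_synonym state = "(vname \<Rightarrow> nat) \<times> (vname \<Rightarrow> nat \<Rightarrow> nat \<Rightarrow> real)"

datatype nexp = NConst nat | NVar vname | NPlus nexp nexp | NMinus nexp nexp

datatype rexp = RConst int | RCell vname nexp nexp
  | RPlus rexp rexp | RMinus rexp rexp | RTimes rexp rexp | RDivide rexp rexp

datatype bexp = NLess nexp nexp | RLess rexp rexp | BNot bexp | BAnd bexp bexp

datatype com = Skip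
  | NAssign vname nexp
  | RAssign vname nexp nexp rexp
  | Seq com com
  | If bexp com com
  | While bexp com
  | ZLIP_Call nexp vname vname
  | GI_Call nexp vname vname vname vname

fun nval :: "nexp \<Rightarrow> state \<Rightarrow> nat" where
  "nval (NConst k) s = k"
| "nval (NVar x) s = fst s x"
| "nval (NPlus a b) s = nval a s + nval b s"
| "nval (NMinus a b) s = nval a s - nval b s"

fun rval :: "rexp \<Rightarrow> state \<Rightarrow> real" where
  "rval (RConst k) s = of_int k"
| "rval (RCell x i j) s = snd s x (nval i s) (nval j s)"
| "rval (RPlus a b) s = rval a s + rval b s"
| "rval (RMinus a b) s = rval a s - rval b s"
| "rval (RTimes a b) s = rval a s * rval b s"
| "rval (RDivide a b) s = rval a s / rval b s"

fun bval :: "bexp \<Rightarrow> state \<Rightarrow> bool" where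
  "bval (NLess a b) s = (nval a s < nval b s)"
| "bval (RLess a b) s = (rval a s < rval b s)"
| "bval (BNot b) s = (\<not> bval b s)"
| "bval (BAnd a b) s = (bval a s \<and> bval b s)"

definition set_nvar :: "vname \<Rightarrow> nat \<Rightarrow> state \<Rightarrow> state" where
  "set_nvar x k s = ((fst s)(x := k), snd s)"

definition set_cell :: "vname \<Rightarrow> nat \<Rightarrow> nat \<Rightarrow> real \<Rightarrow> state \<Rightarrow> state" where
  "set_cell x i j r s = (fst s, (snd s)(x := (snd s x)(i := (snd s x i)(j := r))))"

definition get_mat :: "nat \<Rightarrow> vname \<Rightarrow> state \<Rightarrow> real mat" where
  "get_mat d x s = mat d d (\<lambda>(i, j). snd s x i j)"

definition set_mat :: "nat \<Rightarrow> vname \<Rightarrow> real mat \<Rightarrow> state \<Rightarrow> state" where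
  "set_mat d x A s =
     (fst s, (snd s)(x := (\<lambda>i j. if i < d \<and> j < d then A $$ (i, j) else snd s x i j)))"

text \<open>
  The size of a real counts the bits of its integer part, so that integers have their usual binary
  size. Without such a term no program could round or reduce modulo \<open>q\<close> within a number of steps
  bounded in terms of the size.
\<close>

definition real_size :: "real \<Rightarrow> nat" where
  "real_size x = 1 + nat \<lceil>log 2 (1 + \<bar>x\<bar>)\<rceil>"

definition mat_size :: "real mat \<Rightarrow> nat" where
  "mat_size A = (\<Sum>i<dim_row A. \<Sum>j<dim_col A. real_size (A $$ (i, j)))"

text \<open>
  \<open>steps zl gi c s t s'\<close>: with oracles \<open>zl\<close> and \<open>gi\<close>, program \<open>c\<close> started in \<open>s\<close> halts in \<open>s'\<close>
  at cost \<open>t\<close>.  An oracle call costs the size of the query, so in polynomial time only queries of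
  polynomial size can be asked.
\<close>

inductive steps ::
  "(real mat \<Rightarrow> real mat) \<Rightarrow> (real mat \<Rightarrow> real mat \<Rightarrow> real mat option) \<Rightarrow>
   com \<Rightarrow> state \<Rightarrow> nat \<Rightarrow> state \<Rightarrow> bool"
  for zl gi
where
  Skip: "steps zl gi Skip s 1 s"
| NAssign: "steps zl gi (NAssign x a) s 1 (set_nvar x (nval a s) s)"
| RAssign: "steps zl gi (RAssign x i j a) s 1 (set_cell x (nval i s) (nval j s) (rval a s) s)"
| Seq: "steps zl gi c1 s1 t1 s2 \<Longrightarrow> steps zl gi c2 s2 t2 s3 \<Longrightarrow>
    steps zl gi (Seq c1 c2) s1 (t1 + t2) s3"
| IfTrue: "bval b s \<Longrightarrow> steps zl gi c1 s t s' \<Longrightarrow> steps zl gi (If b c1 c2) s (1 + t) s'"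
| IfFalse: "\<not> bval b s \<Longrightarrow> steps zl gi c2 s t s' \<Longrightarrow> steps zl gi (If b c1 c2) s (1 + t) s'"
| WhileFalse: "\<not> bval b s \<Longrightarrow> steps zl gi (While b c) s 1 s"
| WhileTrue: "bval b s1 \<Longrightarrow> steps zl gi c s1 t1 s2 \<Longrightarrow> steps zl gi (While b c) s2 t2 s3 \<Longrightarrow>
    steps zl gi (While b c) s1 (1 + t1 + t2) s3"
| ZLIP_Call: "d = nval a s \<Longrightarrow> B = get_mat d x s \<Longrightarrow>
    steps zl gi (ZLIP_Call a x y) s (1 + mat_size B) (set_mat d y (zl B) s)"
| GI_Call_None: "d = nval a s \<Longrightarrow> A1 = get_mat d x1 s \<Longrightarrow> A2 = get_mat d x2 s \<Longrightarrow>
    gi A1 A2 = None \<Longrightarrow>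
    steps zl gi (GI_Call a x1 x2 f y) s (1 + mat_size A1 + mat_size A2) (set_nvar f 0 s)"
| GI_Call_Some: "d = nval a s \<Longrightarrow> A1 = get_mat d x1 s \<Longrightarrow> A2 = get_mat d x2 s \<Longrightarrow>
    gi A1 A2 = Some P \<Longrightarrow>
    steps zl gi (GI_Call a x1 x2 f y) s (1 + mat_size A1 + mat_size A2)
      (set_nvar f 1 (set_mat d y P s))"

definition LIP_input :: "nat \<Rightarrow> nat \<Rightarrow> real mat \<Rightarrow> real mat \<Rightarrow> state" where
  "LIP_input n q B1 B2 =
     set_mat n ''B1'' B1 (set_mat n ''B2'' B2 (set_cell ''q'' 0 0 (real q)
       (set_nvar ''n'' n ((\<lambda>_. 0), (\<lambda>_ _ _. 0)))))"

definition LIP_input_size :: "nat \<Rightarrow> nat \<Rightarrow> real mat \<Rightarrow> real mat \<Rightarrow> nat" where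
  "LIP_input_size n q B1 B2 = n + real_size (real q) + mat_size B1 + mat_size B2"

text \<open>
  \<open>LIP_reducible F N\<close>: one program solves the lattice isomorphism problem, in its search version
  and in polynomial time, for all pairs of lattices in the family \<open>F\<close> (indexed by the dimension
  \<open>n\<close> and a parameter \<open>q\<close>), given an oracle for the isomorphism problem with the integer lattice
  and an oracle for isomorphism of weighted graphs with \<open>N n\<close> vertices. The program receives
  \<open>n\<close>, \<open>q\<close> and arbitrary bases of the two lattices.
\<close>

definition LIP_reducible ::
  "(nat \<Rightarrow> nat \<Rightarrow> real vec set \<Rightarrow> real vec set \<Rightarrow> bool) \<Rightarrow> (nat \<Rightarrow> nat) \<Rightarrow> bool" where
  "LIP_reducible F N \<longleftrightarrow>
     (\<exists>(c :: com) (p :: nat poly). \<forall>n q L1 L2 B1 B2 zl gi.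
        F n q L1 L2 \<and> lattice_basis n B1 L1 \<and> lattice_basis n B2 L2 \<and>
        ZLIP_oracle zl \<and> GI_oracle (N n) gi \<longrightarrow>
        (\<exists>t s. steps zl gi c (LIP_input n q B1 B2) t s \<and>
               t \<le> poly p (LIP_input_size n q B1 B2) \<and>
               lattice_iso_by n (get_mat n ''O'' s) L1 L2))"

end

theory Submission
  imports Defs
begin

text \<open>
  Put \<open>L = O (C + q \<int>\<^sup>n)\<close>.  As \<open>C\<close> is LCD, the hull of \<open>L\<close>, that is, the set of vectors of \<open>L\<close> whose inner
  products with \<open>L\<close> are all divisible by \<open>q\<close>, is \<open>O (q \<int>\<^sup>n)\<close>.  If \<open>G\<close> is the Gram matrix of a basis \<open>B\<close>
  of \<open>L\<close>, the hull is \<open>B\<close> applied to the kernel of \<open>G\<close> modulo \<open>q\<close>.  Elimination modulo \<open>q\<close> yields a basis of this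
  kernel together with a matrix \<open>Y\<close> such that \<open>G Y G \<equiv> G\<close>.  Scaled by \<open>1 / q\<close>, the hull is isomorphic to \<open>\<int>\<^sup>n\<close>,
  so the oracle for the integer lattice returns an orthonormal \<open>Q\<close> such that \<open>U = Q\<^sup>T B\<close> is integral and
  generates \<open>T (C + q \<int>\<^sup>n)\<close> for some signed permutation \<open>T\<close>.

  The matrix \<open>U Y U\<^sup>T\<close> is, modulo \<open>q\<close>, the orthogonal projector onto the code \<open>T C\<close>, so it depends on \<open>T C\<close> only and
  determines it.  What remains is to find a signed permutation that conjugates two such projectors \<open>P\<close>.  This
  is an isomorphism problem for weighted graphs on the vertices \<open>(i, \<plusminus>)\<close>: the edge between \<open>(i, s)\<close> and
  \<open>(j, t)\<close> has weight \<open>s t P\<^sub>i\<^sub>j mod q\<close>, and the edge between \<open>(i, +)\<close> and \<open>(i, -)\<close> has weight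
  \<open>q + P\<^sub>i\<^sub>i mod q\<close>, which exceeds all other weights and hence makes isomorphisms commute with the change of sign.
\<close>

section \<open>Integer matrices modulo an integer\<close>

text \<open>The program sees neither the rotations nor the code. Before any oracle call it can
  compute the Gram matrix \<open>G\<close>, which is integral and the same for \<open>B\<close> and
  for \<open>U\<close>; so \<open>Y\<close> is found first and still fits once the oracle has
  replaced \<open>B\<close> by \<open>U\<close>. LCD acts throughout as a cancellation rule: if
  \<open>q\<close> divides \<open>G z\<close>, it divides \<open>U z\<close>. The rule turns
  \<open>G Y G\<close> congruent to \<open>G\<close> into \<open>U Y U^T U\<close> congruent to
  \<open>U\<close>. It also bridges the gap between a prime and a prime power: elimination stops
  once no entry is a unit, when the residual is only known to be divisible by \<open>p\<close>, and
  cancellation raises this to \<open>q\<close>. Two oracle calls leave two unrelated signed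
  permutations open; passing from bases to projectors removes the choice of basis, so that only a
  signed permutation remains to be found. Doubling the vertices encodes its signs in a graph, which
  knows only permutations. Reduction modulo \<open>q\<close> after each pivot, and the fact that
  entries of orthonormal matrices are at most 1 in absolute value, keep the bit lengths linear in
  the input size.\<close>

definition mdvd :: "int \<Rightarrow> int mat \<Rightarrow> bool" where
  "mdvd m A \<longleftrightarrow> (\<forall>i<dim_row A. \<forall>j<dim_col A. m dvd A $$ (i, j))"

lemma mdvd_mult:
  assumes "mdvd a A" "mdvd b B" "dim_col A = dim_row B"
  shows "mdvd (a * b) (A * B)"
  using assms unfolding mdvd_def
  by (auto simp: scalar_prod_def intro!: dvd_sum mult_dvd_mono)

lemma mdvd_1 [simp]: "mdvd 1 A"
  by (simp add: mdvd_def)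

lemma mdvd_mult_left: "mdvd m B \<Longrightarrow> dim_col A = dim_row B \<Longrightarrow> mdvd m (A * B)"
  using mdvd_mult[of 1 A m B] by simp

lemma mdvd_mult_right: "mdvd m A \<Longrightarrow> dim_col A = dim_row B \<Longrightarrow> mdvd m (A * B)"
  using mdvd_mult[of m A 1 B] by simp

lemma mdvd_add: "mdvd m A \<Longrightarrow> mdvd m B \<Longrightarrow> dim_row A = dim_row B \<Longrightarrow> dim_col A = dim_col B \<Longrightarrow> mdvd m (A + B)"
  by (auto simp: mdvd_def)

lemma mdvd_minus: "mdvd m A \<Longrightarrow> mdvd m B \<Longrightarrow> dim_row A = dim_row B \<Longrightarrow> dim_col A = dim_col B \<Longrightarrow> mdvd m (A - B)"
  by (auto simp: mdvd_def)

lemma mdvd_smult: "mdvd m A \<Longrightarrow> mdvd m (k \<cdot>\<^sub>m A)"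
  by (auto simp: mdvd_def)

lemma mdvd_transpose: "mdvd m (transpose_mat A) \<longleftrightarrow> mdvd m A"
  by (auto simp: mdvd_def)

lemma mdvd_trans: "mdvd m A \<Longrightarrow> k dvd m \<Longrightarrow> mdvd k A"
  by (auto simp: mdvd_def intro: dvd_trans)

lemma mdvd_smult_cancel: "k \<noteq> 0 \<Longrightarrow> mdvd (k * m) (k \<cdot>\<^sub>m A) \<longleftrightarrow> mdvd m A"
  by (auto simp: mdvd_def)

lemma mdvd_smult_self: "mdvd m A \<Longrightarrow> mdvd (k * m) (k \<cdot>\<^sub>m A)"
  by (auto simp: mdvd_def)

text \<open>Noncommutative matrix algebra with all dimensions set to one \<open>n\<close>. In the
  general rules the inner dimensions occur only in the premises, where the simplifier would have to
  guess them.\<close>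

lemmas sq_mat_simps =
  mult_add_distrib_mat[of _ n n _ n] add_mult_distrib_mat[of _ n n _ _ n]
  mult_minus_distrib_mat[of _ n n _ n] minus_mult_distrib_mat[of _ n n _ _ n]
  assoc_mult_mat[of _ n n _ n _ n] mult_smult_distrib[of _ n n _ n] mult_smult_assoc_mat[of _ n n _ n]
  mult_carrier_mat[of _ n n _ n]
  for n

text \<open>
  If \<open>p\<^sup>a\<close> divides the residual \<open>D = G (1 - Y G)\<close>, triviality of the hull makes \<open>p\<^sup>a\<close> divide \<open>U (1 - Y G)\<close>,
  so that \<open>p\<^bsup>2a\<^esup>\<close> divides the Gram matrix \<open>D - G Y\<^sup>T D\<close> of the latter; as \<open>Y D\<close> vanishes modulo \<open>p\<^sup>e\<close>,
  this improves the exponent.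
\<close>

lemma prime_power_mdvd_lift:
  fixes U Y :: "int mat" and p :: int
  defines "G \<equiv> transpose_mat U * U"
  defines "D \<equiv> G - G * Y * G"
  assumes U: "U \<in> carrier_mat n n" and Y: "Y \<in> carrier_mat n n" and p: "p \<noteq> 0"
    and hull: "\<And>Z. Z \<in> carrier_mat n n \<Longrightarrow> mdvd (p ^ e) (G * Z) \<Longrightarrow> mdvd (p ^ e) (U * Z)"
    and pD: "mdvd p D" and YD: "mdvd (p ^ e) (Y * D)"
  shows "mdvd (p ^ e) D"
proof -
  define A where "A = 1\<^sub>m n - Y * G"
  have G: "G \<in> carrier_mat n n" and D: "D \<in> carrier_mat n n" and A: "A \<in> carrier_mat n n"
    using U Y unfolding G_def D_def A_def by auto
  have tG: "transpose_mat G = G"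
    unfolding G_def using U by (simp add: transpose_mult[of _ n n _ n])
  note C = U Y G D A transpose_carrier_mat[of U n n] transpose_carrier_mat[of Y n n]
  have GA: "G * A = D"
    unfolding A_def D_def using C by (simp add: sq_mat_simps[where n = n])
  have tA: "transpose_mat A = 1\<^sub>m n - G * transpose_mat Y"
    unfolding A_def using C tG by (simp add: transpose_minus[of _ n n] transpose_mult[of _ n n _ n])
  have sq: "transpose_mat (U * A) * (U * A) = D - G * (transpose_mat Y * D)"
  proof -
    have "transpose_mat (U * A) * (U * A) = transpose_mat A * (G * A)"
      unfolding G_def using C by (simp add: transpose_mult[of _ n n _ n] sq_mat_simps[where n = n])
    also have "\<dots> = D - G * (transpose_mat Y * D)"
      unfolding GA tA using C by (simp add: sq_mat_simps[where n = n])
    finally show ?thesis .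
  qed
  \<comment> \<open>To solve for \<open>D\<close>, replace the left factor of \<open>G Y^T D\<close>
    by \<open>D + G Y G\<close>. In the resulting \<open>G Y (G Y^T D)\<close> the bracket is
    \<open>D\<close> minus the Gram matrix of \<open>U A\<close>. Every term on the right then gains
    a factor \<open>p\<close> over what is known of \<open>D\<close>.\<close>
  have id: "D = (D - G * (transpose_mat Y * D)) + (D * (transpose_mat Y * D) + G * (Y * D)
       - G * (Y * (D - G * (transpose_mat Y * D))))"
  proof -
    have "D * (transpose_mat Y * D) = G * (transpose_mat Y * D) - G * (Y * (G * (transpose_mat Y * D)))"
      unfolding D_def[symmetric] using C
      by (subst (1) D_def) (simp add: sq_mat_simps[where n = n])
    moreover have "G * (Y * (D - G * (transpose_mat Y * D))) = G * (Y * D) - G * (Y * (G * (transpose_mat Y * D)))"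
      using C by (simp add: sq_mat_simps[where n = n])
    ultimately show ?thesis using C by (intro eq_matI) auto
  qed
  have "mdvd (p ^ a) D" if "1 \<le> a" "a \<le> e" for a
    using that
  proof (induction a rule: dec_induct)
    case base
    show ?case using pD by simp
  next
    case (step a)
    have pe: "p ^ e = p ^ (e - a) * p ^ a"
      using step by (simp add: power_add[symmetric])
    \<comment> \<open>The hull hypothesis speaks of the exponent \<open>e\<close> only. Scaling
      \<open>A\<close> by \<open>p^(e - a)\<close> lifts divisibility of \<open>G A = D\<close> by
      \<open>p^a\<close> to that exponent; afterwards the factor is cancelled.\<close>
    have "mdvd (p ^ e) (G * (p ^ (e - a) \<cdot>\<^sub>m A))"
      unfolding pe using step C GA by (simp add: mult_smult_distrib[of _ n n _ n] mdvd_smult_self)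
    then have "mdvd (p ^ e) (U * (p ^ (e - a) \<cdot>\<^sub>m A))"
      using hull C by auto
    then have UA: "mdvd (p ^ a) (U * A)"
      unfolding pe using C p by (simp add: mult_smult_distrib[of _ n n _ n] mdvd_smult_cancel)
    \<comment> \<open>This needs \<open>a\<close> at least 1, so the induction starts from
      \<open>pD\<close> and not from exponent 0.\<close>
    have "p ^ Suc a dvd p ^ a * p ^ a"
      unfolding power_add[symmetric] using step by (intro le_imp_power_dvd) auto
    then have 1: "mdvd (p ^ Suc a) (D - G * (transpose_mat Y * D))"
      using mdvd_mult[of "p ^ a" "transpose_mat (U * A)" "p ^ a" "U * A"] UA C sq
      by (simp add: mdvd_transpose mdvd_trans)
    have "mdvd (p ^ a * p ^ a) (D * (transpose_mat Y * D))"
      using step C by (intro mdvd_mult mdvd_mult_left) auto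
    then have 2: "mdvd (p ^ Suc a) (D * (transpose_mat Y * D))"
      using \<open>p ^ Suc a dvd p ^ a * p ^ a\<close> by (rule mdvd_trans)
    have "p ^ Suc a dvd p ^ e" using step by (intro le_imp_power_dvd) auto
    then have 3: "mdvd (p ^ Suc a) (G * (Y * D))"
      using mdvd_trans[OF YD] C by (intro mdvd_mult_left[of _ "Y * D"]) auto
    have 4: "mdvd (p ^ Suc a) (G * (Y * (D - G * (transpose_mat Y * D))))"
      using 1 C by (intro mdvd_mult_left[of _ "Y * _"] mdvd_mult_left[of _ "D - _"]) auto
    show ?case
      by (subst id, intro mdvd_add mdvd_minus 1 2 3 4) (use C in auto)
  qed
  then show ?thesis by (cases "e = 0") auto
qed

section \<open>Elimination modulo a prime power\<close>

text \<open>
  The program keeps, modulo \<open>q\<close>, the block matrix with blocks \<open>G - G Y G\<close>, \<open>1 - G Y\<close>, \<open>1 - Y G\<close>, \<open>- Y\<close>, starting from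
  \<open>Y = 0\<close>. One rank one update of the whole matrix pivots on a unit of the first block. \<open>Y\<close> itself is a
  ghost variable over the integers, which makes all matrix identities exact; \<open>S\<close> is the set of pivot columns.
\<close>

definition elim_inv :: "int \<Rightarrow> nat \<Rightarrow> int mat \<Rightarrow> (nat \<Rightarrow> nat \<Rightarrow> int) \<Rightarrow> int mat \<Rightarrow> nat set \<Rightarrow> bool" where
  "elim_inv q n G X Y S \<longleftrightarrow>
     Y \<in> carrier_mat n n \<and> mdvd q (Y * (G - G * Y * G)) \<and>
     (\<forall>a<n. \<forall>b<n.
        [X a b = (G - G * Y * G) $$ (a, b)] (mod q) \<and>
        [X a (n + b) = (1\<^sub>m n - G * Y) $$ (a, b)] (mod q) \<and>
        [X (n + a) b = (1\<^sub>m n - Y * G) $$ (a, b)] (mod q) \<and>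
        [X (n + a) (n + b) = - Y $$ (a, b)] (mod q) \<and>
        (b \<in> S \<longrightarrow> q dvd (1\<^sub>m n - Y * G) $$ (a, b)) \<and>
        (a \<notin> S \<longrightarrow> [(1\<^sub>m n - Y * G) $$ (a, b) = (if a = b then 1 else 0)] (mod q)))"

lemma elim_inv_init:
  assumes G: "G \<in> carrier_mat n n"
    and X: "\<And>a b. a < n \<Longrightarrow> b < n \<Longrightarrow> [X a b = G $$ (a, b)] (mod q)"
      "\<And>a b. a < n \<Longrightarrow> b < n \<Longrightarrow> X a (n + b) = (if a = b then 1 else 0)"
      "\<And>a b. a < n \<Longrightarrow> b < n \<Longrightarrow> X (n + a) b = (if a = b then 1 else 0)"
      "\<And>a b. a < n \<Longrightarrow> b < n \<Longrightarrow> X (n + a) (n + b) = 0"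
  shows "elim_inv q n G X (0\<^sub>m n n) {}"
proof -
  have [simp]: "G * 0\<^sub>m n n = 0\<^sub>m n n" "0\<^sub>m n n * G = 0\<^sub>m n n" "G - 0\<^sub>m n n = G"
    "1\<^sub>m n - 0\<^sub>m n n = (1\<^sub>m n :: int mat)"
    using G by (auto intro!: eq_matI)
  show ?thesis unfolding elim_inv_def using X G by (auto simp: mdvd_def)
qed

text \<open>\<open>P E R\<close> with a matrix unit \<open>E\<close> is the outer product of a
  column of \<open>P\<close> and a row of \<open>R\<close>. In this form the entrywise rank one
  update of the array becomes a matrix identity.\<close>

lemma unit_mat_conj:
  fixes P R :: "int mat"
  assumes "P \<in> carrier_mat n n" "R \<in> carrier_mat n n" "a < n" "b < n" "i < n" "j < n"
  shows "(P * (mat n n (\<lambda>(k, l). if k = j \<and> l = i then 1 else 0) * R)) $$ (a, b)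
    = P $$ (a, j) * R $$ (i, b)"
proof -
  define E :: "int mat" where "E = mat n n (\<lambda>(k, l). if k = j \<and> l = i then 1 else 0)"
  have ER: "(E * R) $$ (k, b) = (if k = j then R $$ (i, b) else 0)" if "k < n" for k
  proof -
    have "(E * R) $$ (k, b) = (\<Sum>l = 0..<n. (if k = j \<and> l = i then 1 else 0) * R $$ (l, b))"
      using assms that by (auto simp: E_def scalar_prod_def)
    also have "\<dots> = (\<Sum>l = 0..<n. if l = i then (if k = j then R $$ (i, b) else 0) else 0)"
      by (intro sum.cong) auto
    finally show ?thesis using assms by simp
  qed
  have "(P * (E * R)) $$ (a, b) = (\<Sum>k = 0..<n. P $$ (a, k) * (E * R) $$ (k, b))"
    using assms by (simp add: E_def scalar_prod_def)
  also have "\<dots> = (\<Sum>k = 0..<n. if k = j then P $$ (a, j) * R $$ (i, b) else 0)"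
    by (intro sum.cong) (auto simp: ER)
  finally show ?thesis using assms by (simp add: E_def)
qed

text \<open>Because \<open>G A = D\<close> and \<open>C G = D\<close>, adding \<open>d A E C\<close>
  to \<open>Y\<close> subtracts \<open>d D E D\<close> from \<open>D\<close>, \<open>d D E C\<close>
  from \<open>C\<close> and \<open>d A E D\<close> from \<open>A\<close>. With \<open>E\<close> the
  matrix unit at \<open>(j, i)\<close>, these are one and the same rank one update of the block
  matrix, with pivot entry \<open>(i, j)\<close>.\<close>

lemma elim_inv_pivot:
  assumes inv: "elim_inv q n G X Y S" and G: "G \<in> carrier_mat n n" and ij: "i < n" "j < n"
    and d: "[d * X i j = 1] (mod q)" and q: "1 < q"
    and X': "\<And>a b. a < 2 * n \<Longrightarrow> b < 2 * n \<Longrightarrow> [X' a b = X a b - d * X a j * X i b] (mod q)"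
  shows "\<exists>Y'. elim_inv q n G X' Y' (insert j S)"
proof -
  define D where "D = G - G * Y * G"
  define C where "C = 1\<^sub>m n - G * Y"
  define A where "A = 1\<^sub>m n - Y * G"
  define E :: "int mat" where "E = mat n n (\<lambda>(k, l). if k = j \<and> l = i then 1 else 0)"
  define Y' where "Y' = Y + d \<cdot>\<^sub>m (A * (E * C))"
  define D' where "D' = D - d \<cdot>\<^sub>m (D * (E * D))"
  note inv = inv[unfolded elim_inv_def, folded D_def C_def A_def]
  have Y: "Y \<in> carrier_mat n n" and YD: "mdvd q (Y * D)" using inv by auto
  have D: "D \<in> carrier_mat n n" and C: "C \<in> carrier_mat n n" and A: "A \<in> carrier_mat n n"
    and E: "E \<in> carrier_mat n n"
    unfolding D_def C_def A_def E_def using Y G by auto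
  note car = G Y D C A E
  have Y': "Y' \<in> carrier_mat n n" and D': "D' \<in> carrier_mat n n" unfolding Y'_def D'_def using car by auto
  have GA: "G * A = D" unfolding A_def D_def using car by (simp add: sq_mat_simps[where n = n])
  have CG: "C * G = D" unfolding C_def D_def using car by (simp add: sq_mat_simps[where n = n])
  have GY': "G * Y' = G * Y + d \<cdot>\<^sub>m (D * (E * C))"
    unfolding Y'_def using car GA[symmetric] by (simp add: sq_mat_simps[where n = n])
  have YG': "Y' * G = Y * G + d \<cdot>\<^sub>m (A * (E * D))"
    unfolding Y'_def using car CG[symmetric] by (simp add: sq_mat_simps[where n = n])
  have C'eq: "1\<^sub>m n - G * Y' = C - d \<cdot>\<^sub>m (D * (E * C))"
    unfolding GY' C_def using car by (intro eq_matI) auto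
  have A'eq: "1\<^sub>m n - Y' * G = A - d \<cdot>\<^sub>m (A * (E * D))"
    unfolding YG' A_def using car by (intro eq_matI) auto
  have D'eq: "G - G * Y' * G = D'"
  proof -
    have "G * Y' * G = G * Y * G + d \<cdot>\<^sub>m (D * (E * D))"
      unfolding GY' using car CG by (simp add: sq_mat_simps[where n = n])
    then show ?thesis unfolding D'_def D_def[symmetric] using car D_def by (intro eq_matI) auto
  qed
  have ent: "(P * (E * R)) $$ (a, b) = P $$ (a, j) * R $$ (i, b)"
    if "P \<in> carrier_mat n n" "R \<in> carrier_mat n n" "a < n" "b < n" for P R a b
    using unit_mat_conj[of P n R a b i j] that ij by (simp add: E_def)
  have XD: "[X a b = D $$ (a, b)] (mod q)" and XC: "[X a (n + b) = C $$ (a, b)] (mod q)"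
    and XA: "[X (n + a) b = A $$ (a, b)] (mod q)" and XY: "[X (n + a) (n + b) = - Y $$ (a, b)] (mod q)"
    if "a < n" "b < n" for a b
    using inv that by auto
  have dD: "[d * D $$ (i, j) = 1] (mod q)"
    using cong_trans[OF cong_sym[OF cong_scalar_left[OF XD[OF ij]]] d] .
  have upd: "[X' a b = x - d * y * z] (mod q)"
    if "[X a b = x] (mod q)" "[X a j = y] (mod q)" "[X i b = z] (mod q)" "a < 2 * n" "b < 2 * n" for a b x y z
    by (rule cong_trans[OF X'[OF that(4,5)]]) (intro cong_diff cong_mult that cong_refl)
  \<comment> \<open>\<open>W\<close> below is \<open>Y D'\<close>, which \<open>q\<close> divides
    because it divides \<open>Y D\<close>. As \<open>C D' = D' - G W\<close>, the correction
    \<open>A E (C D')\<close> splits into \<open>A E D'\<close> and a product that contains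
    \<open>W\<close>; both vanish modulo \<open>q\<close>.\<close>
  have YD': "mdvd q (Y' * D')"
  proof -
    have CD: "C * D = D - G * (Y * D)"
      unfolding C_def using car by (simp add: sq_mat_simps[where n = n])
    \<comment> \<open>\<open>E D'\<close> has at most one nonzero row, a copy of row
      \<open>i\<close> of \<open>D'\<close>. The pivot cancels it: it is \<open>1 - d D_ij\<close>
      times row \<open>i\<close> of \<open>D\<close>.\<close>
    have 1: "mdvd q (E * D')"
      unfolding mdvd_def
    proof (intro allI impI)
      fix a b assume "a < dim_row (E * D')" "b < dim_col (E * D')"
      then have ab: "a < n" "b < n" using E D' by auto
      have "(E * D') $$ (a, b) = (1\<^sub>m n * (E * D')) $$ (a, b)" using E D' by simp
      also have "\<dots> = (1\<^sub>m n) $$ (a, j) * (D $$ (i, b) - d * (D $$ (i, j) * D $$ (i, b)))"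
      proof -
        have "D' $$ (i, b) = D $$ (i, b) - d * (D $$ (i, j) * D $$ (i, b))"
          using ab ij car by (simp add: D'_def ent del: index_mult_mat(1))
        then show ?thesis using ent[OF one_carrier_mat D' ab] by metis
      qed
      also have "\<dots> = (1\<^sub>m n) $$ (a, j) * D $$ (i, b) * (1 - d * D $$ (i, j))"
        by (simp add: algebra_simps)
      also have "q dvd \<dots>"
        using dD by (simp add: cong_iff_dvd_diff dvd_diff_commute)
      finally show "q dvd (E * D') $$ (a, b)" .
    qed
    define W where "W = Y * D - d \<cdot>\<^sub>m (Y * D * (E * D))"
    have W: "W \<in> carrier_mat n n" unfolding W_def using car by auto
    have "Y * D' = W"
      unfolding D'_def W_def using car by (simp add: sq_mat_simps[where n = n])
    moreover have "C * D' = D' - G * W"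
    proof -
      have "C * D' = C * D - d \<cdot>\<^sub>m (C * D * (E * D))"
        unfolding D'_def using car by (simp add: sq_mat_simps[where n = n])
      moreover have "C * D * (E * D) = D * (E * D) - G * (Y * D * (E * D))"
        unfolding CD using car by (simp add: sq_mat_simps[where n = n])
      moreover have "G * W = G * (Y * D) - d \<cdot>\<^sub>m (G * (Y * D * (E * D)))"
        unfolding W_def using car by (simp add: sq_mat_simps[where n = n])
      ultimately show ?thesis
        using CD car unfolding D'_def
        by (intro eq_matI) (auto simp: algebra_simps simp del: index_mult_mat(1))
    qed
    moreover have "Y' * D' = Y * D' + d \<cdot>\<^sub>m (A * (E * (C * D')))"
      unfolding Y'_def using car D' by (simp add: sq_mat_simps[where n = n])
    moreover have "A * (E * (D' - G * W)) = A * (E * D') - A * (E * (G * W))"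
      using car D' W by (simp add: sq_mat_simps[where n = n])
    ultimately have *: "Y' * D' = W + d \<cdot>\<^sub>m (A * (E * D') - A * (E * (G * W)))"
      by simp
    have "mdvd q W"
      unfolding W_def using YD car by (intro mdvd_minus mdvd_smult mdvd_mult_right[of _ "Y * D"]) auto
    then have "mdvd q (E * (G * W))"
      using car W by (intro mdvd_mult_left[of _ "G * W"] mdvd_mult_left[of _ W]) auto
    then show ?thesis
      unfolding * using 1 \<open>mdvd q W\<close> car D' W
      by (intro mdvd_add mdvd_minus mdvd_smult mdvd_mult_left[of _ "E * _"]) auto
  qed
  have jS: "j \<notin> S"
  proof
    assume "j \<in> S"
    then have "q dvd A $$ (a, j)" if "a < n" for a using inv that ij by blast
    then have "q dvd (G * A) $$ (i, j)"
      using car ij by (auto simp: scalar_prod_def intro!: dvd_sum dvd_mult)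
    then have "q dvd d * D $$ (i, j)" unfolding GA by simp
    then have "q dvd 1" using dD by (metis cong_dvd_iff)
    then show False using q by auto
  qed
  \<comment> \<open>\<open>D = G A\<close> inherits the zero columns of \<open>A\<close>, so the
    update does not disturb earlier pivot columns.\<close>
  have DS: "q dvd D $$ (i, b)" if "b \<in> S" "b < n" for b
  proof -
    have "q dvd A $$ (a, b)" if "a < n" for a using inv that \<open>b \<in> S\<close> \<open>b < n\<close> by blast
    then have "q dvd (G * A) $$ (i, b)"
      using car ij that by (auto simp: scalar_prod_def intro!: dvd_sum dvd_mult)
    then show ?thesis unfolding GA .
  qed
  have "elim_inv q n G X' Y' (insert j S)"
    unfolding elim_inv_def D'eq C'eq A'eq
  proof (intro conjI allI impI Y' YD')
    fix a b assume ab: "a < n" "b < n"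
    show "[X' a b = D' $$ (a, b)] (mod q)"
      using upd[OF XD XD XD, of a b] ab ij car by (simp add: D'_def ent mult.assoc del: index_mult_mat(1))
    show "[X' a (n + b) = (C - d \<cdot>\<^sub>m (D * (E * C))) $$ (a, b)] (mod q)"
      using upd[OF XC XD XC, of a b] ab ij car by (simp add: ent mult.assoc del: index_mult_mat(1))
    show "[X' (n + a) b = (A - d \<cdot>\<^sub>m (A * (E * D))) $$ (a, b)] (mod q)"
      using upd[OF XA XA XD, of a b] ab ij car by (simp add: ent mult.assoc del: index_mult_mat(1))
    show "[X' (n + a) (n + b) = - Y' $$ (a, b)] (mod q)"
      using upd[OF XY XA XC, of a b] ab ij car by (simp add: Y'_def ent mult.assoc del: index_mult_mat(1))
    have A': "(A - d \<cdot>\<^sub>m (A * (E * D))) $$ (a, b) = A $$ (a, b) - A $$ (a, j) * (d * D $$ (i, b))"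
      using ab car by (simp add: ent del: index_mult_mat(1))
    show "q dvd (A - d \<cdot>\<^sub>m (A * (E * D))) $$ (a, b)" if "b \<in> insert j S"
    proof (cases "b = j")
      case True
      then have "(A - d \<cdot>\<^sub>m (A * (E * D))) $$ (a, b) = A $$ (a, j) * (1 - d * D $$ (i, j))"
        unfolding A' by (simp add: algebra_simps)
      then show ?thesis using dD by (simp add: cong_iff_dvd_diff dvd_diff_commute)
    next
      case False
      then show ?thesis unfolding A' using inv DS that ab by auto
    qed
    show "[(A - d \<cdot>\<^sub>m (A * (E * D))) $$ (a, b) = (if a = b then 1 else 0)] (mod q)"
      if "a \<notin> insert j S"
    proof -
      have "[A $$ (a, j) = (if a = j then 1 else 0)] (mod q)" using inv that ab ij by blast
      then have "[A $$ (a, j) * (d * D $$ (i, b)) = 0 * (d * D $$ (i, b))] (mod q)"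
        using that by (intro cong_mult) auto
      moreover have "[A $$ (a, b) = (if a = b then 1 else 0)] (mod q)" using inv that ab by blast
      ultimately have "[A $$ (a, b) - A $$ (a, j) * (d * D $$ (i, b)) = (if a = b then 1 else 0) - 0] (mod q)"
        by (intro cong_diff) auto
      then show ?thesis unfolding A' by simp
    qed
  qed
  then show ?thesis by blast
qed

section \<open>Trivial hulls\<close>

definition vdvd :: "int \<Rightarrow> int vec \<Rightarrow> bool" where
  "vdvd m v \<longleftrightarrow> (\<forall>i<dim_vec v. m dvd v $ i)"

lemma mdvd_mult_vec: "mdvd m A \<Longrightarrow> dim_vec v = dim_col A \<Longrightarrow> vdvd m (A *\<^sub>v v)"
  by (auto simp: mdvd_def vdvd_def scalar_prod_def intro!: dvd_sum)

lemma vdvd_mult_vec: "vdvd m v \<Longrightarrow> dim_vec v = dim_col A \<Longrightarrow> vdvd m (A *\<^sub>v v)"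
  by (auto simp: vdvd_def scalar_prod_def intro!: dvd_sum)

lemma mdvd_iff_cols: "mdvd m A \<longleftrightarrow> (\<forall>j<dim_col A. vdvd m (col A j))"
  by (auto simp: mdvd_def vdvd_def)

text \<open>The vectors \<open>U z\<close> with \<open>q\<close> dividing \<open>G z\<close> form
  the hull of the lattice generated by \<open>U\<close>. It counts as trivial if it lies in
  \<open>q\<close> times the integer lattice.\<close>

definition trivial_hull :: "int \<Rightarrow> nat \<Rightarrow> int mat \<Rightarrow> bool" where
  "trivial_hull q n U \<longleftrightarrow> U \<in> carrier_mat n n \<and>
     (\<forall>z\<in>carrier_vec n. vdvd q ((transpose_mat U * U) *\<^sub>v z) \<longrightarrow> vdvd q (U *\<^sub>v z))"

lemma trivial_hull_mat:
  assumes "trivial_hull q n U" "Z \<in> carrier_mat n n" "mdvd q (transpose_mat U * U * Z)"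
  shows "mdvd q (U * Z)"
proof -
  have U: "U \<in> carrier_mat n n" using assms by (simp add: trivial_hull_def)
  have "vdvd q (col (U * Z) j)" if "j < n" for j
  proof -
    have "vdvd q (col (transpose_mat U * U * Z) j)"
      using assms U that by (auto simp: mdvd_iff_cols)
    also have "col (transpose_mat U * U * Z) j = (transpose_mat U * U) *\<^sub>v col Z j"
      using assms U that by (intro col_mult2[of _ n n _ n]) auto
    finally have "vdvd q (U *\<^sub>v col Z j)"
      using assms(1,2) that by (auto simp: trivial_hull_def)
    then show ?thesis unfolding col_mult2[OF U assms(2) that] .
  qed
  then show ?thesis using assms U by (simp add: mdvd_iff_cols)
qed

text \<open>For a power of \<open>p\<close>, an entry that is not coprime to \<open>q\<close> is a
  multiple of \<open>p\<close>. So \<open>p\<close> divides the residual when elimination runs out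
  of pivots, and the trivial hull lifts this to \<open>q\<close>.\<close>

lemma elim_inv_final:
  assumes inv: "elim_inv q n (transpose_mat U * U) X Y S" and hull: "trivial_hull q n U"
    and q: "q = p ^ e" "prime p" "0 < e"
    and X: "\<And>a b. a < n \<Longrightarrow> b < n \<Longrightarrow> \<not> coprime (X a b) q"
  shows "mdvd q (transpose_mat U * U - transpose_mat U * U * Y * (transpose_mat U * U))"
proof -
  let ?D = "transpose_mat U * U - transpose_mat U * U * Y * (transpose_mat U * U)"
  have U: "U \<in> carrier_mat n n" using hull by (simp add: trivial_hull_def)
  have Y: "Y \<in> carrier_mat n n" using inv by (simp add: elim_inv_def)
  have "p dvd ?D $$ (a, b)" if "a < n" "b < n" for a b
  proof -
    have "[X a b = ?D $$ (a, b)] (mod q)" using inv that by (simp add: elim_inv_def)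
    then have "[X a b = ?D $$ (a, b)] (mod p)"
      by (rule cong_dvd_modulus) (use q in auto)
    moreover have "p dvd X a b"
      using X[OF that] q by (metis coprime_commute coprime_power_left_iff prime_imp_coprime)
    ultimately show ?thesis by (metis cong_dvd_iff)
  qed
  then have "mdvd p ?D" using U Y by (auto simp: mdvd_def)
  moreover have "mdvd q (Y * ?D)" using inv by (simp add: elim_inv_def)
  ultimately show ?thesis
    unfolding q(1) using trivial_hull_mat[OF hull] q U Y
    by (intro prime_power_mdvd_lift[of U n Y p e]) auto
qed

text \<open>
  The pivot columns of \<open>1 - Y G\<close> vanish modulo \<open>q\<close>; replacing their diagonal entries by \<open>q\<close> makes
  the columns a basis of the kernel of \<open>G\<close> modulo \<open>q\<close>.
\<close>

definition hull_basis :: "int \<Rightarrow> nat \<Rightarrow> (nat \<Rightarrow> nat \<Rightarrow> int) \<Rightarrow> int mat" where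
  "hull_basis q n X = mat n n (\<lambda>(a, b). if a = b \<and> X (n + b) b = 0 then q else X (n + a) b)"

text \<open>Modulo \<open>q\<close> the matrix agrees with \<open>A = 1 - Y G\<close>, and
  \<open>G A\<close> is the residual; this gives the first claim. For the second, \<open>A z\<close>
  is congruent to \<open>z\<close> whenever \<open>G z\<close> vanishes modulo
  \<open>q\<close>.\<close>

lemma hull_basis:
  assumes inv: "elim_inv q n G X Y S" and G: "G \<in> carrier_mat n n" and q: "1 < q"
    and D: "mdvd q (G - G * Y * G)"
    and X: "\<And>a b. a < n \<Longrightarrow> b < n \<Longrightarrow> 0 \<le> X (n + a) b \<and> X (n + a) b < q"
  shows "mdvd q (G * hull_basis q n X)"
    and "\<And>z. z \<in> carrier_vec n \<Longrightarrow> vdvd q (G *\<^sub>v z) \<Longrightarrow> \<exists>y\<in>carrier_vec n. z = hull_basis q n X *\<^sub>v y"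
proof -
  define A where "A = 1\<^sub>m n - Y * G"
  define K where "K = hull_basis q n X"
  have Y: "Y \<in> carrier_mat n n" using inv by (simp add: elim_inv_def)
  have A: "A \<in> carrier_mat n n" using Y G by (auto simp: A_def)
  have K: "K \<in> carrier_mat n n" by (simp add: K_def hull_basis_def)
  note car = G Y A K
  have XA: "[X (n + a) b = A $$ (a, b)] (mod q)" if "a < n" "b < n" for a b
    using inv that by (simp add: elim_inv_def A_def)
  have XS: "X (n + a) b = 0" if "b \<in> S" "a < n" "b < n" for a b
  proof -
    have "q dvd A $$ (a, b)" using inv that unfolding elim_inv_def A_def by blast
    then have "q dvd X (n + a) b" using XA[of a b] that by (metis cong_dvd_iff)
    then show ?thesis using X[of a b] that zdvd_not_zless[of "X (n + a) b" q] by force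
  qed
  have XN: "X (n + a) b = (if a = b then 1 else 0)" if "a \<notin> S" "a < n" "b < n" for a b
  proof -
    have "[A $$ (a, b) = (if a = b then 1 else 0)] (mod q)"
      using inv that unfolding elim_inv_def A_def by blast
    with XA[OF that(2,3)] have "[X (n + a) b = (if a = b then 1 else 0)] (mod q)"
      by (rule cong_trans)
    then show ?thesis using X[OF that(2,3)] q by (auto simp: cong_def)
  qed
  have KA: "q dvd K $$ (a, b) - A $$ (a, b)" if "a < n" "b < n" for a b
  proof -
    have "[K $$ (a, b) = X (n + a) b] (mod q)"
      using that by (auto simp: K_def hull_basis_def cong_def)
    then show ?thesis using XA[OF that] cong_trans by (auto simp: cong_iff_dvd_diff[symmetric])
  qed
  have "G * K = (G - G * Y * G) + G * (K - A)"
  proof -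
    have "G * A = G - G * Y * G" unfolding A_def using car by (simp add: sq_mat_simps[where n = n])
    moreover have "G * (K - A) = G * K - G * A" using car by (simp add: sq_mat_simps[where n = n])
    ultimately show ?thesis using car by (intro eq_matI) (auto simp del: index_mult_mat(1))
  qed
  moreover have "mdvd q (K - A)" using KA A K by (auto simp: mdvd_def)
  then have "mdvd q (G * (K - A))" using car by (intro mdvd_mult_left) auto
  ultimately show "mdvd q (G * hull_basis q n X)"
    using D car unfolding K_def[symmetric] by (auto intro!: mdvd_add)
  fix z assume z: "z \<in> carrier_vec n" and Gz: "vdvd q (G *\<^sub>v z)"
  \<comment> \<open>Outside \<open>S\<close> the rows of \<open>K\<close> are unit rows, which
    forces \<open>y\<close> to agree with \<open>z\<close> there. In a row \<open>l\<close> of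
    \<open>S\<close> the only pivot column that contributes is \<open>l\<close> itself, with entry
    \<open>q\<close>. So \<open>y\<close> at \<open>l\<close> is the quotient by \<open>q\<close> of
    what the other columns leave of \<open>z\<close>.\<close>
  define r where "r l = (\<Sum>m\<in>{0..<n} - S. K $$ (l, m) * z $ m)" for l
  define y where "y = vec n (\<lambda>l. if l \<in> S then (z $ l - r l) div q else z $ l)"
  have "z = K *\<^sub>v y"
  proof (intro eq_vecI)
    show "dim_vec z = dim_vec (K *\<^sub>v y)" using z K by simp
    fix l assume "l < dim_vec (K *\<^sub>v y)"
    then have l: "l < n" using K by simp
    have Ky: "(K *\<^sub>v y) $ l = (\<Sum>m = 0..<n. K $$ (l, m) * y $ m)"
      using l K by (simp add: scalar_prod_def y_def)
    show "z $ l = (K *\<^sub>v y) $ l"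
    proof (cases "l \<in> S")
      case False
      then have "(K *\<^sub>v y) $ l = (\<Sum>m = 0..<n. if m = l then z $ l else 0)"
        unfolding Ky using l by (intro sum.cong) (auto simp: K_def hull_basis_def XN y_def)
      then show ?thesis using l by simp
    next
      case True
      have "A *\<^sub>v z = z - Y *\<^sub>v (G *\<^sub>v z)"
        unfolding A_def using car z by (simp add: minus_mult_distrib_mat_vec[of _ n n])
      moreover have "vdvd q (Y *\<^sub>v (G *\<^sub>v z))" using vdvd_mult_vec[OF Gz, of Y] car z by simp
      ultimately have "q dvd z $ l - (A *\<^sub>v z) $ l"
        using l car z by (auto simp: vdvd_def)
      moreover have "q dvd (A *\<^sub>v z) $ l - r l"
      proof -
        have "(A *\<^sub>v z) $ l - r l = (\<Sum>m = 0..<n. A $$ (l, m) * z $ m) - (\<Sum>m = 0..<n. if m \<in> S then 0 else K $$ (l, m) * z $ m)"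
          unfolding r_def using l A z
          by (simp add: scalar_prod_def sum.If_cases Diff_eq Collect_neg_eq[symmetric])
        also have "\<dots> = (\<Sum>m = 0..<n. A $$ (l, m) * z $ m - (if m \<in> S then 0 else K $$ (l, m) * z $ m))"
          by (simp add: sum_subtractf)
        also have "q dvd \<dots>"
        proof (intro dvd_sum)
          fix m assume "m \<in> {0..<n}"
          then have m: "m < n" by simp
          show "q dvd A $$ (l, m) * z $ m - (if m \<in> S then 0 else K $$ (l, m) * z $ m)"
          proof (cases "m \<in> S")
            case True
            then show ?thesis using XA[OF l m] XS[OF True l m] by (simp add: cong_0_iff cong_sym_eq[of 0])
          next
            case False
            have "A $$ (l, m) * z $ m - K $$ (l, m) * z $ m = - ((K $$ (l, m) - A $$ (l, m)) * z $ m)"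
              by (simp add: algebra_simps)
            then show ?thesis using KA[OF l m] False by simp
          qed
        qed
        finally show ?thesis .
      qed
      ultimately have "q dvd (z $ l - (A *\<^sub>v z) $ l) + ((A *\<^sub>v z) $ l - r l)" by (rule dvd_add)
      then have "q dvd z $ l - r l" by simp
      have "(K *\<^sub>v y) $ l = (\<Sum>m = 0..<n. (if m = l then q * y $ l else 0) + (if m \<in> S then 0 else K $$ (l, m) * z $ m))"
        unfolding Ky using l True by (intro sum.cong) (auto simp: K_def hull_basis_def XS y_def)
      also have "\<dots> = q * y $ l + r l"
        unfolding sum.distrib r_def using l
        by (simp add: sum.If_cases Diff_eq Collect_neg_eq[symmetric])
      finally show ?thesis using \<open>q dvd z $ l - r l\<close> l True by (simp add: y_def)
    qed
  qed
  then show "\<exists>y\<in>carrier_vec n. z = hull_basis q n X *\<^sub>v y"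
    unfolding K_def by (auto simp: y_def)
qed

section \<open>Code projectors\<close>

text \<open>Modulo \<open>q\<close> this is the orthogonal projector onto the column span of
  \<open>U\<close>. The factorization through \<open>U\<close> is exact and not only modulo
  \<open>q\<close>, so that \<open>P\<close> maps integer vectors into the lattice itself.\<close>

definition code_projector :: "int \<Rightarrow> nat \<Rightarrow> int mat \<Rightarrow> int mat \<Rightarrow> bool" where
  "code_projector q n U P \<longleftrightarrow> U \<in> carrier_mat n n \<and> P \<in> carrier_mat n n \<and>
     mdvd q (P * U - U) \<and> mdvd q (P - transpose_mat P) \<and> (\<exists>R\<in>carrier_mat n n. P = U * R)"

lemma mdvd_transpose_diff:
  "A \<in> carrier_mat n n \<Longrightarrow> B \<in> carrier_mat n n \<Longrightarrow>
   mdvd m (transpose_mat A - transpose_mat B) \<longleftrightarrow> mdvd m (A - B)"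
  by (simp add: transpose_minus[symmetric, of _ n n] mdvd_transpose)

lemma mdvd_diff_trans:
  assumes "mdvd m (A - B)" "mdvd m (B - C)"
    "A \<in> carrier_mat n n" "B \<in> carrier_mat n n" "C \<in> carrier_mat n n"
  shows "mdvd m (A - C)"
proof -
  have "A - C = (A - B) + (B - C)" using assms by (intro eq_matI) auto
  then show ?thesis using mdvd_add[OF assms(1,2)] assms(3-5) by simp
qed

lemma mdvd_diff_sym:
  "mdvd m (A - B) \<Longrightarrow> A \<in> carrier_mat n n \<Longrightarrow> B \<in> carrier_mat n n \<Longrightarrow> mdvd m (B - A)"
  by (auto simp: mdvd_def dvd_diff_commute)

lemma mdvd_diff_mult_right:
  assumes "mdvd m (A - B)" "A \<in> carrier_mat n n" "B \<in> carrier_mat n n" "C \<in> carrier_mat n n"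
  shows "mdvd m (A * C - B * C)"
  using mdvd_mult_right[OF assms(1), of C] assms(2-) by (simp add: minus_mult_distrib_mat[of _ n n])

lemma mdvd_diff_mult_left:
  assumes "mdvd m (A - B)" "A \<in> carrier_mat n n" "B \<in> carrier_mat n n" "C \<in> carrier_mat n n"
  shows "mdvd m (C * A - C * B)"
  using mdvd_mult_left[OF assms(1), of C] assms(2-) by (simp add: mult_minus_distrib_mat[of _ n n])

text \<open>The trivial hull cancels the left factor of \<open>U^T U (1 - Y G)\<close>, so
  \<open>P\<close> fixes \<open>U\<close>. As \<open>G\<close> is symmetric, the same argument
  applies to the transpose of \<open>Y\<close>, so \<open>P^T\<close> fixes \<open>U\<close> and
  therefore \<open>P\<close>. Thus \<open>P\<close> is congruent to \<open>P^T P\<close>, which is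
  symmetric. Symmetry of \<open>Y\<close>, which depends on the pivots, is never asked for.\<close>

lemma code_projectorI:
  assumes hull: "trivial_hull q n U" and Y: "Y \<in> carrier_mat n n"
    and D: "mdvd q (transpose_mat U * U - transpose_mat U * U * Y * (transpose_mat U * U))"
  shows "code_projector q n U (U * Y * transpose_mat U)"
proof -
  define G where "G = transpose_mat U * U"
  have U: "U \<in> carrier_mat n n" using hull by (simp add: trivial_hull_def)
  have G: "G \<in> carrier_mat n n" and Ut: "transpose_mat U \<in> carrier_mat n n"
    and Yt: "transpose_mat Y \<in> carrier_mat n n"
    using U Y by (auto simp: G_def)
  note car = U Y G Ut Yt
  have tG: "transpose_mat G = G"
    unfolding G_def using car by (simp add: transpose_mult[of _ n n _ n])
  have fix_code: "mdvd q (U * Z * transpose_mat U * U - U)"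
    if Z: "Z \<in> carrier_mat n n" "mdvd q (G - G * Z * G)" for Z
  proof -
    have "G * (1\<^sub>m n - Z * G) = G - G * Z * G"
      using car Z by (simp add: sq_mat_simps[where n = n])
    then have "mdvd q (U * (1\<^sub>m n - Z * G))"
      using trivial_hull_mat[OF hull, of "1\<^sub>m n - Z * G"] Z
      unfolding G_def[symmetric] by (simp add: minus_carrier_mat[OF mult_carrier_mat[OF Z(1) G]])
    moreover have "U * (1\<^sub>m n - Z * G) = U - U * Z * transpose_mat U * U"
      unfolding G_def using car Z by (simp add: sq_mat_simps[where n = n])
    ultimately show ?thesis
      using mdvd_diff_sym[of q U "U * Z * transpose_mat U * U" n] car Z by (simp add: mult_carrier_mat[of _ n n _ n])
  qed
  define P where "P = U * Y * transpose_mat U"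
  have P: "P \<in> carrier_mat n n" and Pt: "transpose_mat P \<in> carrier_mat n n"
    unfolding P_def using car by auto
  have tP: "transpose_mat P = U * transpose_mat Y * transpose_mat U"
    unfolding P_def using car by (simp add: transpose_mult[of _ n n _ n])
  have 1: "mdvd q (P * U - U)" unfolding P_def by (intro fix_code Y) (use D G_def in auto)
  have "transpose_mat (G - G * Y * G) = G - G * transpose_mat Y * G"
    using car tG by (simp add: transpose_minus[of _ n n] transpose_mult[of _ n n _ n])
  then have "mdvd q (G - G * transpose_mat Y * G)"
    using D unfolding G_def[symmetric] by (simp only: mdvd_transpose[symmetric, of q "G - G * Y * G"])
  then have 2: "mdvd q (transpose_mat P * U - U)"
    unfolding tP by (intro fix_code Yt)
  have "mdvd q (transpose_mat P * U * (Y * transpose_mat U) - U * (Y * transpose_mat U))"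
    using 2 by (rule mdvd_diff_mult_right) (use car Pt in auto)
  then have 3: "mdvd q (transpose_mat P * P - P)"
    unfolding P_def using car Pt by (simp add: P_def sq_mat_simps[where n = n])
  then have "mdvd q (transpose_mat (transpose_mat P * P) - transpose_mat P)"
    using P Pt by (subst mdvd_transpose_diff) auto
  then have 4: "mdvd q (transpose_mat P * P - transpose_mat P)"
    using P Pt by (simp add: transpose_mult[of _ n n _ n])
  have "mdvd q (P - transpose_mat P)"
    using mdvd_diff_trans[OF mdvd_diff_sym[OF 3] 4] P Pt by auto
  moreover have "P = U * (Y * transpose_mat U)"
    unfolding P_def using car by (simp add: sq_mat_simps[where n = n])
  ultimately show ?thesis
    unfolding code_projector_def P_def[symmetric]
    using 1 P car mult_carrier_mat[OF Y Ut] by (intro conjI bexI[of _ "Y * transpose_mat U"])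
qed

text \<open>Projectors onto the same code absorb each other: \<open>P P'\<close> is congruent to
  \<open>P'\<close> and \<open>P' P\<close> to \<open>P\<close>. Transposing the second relation and
  using symmetry identifies the two. Hence neither the basis nor the pivots influence the projector
  modulo \<open>q\<close>.\<close>

lemma code_projector_unique:
  assumes P: "code_projector q n U P" and P': "code_projector q n U' P'"
    and V: "V \<in> carrier_mat n n" "U' = U * V" and W: "W \<in> carrier_mat n n" "U = U' * W"
  shows "mdvd q (P - P')"
proof -
  have car: "U \<in> carrier_mat n n" "U' \<in> carrier_mat n n" "P \<in> carrier_mat n n" "P' \<in> carrier_mat n n"
    "transpose_mat P \<in> carrier_mat n n" "transpose_mat P' \<in> carrier_mat n n"
    using P P' by (auto simp: code_projector_def)
  have absorb: "mdvd q (P1 * P2 - P2)"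
    if "code_projector q n U1 P1" and U2: "code_projector q n U2 P2" and "T \<in> carrier_mat n n" "U2 = U1 * T"
    for U1 U2 P1 P2 T
  proof -
    obtain R where R: "R \<in> carrier_mat n n" "P2 = U2 * R"
      using U2 by (auto simp: code_projector_def)
    have car': "U1 \<in> carrier_mat n n" "P1 \<in> carrier_mat n n" using that(1) by (auto simp: code_projector_def)
    have "mdvd q (P1 * U1 * (T * R) - U1 * (T * R))"
      by (rule mdvd_diff_mult_right[where n = n]) (use that U2 R car' in \<open>auto simp: code_projector_def\<close>)
    then show ?thesis using that R car' by (simp add: sq_mat_simps[where n = n])
  qed
  have 1: "mdvd q (P * P' - P')" by (rule absorb[OF P P' V])
  have 2: "mdvd q (P' * P - P)" by (rule absorb[OF P' P W])
  have sP: "mdvd q (P - transpose_mat P)" and sP': "mdvd q (P' - transpose_mat P')"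
    using P P' by (auto simp: code_projector_def)
  have "mdvd q (transpose_mat (P' * P) - transpose_mat P)"
    using 2 car by (subst mdvd_transpose_diff[of _ n]) auto
  then have a: "mdvd q (transpose_mat P * transpose_mat P' - transpose_mat P)"
    using car by (simp add: transpose_mult[of _ n n _ n])
  have b: "mdvd q (P * P' - P * transpose_mat P')"
    using sP' by (rule mdvd_diff_mult_left) (use car in auto)
  have c: "mdvd q (P * transpose_mat P' - transpose_mat P * transpose_mat P')"
    using sP by (rule mdvd_diff_mult_right) (use car in auto)
  have m: "A * B \<in> carrier_mat n n" if "A \<in> carrier_mat n n" "B \<in> carrier_mat n n" for A B :: "int mat"
    using that by auto
  have "mdvd q (P' - P * P')" using mdvd_diff_sym[OF 1] car m by blast
  then have "mdvd q (P' - P * transpose_mat P')"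
    by (rule mdvd_diff_trans[OF _ b]) (use car m in auto)
  then have "mdvd q (P' - transpose_mat P * transpose_mat P')"
    by (rule mdvd_diff_trans[OF _ c]) (use car m in auto)
  then have "mdvd q (P' - transpose_mat P)"
    by (rule mdvd_diff_trans[OF _ a]) (use car m in auto)
  then have "mdvd q (P' - P)"
    by (rule mdvd_diff_trans[OF _ mdvd_diff_sym[OF sP]]) (use car m in auto)
  then show ?thesis using car by (intro mdvd_diff_sym[of q P' P n]) auto
qed

lemma code_projector_conj:
  assumes P: "code_projector q n U P" and T: "T \<in> carrier_mat n n" "transpose_mat T * T = 1\<^sub>m n"
  shows "code_projector q n (T * U) (T * P * transpose_mat T)"
proof -
  obtain R where R: "R \<in> carrier_mat n n" "P = U * R"
    using P by (auto simp: code_projector_def)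
  have car: "U \<in> carrier_mat n n" "P \<in> carrier_mat n n" "T \<in> carrier_mat n n"
    "transpose_mat T \<in> carrier_mat n n" "transpose_mat P \<in> carrier_mat n n"
    using P T by (auto simp: code_projector_def)
  have TT: "transpose_mat T * (T * X) = X" if "X \<in> carrier_mat n n" for X
  proof -
    have "transpose_mat T * (T * X) = transpose_mat T * T * X"
      using car that by (simp add: assoc_mult_mat[of _ n n _ n _ n])
    then show ?thesis using T that by simp
  qed
  have "T * P * transpose_mat T * (T * U) - T * U = T * (P * U - U)"
    using car TT by (simp add: sq_mat_simps[where n = n])
  then have "mdvd q (T * P * transpose_mat T * (T * U) - T * U)"
    using mdvd_mult_left[of q "P * U - U" T] P car by (simp add: code_projector_def)
  moreover have "T * P * transpose_mat T - transpose_mat (T * P * transpose_mat T)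
    = T * (P - transpose_mat P) * transpose_mat T"
    using car by (simp add: sq_mat_simps[where n = n] transpose_mult[of _ n n _ n])
  then have "mdvd q (T * P * transpose_mat T - transpose_mat (T * P * transpose_mat T))"
    using mdvd_mult_right[OF mdvd_mult_left[of q "P - transpose_mat P" T], of "transpose_mat T"] P car
    by (simp add: code_projector_def)
  moreover have "T * P * transpose_mat T = T * U * (R * transpose_mat T)"
    using car R by (simp add: sq_mat_simps[where n = n])
  moreover have "R * transpose_mat T \<in> carrier_mat n n" using car R by auto
  ultimately show ?thesis
    unfolding code_projector_def using mult_carrier_mat[OF car(3,1)]
      mult_carrier_mat[OF mult_carrier_mat[OF car(3,2)] car(4)]
    by (intro conjI bexI[of _ "R * transpose_mat T"])
qed

text \<open>This recovers the lattice from the projector alone: \<open>P x\<close> lies in the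
  lattice exactly, and \<open>P x - x\<close> does so as a multiple of \<open>q\<close>.\<close>

lemma code_projector_fixes_iff:
  assumes P: "code_projector q n U P" and x: "x \<in> carrier_vec n"
    and full: "\<And>x. x \<in> carrier_vec n \<Longrightarrow> \<exists>z\<in>carrier_vec n. U *\<^sub>v z = q \<cdot>\<^sub>v x"
  shows "vdvd q (P *\<^sub>v x - x) \<longleftrightarrow> (\<exists>z\<in>carrier_vec n. x = U *\<^sub>v z)"
proof
  obtain R where R: "R \<in> carrier_mat n n" "P = U * R"
    using P by (auto simp: code_projector_def)
  have car: "U \<in> carrier_mat n n" "P \<in> carrier_mat n n" using P by (auto simp: code_projector_def)
  assume *: "vdvd q (P *\<^sub>v x - x)"
  define w where "w = vec n (\<lambda>i. (P *\<^sub>v x - x) $ i div q)"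
  have w: "w \<in> carrier_vec n" by (simp add: w_def)
  have qw: "P *\<^sub>v x - x = q \<cdot>\<^sub>v w"
    using * car x by (intro eq_vecI) (auto simp: w_def vdvd_def)
  obtain z where z: "z \<in> carrier_vec n" "U *\<^sub>v z = q \<cdot>\<^sub>v w" using full[OF w] by blast
  have "x = P *\<^sub>v x - (P *\<^sub>v x - x)" using car x by (intro eq_vecI) auto
  also have "\<dots> = U *\<^sub>v (R *\<^sub>v x) - U *\<^sub>v z" unfolding qw z(2) unfolding R(2)
    using car R x by simp
  also have "\<dots> = U *\<^sub>v (R *\<^sub>v x - z)"
    using car R x z by (simp add: mult_minus_distrib_mat_vec[of _ n n])
  finally show "\<exists>z\<in>carrier_vec n. x = U *\<^sub>v z"
    using R x z by (intro bexI[of _ "R *\<^sub>v x - z"]) auto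
next
  have car: "U \<in> carrier_mat n n" "P \<in> carrier_mat n n" using P by (auto simp: code_projector_def)
  assume "\<exists>z\<in>carrier_vec n. x = U *\<^sub>v z"
  then obtain z where z: "z \<in> carrier_vec n" "x = U *\<^sub>v z" by blast
  have "P *\<^sub>v x - x = (P * U - U) *\<^sub>v z"
    unfolding z(2) using car z by (simp add: minus_mult_distrib_mat_vec[of _ n n])
  then show "vdvd q (P *\<^sub>v x - x)"
    using mdvd_mult_vec[of q "P * U - U" z] P z car by (simp add: code_projector_def)
qed

section \<open>Bases of rotated Construction A lattices\<close>

abbreviation rvec :: "int vec \<Rightarrow> real vec" where
  "rvec \<equiv> map_vec real_of_int"

abbreviation rmat :: "int mat \<Rightarrow> real mat" where
  "rmat \<equiv> map_mat real_of_int"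

lemma rvec_inj: "rvec x = rvec y \<longleftrightarrow> x = y"
  by (auto simp: vec_eq_iff)

lemma rmat_mult_rvec:
  "A \<in> carrier_mat n m \<Longrightarrow> v \<in> carrier_vec m \<Longrightarrow> rmat A *\<^sub>v rvec v = rvec (A *\<^sub>v v)"
  by (intro eq_vecI) (auto simp: scalar_prod_def)

lemma mult_mat_unit_vec:
  fixes A :: "'a :: semiring_1 mat"
  shows "A \<in> carrier_mat n m \<Longrightarrow> j < m \<Longrightarrow> A *\<^sub>v unit_vec m j = col A j"
  by (intro eq_vecI) auto

lemma smult_mat_mult_vec:
  fixes A :: "'a :: comm_ring_1 mat"
  shows "A \<in> carrier_mat n m \<Longrightarrow> v \<in> carrier_vec m \<Longrightarrow> (k \<cdot>\<^sub>m A) *\<^sub>v v = k \<cdot>\<^sub>v (A *\<^sub>v v)"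
  by (intro eq_vecI) (auto simp: scalar_prod_def sum_distrib_left mult.assoc)

lemma lattice_of_cols:
  fixes B :: "real mat"
  assumes B: "B \<in> carrier_mat n n"
  shows "vec_module.lattice_of n (cols B) = (\<lambda>z. B *\<^sub>v rvec z) ` carrier_vec n"
proof -
  have *: "abelian_monoid.sumlist (module_vec TYPE(real) n)
      (map (\<lambda>i. of_int (c i) \<cdot>\<^sub>v cols B ! i) [0..<length (cols B)]) = B *\<^sub>v rvec (vec n c)"
    for c :: "nat \<Rightarrow> int"
  proof -
    have car: "x \<in> carrier_vec n" if "x \<in> set (map (\<lambda>i. of_int (c i) \<cdot>\<^sub>v cols B ! i) [0..<length (cols B)])" for x
      using that B by auto
    show ?thesis
    proof (intro eq_vecI)
      fix i assume "i < dim_vec (B *\<^sub>v rvec (vec n c))"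
      then have i: "i < n" using B by simp
      show "abelian_monoid.sumlist (module_vec TYPE(real) n)
          (map (\<lambda>i. of_int (c i) \<cdot>\<^sub>v cols B ! i) [0..<length (cols B)]) $ i
        = (B *\<^sub>v rvec (vec n c)) $ i"
        by (subst vec_module.sumlist_vec_index[OF car i], assumption)
          (use i B in \<open>simp add: scalar_prod_def interv_sum_list_conv_sum_set_nat o_def,
            intro sum.cong, auto\<close>)
    qed (subst vec_module.sumlist_dim[OF car], assumption, use B in simp)
  qed
  show ?thesis
  proof (intro equalityI subsetI)
    fix x assume "x \<in> vec_module.lattice_of n (cols B)"
    then show "x \<in> (\<lambda>z. B *\<^sub>v rvec z) ` carrier_vec n"
      unfolding vec_module.lattice_of_def * by auto
  next
    fix x assume "x \<in> (\<lambda>z. B *\<^sub>v rvec z) ` carrier_vec n"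
    then obtain z where z: "z \<in> carrier_vec n" "x = B *\<^sub>v rvec z" by auto
    moreover from z have "vec n (\<lambda>i. z $ i) = z" by (intro eq_vecI) auto
    ultimately have "x = B *\<^sub>v rvec (vec n (\<lambda>i. z $ i))" by simp
    then show "x \<in> vec_module.lattice_of n (cols B)"
      unfolding vec_module.lattice_of_def * by auto
  qed
qed

section \<open>Orthonormal matrices and integral coordinates\<close>

lemma orthonormal_cancel:
  assumes "orthonormal_mat n Q"
  shows "X \<in> carrier_mat n n \<Longrightarrow> transpose_mat Q * (Q * X) = X"
    and "v \<in> carrier_vec n \<Longrightarrow> transpose_mat Q *\<^sub>v (Q *\<^sub>v v) = v"
    and "Q * transpose_mat Q = 1\<^sub>m n"
    and "v \<in> carrier_vec n \<Longrightarrow> Q *\<^sub>v (transpose_mat Q *\<^sub>v v) = v"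
    and "orthonormal_mat n (transpose_mat Q)"
proof -
  have Q: "Q \<in> carrier_mat n n" "transpose_mat Q * Q = 1\<^sub>m n" "transpose_mat Q \<in> carrier_mat n n"
    using assms by (auto simp: orthonormal_mat_def)
  show "transpose_mat Q * (Q * X) = X" if "X \<in> carrier_mat n n"
    using assoc_mult_mat[OF Q(3,1) that] that unfolding Q(2) by simp
  show "transpose_mat Q *\<^sub>v (Q *\<^sub>v v) = v" if "v \<in> carrier_vec n"
    using assoc_mult_mat_vec[OF Q(3,1) that] that unfolding Q(2) by simp
  show *: "Q * transpose_mat Q = 1\<^sub>m n"
    by (rule mat_mult_left_right_inverse[OF Q(3,1,2)])
  show "Q *\<^sub>v (transpose_mat Q *\<^sub>v v) = v" if "v \<in> carrier_vec n"
    using assoc_mult_mat_vec[OF Q(1,3) that] that unfolding * by simp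
  show "orthonormal_mat n (transpose_mat Q)"
    unfolding orthonormal_mat_def using Q * by simp
qed

lemma orthonormal_mult:
  assumes "orthonormal_mat n Q" "orthonormal_mat n R"
  shows "orthonormal_mat n (Q * R)"
proof -
  have Q: "Q \<in> carrier_mat n n" "R \<in> carrier_mat n n" "transpose_mat Q \<in> carrier_mat n n" "transpose_mat R \<in> carrier_mat n n"
    "transpose_mat R * R = 1\<^sub>m n"
    using assms by (auto simp: orthonormal_mat_def)
  have "transpose_mat (Q * R) * (Q * R) = transpose_mat R * (transpose_mat Q * (Q * R))"
    using Q by (simp add: transpose_mult[of _ n n _ n] assoc_mult_mat[of _ n n _ n _ n])
  then show ?thesis
    using Q orthonormal_cancel(1)[OF assms(1) Q(2)] by (simp add: orthonormal_mat_def)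
qed

section \<open>Lattices of LCD codes and the query about their hull\<close>

definition code_lattice :: "nat \<Rightarrow> nat \<Rightarrow> int vec set \<Rightarrow> int vec set" where
  "code_lattice q n C = {x \<in> carrier_vec n. map_vec (\<lambda>a. a mod int q) x \<in> C}"

lemma construction_A_code_lattice: "construction_A q n C = rvec ` code_lattice q n C"
  by (simp add: construction_A_def code_lattice_def)

lemma int_factor_of_cols:
  fixes A B :: "real mat"
  assumes A: "A \<in> carrier_mat n n" and B: "B \<in> carrier_mat n n"
    and cols: "\<And>j. j < n \<Longrightarrow> \<exists>x\<in>carrier_vec n. col B j = A *\<^sub>v rvec x"
  obtains W where "W \<in> carrier_mat n n" "B = A * rmat W"
proof -
  obtain f where f: "\<And>j. j < n \<Longrightarrow> f j \<in> carrier_vec n \<and> col B j = A *\<^sub>v rvec (f j)"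
    using cols by metis
  define W where "W = mat n n (\<lambda>(i, j). f j $ i)"
  have W: "W \<in> carrier_mat n n" "rmat W \<in> carrier_mat n n" by (auto simp: W_def)
  have "B = A * rmat W"
  proof (rule mat_col_eqI)
    fix j assume "j < dim_col (A * rmat W)"
    then have j: "j < n" using W by simp
    have "rvec (f j) = col (rmat W) j" using f[OF j] j by (intro eq_vecI) (auto simp: W_def)
    then show "col B j = col (A * rmat W) j"
      unfolding col_mult2[OF A W(2) j] using f[OF j] by metis
  qed (use A B W in auto)
  with W(1) show ?thesis by (rule that)
qed

lemma col_eq_mult_rvec: "A \<in> carrier_mat n n \<Longrightarrow> j < n \<Longrightarrow> col A j = A *\<^sub>v rvec (unit_vec n j)"
proof -
  assume A: "A \<in> carrier_mat n n" "j < n"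
  have "rvec (unit_vec n j) = unit_vec n j" by (intro eq_vecI) (auto simp: unit_vec_def)
  then show ?thesis using mult_mat_unit_vec[OF A] by simp
qed

lemma int_cols_factor:
  assumes B: "B \<in> carrier_mat n n" and Q: "orthonormal_mat n Q"
    and cols: "\<And>z. z \<in> carrier_vec n \<Longrightarrow> \<exists>x\<in>carrier_vec n. B *\<^sub>v rvec z = Q *\<^sub>v rvec x"
  obtains U where "U \<in> carrier_mat n n" "B = Q * rmat U"
proof (rule int_factor_of_cols[OF _ B])
  show "Q \<in> carrier_mat n n" using Q by (simp add: orthonormal_mat_def)
  show "\<exists>x\<in>carrier_vec n. col B j = Q *\<^sub>v rvec x" if "j < n" for j
    using cols[of "unit_vec n j"] col_eq_mult_rvec[OF B that] by simp
qed (rule that)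

text \<open>If \<open>U^T U z\<close> vanishes modulo \<open>q\<close>, then \<open>U z\<close>
  reduced modulo \<open>q\<close> is a codeword orthogonal to every codeword, because each codeword
  is itself of the form \<open>U y\<close>. By LCD it is zero. This is the only place where the LCD
  property is used directly.\<close>

lemma LCD_basis_trivial_hull:
  assumes q: "1 < q" and C: "LCD_code q n C" and Q: "orthonormal_mat n Q"
    and B: "B \<in> carrier_mat n n"
    and L: "(\<lambda>z. B *\<^sub>v rvec z) ` carrier_vec n = mat_image Q (construction_A q n C)"
  obtains U where "U \<in> carrier_mat n n" "B = Q * rmat U" "trivial_hull (int q) n U"
    "(\<lambda>z. U *\<^sub>v z) ` carrier_vec n = code_lattice q n C"
    "\<And>x. x \<in> carrier_vec n \<Longrightarrow> \<exists>z\<in>carrier_vec n. U *\<^sub>v z = int q \<cdot>\<^sub>v x"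
proof -
  have Qc: "Q \<in> carrier_mat n n" using Q by (simp add: orthonormal_mat_def)
  have L': "(\<lambda>z. B *\<^sub>v rvec z) ` carrier_vec n = (\<lambda>x. Q *\<^sub>v rvec x) ` code_lattice q n C"
    using L by (simp add: mat_image_def construction_A_code_lattice image_image)
  have cl: "code_lattice q n C \<subseteq> carrier_vec n" by (auto simp: code_lattice_def)
  obtain U where U: "U \<in> carrier_mat n n" "B = Q * rmat U"
  proof (rule int_cols_factor[OF B Q])
    fix z :: "int vec" assume "z \<in> carrier_vec n"
    then have "B *\<^sub>v rvec z \<in> (\<lambda>x. Q *\<^sub>v rvec x) ` code_lattice q n C" using L' by blast
    then show "\<exists>x\<in>carrier_vec n. B *\<^sub>v rvec z = Q *\<^sub>v rvec x" using cl by blast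
  qed
  have inj: "x = y" if "Q *\<^sub>v rvec x = Q *\<^sub>v rvec y" "x \<in> carrier_vec n" "y \<in> carrier_vec n" for x y
  proof -
    have "transpose_mat Q *\<^sub>v (Q *\<^sub>v rvec x) = transpose_mat Q *\<^sub>v (Q *\<^sub>v rvec y)" using that by simp
    then have "rvec x = rvec y"
      using orthonormal_cancel(2)[OF Q, of "rvec x"] orthonormal_cancel(2)[OF Q, of "rvec y"] that(2,3) by simp
    then show ?thesis by (simp only: rvec_inj)
  qed
  have BU: "B *\<^sub>v rvec z = Q *\<^sub>v rvec (U *\<^sub>v z)" if "z \<in> carrier_vec n" for z
    using U Qc that by (simp add: rmat_mult_rvec[of U n n, symmetric])
  have img: "(\<lambda>z. U *\<^sub>v z) ` carrier_vec n = code_lattice q n C"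
  proof (intro equalityI subsetI)
    fix x assume "x \<in> (\<lambda>z. U *\<^sub>v z) ` carrier_vec n"
    then obtain z where z: "z \<in> carrier_vec n" "x = U *\<^sub>v z" by auto
    then obtain y where y: "y \<in> code_lattice q n C" "B *\<^sub>v rvec z = Q *\<^sub>v rvec y" using L' by blast
    then have "x = y" using z BU cl U by (intro inj) auto
    then show "x \<in> code_lattice q n C" using y by simp
  next
    fix x assume x: "x \<in> code_lattice q n C"
    then have "Q *\<^sub>v rvec x \<in> (\<lambda>z. B *\<^sub>v rvec z) ` carrier_vec n" using L' by blast
    then obtain z where z: "z \<in> carrier_vec n" "Q *\<^sub>v rvec x = B *\<^sub>v rvec z" by auto
    have "x = U *\<^sub>v z" using z BU[of z] x cl U by (intro inj) auto
    then show "x \<in> (\<lambda>z. U *\<^sub>v z) ` carrier_vec n" using z by auto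
  qed
  have lin: "linear_code q n C" and LCD: "C \<inter> dual_code q n C = {0\<^sub>v n}"
    using C by (auto simp: LCD_code_def)
  have CZ: "C \<subseteq> carrier (Zq_space q n)"
    using lin subgroup.subset[of C "add_monoid (Zq_space q n)"]
    by (simp add: linear_code_def Module.submodule_def)
  have car: "c \<in> carrier_vec n" "map_vec (\<lambda>a. a mod int q) c = c" if "c \<in> C" for c
  proof -
    show "c \<in> carrier_vec n" using that CZ by (auto simp: Zq_space_def)
    then show "map_vec (\<lambda>a. a mod int q) c = c"
      using that CZ q by (intro eq_vecI) (auto simp: Zq_space_def residue_ring_def)
  qed
  \<comment> \<open>Multiples of \<open>q\<close> reduce to the zero vector, which is a
    codeword.\<close>
  have full: "\<exists>z\<in>carrier_vec n. U *\<^sub>v z = int q \<cdot>\<^sub>v x" if "x \<in> carrier_vec n" for x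
  proof -
    have "map_vec (\<lambda>a. a mod int q) (int q \<cdot>\<^sub>v x) = 0\<^sub>v n" using that by (intro eq_vecI) auto
    then have "int q \<cdot>\<^sub>v x \<in> code_lattice q n C" using LCD that by (auto simp: code_lattice_def)
    then show ?thesis unfolding img[symmetric] by (metis imageE)
  qed
  have hull: "trivial_hull (int q) n U"
    unfolding trivial_hull_def
  proof (intro conjI U ballI impI)
    fix z :: "int vec" assume z: "z \<in> carrier_vec n" and d: "vdvd (int q) ((transpose_mat U * U) *\<^sub>v z)"
    define x where "x = U *\<^sub>v z"
    define r where "r = map_vec (\<lambda>a. a mod int q) x"
    have x: "x \<in> carrier_vec n" using U z by (simp add: x_def)
    have rC: "r \<in> C" using img z unfolding r_def x_def code_lattice_def by blast
    have "(r \<bullet> c) mod int q = 0" if c: "c \<in> C" for c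
    proof -
      have "c \<in> code_lattice q n C" using car[OF c] c by (simp add: code_lattice_def)
      then obtain y where y: "y \<in> carrier_vec n" "c = U *\<^sub>v y" unfolding img[symmetric] by auto
      have "int q dvd ((transpose_mat U * U) *\<^sub>v z) \<bullet> y"
        using d y U by (auto simp: vdvd_def scalar_prod_def[of _ y] intro!: dvd_sum)
      also have "((transpose_mat U * U) *\<^sub>v z) \<bullet> y = (transpose_mat U *\<^sub>v x) \<bullet> y"
        unfolding x_def using U z by (simp add: assoc_mult_mat_vec[of _ n n _ n])
      also have "\<dots> = x \<bullet> c"
        unfolding y(2) using transpose_vec_mult_scalar[OF U(1) y(1) x]
          comm_scalar_prod[of "U *\<^sub>v y" n x] U x y by simp
      finally have "(x \<bullet> c) mod int q = 0" by simp
      moreover have "(r \<bullet> c) mod int q = (x \<bullet> c) mod int q"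
        unfolding scalar_prod_def r_def using x car[OF c]
        by (subst (1 2) mod_sum_eq[symmetric]) (simp add: mod_mult_left_eq)
      ultimately show ?thesis by simp
    qed
    then have "r \<in> dual_code q n C" using rC CZ by (auto simp: dual_code_def)
    then have "r = 0\<^sub>v n" using rC LCD by auto
    then have "(map_vec (\<lambda>a. a mod int q) x) $ i = 0" if "i < n" for i using that by (simp add: r_def)
    then show "vdvd (int q) (U *\<^sub>v z)"
      unfolding x_def[symmetric] using x by (auto simp: vdvd_def)
  qed
  show ?thesis by (rule that[OF U hull img full])
qed

lemma orthonormal_int:
  assumes "T \<in> carrier_mat n n"
  shows "orthonormal_mat n (rmat T) \<longleftrightarrow> transpose_mat T * T = 1\<^sub>m n"
proof -
  have "transpose_mat (rmat T) * rmat T = rmat (transpose_mat T * T)"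
    using assms by (simp add: of_int_hom.mat_hom_mult[of _ n n _ n] map_mat_transpose)
  moreover have "rmat (1\<^sub>m n) = 1\<^sub>m n" by (intro eq_matI) auto
  moreover have "rmat A = rmat B \<longleftrightarrow> A = B" for A B by (auto simp: mat_eq_iff)
  ultimately have "transpose_mat (rmat T) * rmat T = 1\<^sub>m n \<longleftrightarrow> transpose_mat T * T = 1\<^sub>m n" by metis
  then show ?thesis using assms by (simp add: orthonormal_mat_def)
qed

text \<open>The columns of \<open>K\<close> generate the kernel of \<open>G\<close> modulo
  \<open>q\<close>. \<open>U\<close> maps this kernel into the multiples of \<open>q\<close> because
  the hull is trivial, and onto them by \<open>full\<close>. Dividing by \<open>q\<close> leaves a
  rotated integer lattice.\<close>

lemma hull_query_valid:
  assumes q: "1 < q" and U: "trivial_hull q n U" and Q: "orthonormal_mat n Q" and B: "B = Q * rmat U"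
    and full: "\<And>x. x \<in> carrier_vec n \<Longrightarrow> \<exists>z\<in>carrier_vec n. U *\<^sub>v z = q \<cdot>\<^sub>v x"
    and K: "K \<in> carrier_mat n n" "mdvd q (transpose_mat U * U * K)"
      "\<And>z. z \<in> carrier_vec n \<Longrightarrow> vdvd q ((transpose_mat U * U) *\<^sub>v z) \<Longrightarrow> \<exists>y\<in>carrier_vec n. z = K *\<^sub>v y"
  shows "lattice_basis n ((1 / real_of_int q) \<cdot>\<^sub>m (B * rmat K)) (mat_image Q (Zn n))"
proof -
  define M where "M = (1 / real_of_int q) \<cdot>\<^sub>m (B * rmat K)"
  have Uc: "U \<in> carrier_mat n n" using U by (simp add: trivial_hull_def)
  have Qc: "Q \<in> carrier_mat n n" using Q by (simp add: orthonormal_mat_def)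
  have Bc: "B \<in> carrier_mat n n" unfolding B using Qc Uc by simp
  have M: "M \<in> carrier_mat n n" unfolding M_def using Bc K by simp
  have MK: "M *\<^sub>v rvec y = (1 / real_of_int q) \<cdot>\<^sub>v (Q *\<^sub>v rvec (U *\<^sub>v (K *\<^sub>v y)))" if y: "y \<in> carrier_vec n" for y
  proof -
    have "rvec (U *\<^sub>v (K *\<^sub>v y)) = rmat U *\<^sub>v (rmat K *\<^sub>v rvec y)"
      using Uc K y by (simp add: rmat_mult_rvec[of _ n n])
    moreover have "M *\<^sub>v rvec y = (1 / real_of_int q) \<cdot>\<^sub>v (B *\<^sub>v (rmat K *\<^sub>v rvec y))"
      unfolding M_def using Bc K y by (simp add: smult_mat_mult_vec[of _ n n])
    moreover have "B *\<^sub>v (rmat K *\<^sub>v rvec y) = Q *\<^sub>v (rmat U *\<^sub>v (rmat K *\<^sub>v rvec y))"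
      unfolding B using Qc Uc K y by (intro assoc_mult_mat_vec[of _ n n _ n]) auto
    ultimately show ?thesis by simp
  qed
  have sc: "(1 / real_of_int q) \<cdot>\<^sub>v (Q *\<^sub>v rvec (q \<cdot>\<^sub>v x)) = Q *\<^sub>v rvec x" if x: "x \<in> carrier_vec n" for x
  proof -
    have "rvec (q \<cdot>\<^sub>v x) = real_of_int q \<cdot>\<^sub>v rvec x" by (intro eq_vecI) auto
    then show ?thesis using q Qc x by (simp add: mult_mat_vec[of _ n n] smult_smult_assoc)
  qed
  have img: "(\<lambda>y. M *\<^sub>v rvec y) ` carrier_vec n = mat_image Q (Zn n)"
  proof (intro equalityI subsetI)
    fix v assume "v \<in> (\<lambda>y. M *\<^sub>v rvec y) ` carrier_vec n"
    then obtain y where y: "y \<in> carrier_vec n" "v = M *\<^sub>v rvec y" by auto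
    have "vdvd q ((U * K) *\<^sub>v y)"
      using mdvd_mult_vec[OF trivial_hull_mat[OF U K(1,2)], of y] y K by simp
    then have d: "vdvd q (U *\<^sub>v (K *\<^sub>v y))" using Uc K y by simp
    define x where "x = vec n (\<lambda>i. (U *\<^sub>v (K *\<^sub>v y)) $ i div q)"
    have x: "x \<in> carrier_vec n" by (simp add: x_def)
    have "U *\<^sub>v (K *\<^sub>v y) = q \<cdot>\<^sub>v x" using d Uc by (intro eq_vecI) (auto simp: x_def vdvd_def)
    then have "v = Q *\<^sub>v rvec x" using MK[OF y(1)] sc[OF x] y by simp
    then show "v \<in> mat_image Q (Zn n)" using x by (auto simp: mat_image_def Zn_def)
  next
    fix v assume "v \<in> mat_image Q (Zn n)"
    then obtain x where x: "x \<in> carrier_vec n" "v = Q *\<^sub>v rvec x" by (auto simp: mat_image_def Zn_def)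
    obtain z where z: "z \<in> carrier_vec n" "U *\<^sub>v z = q \<cdot>\<^sub>v x" using full[OF x(1)] by blast
    have "(transpose_mat U * U) *\<^sub>v z = transpose_mat U *\<^sub>v (q \<cdot>\<^sub>v x)"
      using Uc z by (simp add: assoc_mult_mat_vec[of _ n n _ n])
    moreover have "vdvd q (q \<cdot>\<^sub>v x)" by (simp add: vdvd_def)
    then have "vdvd q (transpose_mat U *\<^sub>v (q \<cdot>\<^sub>v x))" using Uc x by (intro vdvd_mult_vec) auto
    ultimately obtain y where y: "y \<in> carrier_vec n" "z = K *\<^sub>v y" using K(3) z by metis
    have "v = M *\<^sub>v rvec y" using MK[OF y(1)] sc[OF x(1)] x y z by simp
    then show "v \<in> (\<lambda>y. M *\<^sub>v rvec y) ` carrier_vec n" using y by auto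
  qed
  \<comment> \<open>The lattice of \<open>M\<close> contains the columns of the invertible matrix
    \<open>Q\<close>, so \<open>M\<close> is invertible too.\<close>
  obtain N where N: "N \<in> carrier_mat n n" "Q = M * rmat N"
  proof (rule int_factor_of_cols[OF M Qc])
    fix j assume "j < n"
    then have "col Q j \<in> mat_image Q (Zn n)"
      using col_eq_mult_rvec[OF Qc] by (auto simp: mat_image_def Zn_def)
    then show "\<exists>y\<in>carrier_vec n. col Q j = M *\<^sub>v rvec y" unfolding img[symmetric] by auto
  qed
  have "det (transpose_mat Q * Q) = 1" using Q by (simp add: orthonormal_mat_def)
  then have "det Q \<noteq> 0" using Qc by (auto simp: det_mult[of _ n])
  then have "det M \<noteq> 0" using N M det_mult[of M n "rmat N"] by auto
  then show ?thesis
    unfolding lattice_basis_def M_def[symmetric] using M img lattice_of_cols[OF M] by simp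
qed

section \<open>Signed graphs of projectors\<close>

definition vertex_index :: "nat \<Rightarrow> nat \<Rightarrow> nat" where
  "vertex_index n a = (if a < n then a else a - n)"

definition vertex_sign :: "nat \<Rightarrow> nat \<Rightarrow> int" where
  "vertex_sign n a = (if a < n then 1 else - 1)"

text \<open>
  Vertex \<open>a < n\<close> stands for \<open>(a, +)\<close> and vertex \<open>n + a\<close> for \<open>(a, -)\<close>.
\<close>

definition graph_weight :: "int \<Rightarrow> nat \<Rightarrow> int mat \<Rightarrow> nat \<Rightarrow> nat \<Rightarrow> int" where
  "graph_weight q n P a b =
    (if vertex_index n a = vertex_index n b then if a = b then 0 else q + P $$ (vertex_index n a, vertex_index n a) mod q
     else (vertex_sign n a * vertex_sign n b * P $$ (vertex_index n a, vertex_index n b)) mod q)"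

lemma vertex_sign_sq [simp]: "vertex_sign n a * vertex_sign n a = 1"
  by (simp add: vertex_sign_def)

lemma vertex_index_less: "a < 2 * n \<Longrightarrow> vertex_index n a < n"
  by (auto simp: vertex_index_def)

lemma vertex_index_sign_eqD: "a < 2 * n \<Longrightarrow> b < 2 * n \<Longrightarrow> vertex_index n a = vertex_index n b \<Longrightarrow> vertex_sign n a = vertex_sign n b \<Longrightarrow> a = b"
  by (auto simp: vertex_index_def vertex_sign_def split: if_splits)

text \<open>All other weights are residues below \<open>q\<close>, so comparison with
  \<open>q\<close> detects the edges between opposite vertices by their weight alone.\<close>

lemma graph_weight_ge_iff:
  "0 < q \<Longrightarrow> q \<le> graph_weight q n P a b \<longleftrightarrow> a \<noteq> b \<and> vertex_index n a = vertex_index n b"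
  using pos_mod_bound[of q] pos_mod_sign[of q] by (force simp: graph_weight_def not_le)

text \<open>Stated over any commutative ring because it serves integral signed permutations as well
  as real permutation matrices, where \<open>e\<close> is constantly 1. Injectivity of
  \<open>f\<close> is not presupposed: the second part is what later yields it.\<close>

lemma signed_selection_entries:
  fixes e :: "nat \<Rightarrow> 'a :: comm_ring_1" and M :: "'a mat"
  assumes f: "\<And>j. j < n \<Longrightarrow> f j < n" and M: "M \<in> carrier_mat n n"
    and S: "S = mat n n (\<lambda>(i, j). if i = f j then e j else 0)" and ij: "i < n" "j < n"
  shows "(transpose_mat S * M * S) $$ (i, j) = e i * e j * M $$ (f i, f j)"
    and "(transpose_mat S * S) $$ (i, j) = (if f i = f j then e i * e j else 0)"
proof -
  have sel: "(\<Sum>k = 0..<n. (if k = f l then e l else 0) * g k) = e l * g (f l)" if "l < n" for g :: "nat \<Rightarrow> 'a" and l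
  proof -
    have "(\<Sum>k = 0..<n. (if k = f l then e l else 0) * g k) = (\<Sum>k = 0..<n. if k = f l then e l * g k else 0)"
      by (intro sum.cong) auto
    then show ?thesis using f[OF that] by simp
  qed
  have MS: "(M * S) $$ (k, j) = e j * M $$ (k, f j)" if "k < n" for k
  proof -
    have "(M * S) $$ (k, j) = (\<Sum>l = 0..<n. (if l = f j then e j else 0) * M $$ (k, l))"
      using that ij M by (auto simp: S scalar_prod_def mult.commute intro!: sum.cong)
    then show ?thesis using sel[OF ij(2)] by simp
  qed
  have "transpose_mat S * M * S = transpose_mat S * (M * S)"
    using M by (intro assoc_mult_mat[of _ n n _ n _ n]) (auto simp: S)
  also have "\<dots> $$ (i, j) = (\<Sum>k = 0..<n. (if k = f i then e i else 0) * (M * S) $$ (k, j))"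
    using ij M by (auto simp: S scalar_prod_def intro!: sum.cong)
  also have "\<dots> = e i * (e j * M $$ (f i, f j))"
    unfolding sel[OF ij(1)] using f ij by (simp add: MS)
  finally show "(transpose_mat S * M * S) $$ (i, j) = e i * e j * M $$ (f i, f j)" by (simp add: mult.assoc)
  have "(transpose_mat S * S) $$ (i, j) = (\<Sum>k = 0..<n. (if k = f i then e i else 0) * (if k = f j then e j else 0))"
    using ij by (auto simp: S scalar_prod_def intro!: sum.cong)
  then show "(transpose_mat S * S) $$ (i, j) = (if f i = f j then e i * e j else 0)"
    unfolding sel[OF ij(1)] by simp
qed

lemma sum_squares_eq_1:
  fixes g :: "nat \<Rightarrow> int"
  assumes "(\<Sum>i<n. g i * g i) = 1"
  shows "\<exists>i<n. g i * g i = 1 \<and> (\<forall>k<n. k \<noteq> i \<longrightarrow> g k = 0)"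
proof -
  have "\<exists>i<n. g i \<noteq> 0"
  proof (rule ccontr)
    assume "\<not> (\<exists>i<n. g i \<noteq> 0)"
    then have "(\<Sum>i<n. g i * g i) = 0" by (intro sum.neutral) auto
    then show False using assms by simp
  qed
  then obtain i where i: "i < n" "g i \<noteq> 0" by blast
  have "(\<Sum>i<n. g i * g i) = g i * g i + (\<Sum>k\<in>{..<n} - {i}. g k * g k)"
    using i by (simp add: sum.remove)
  moreover have "0 < g i * g i" using i(2) by (simp add: zero_less_mult_iff) arith
  moreover have nn: "0 \<le> (\<Sum>k\<in>{..<n} - {i}. g k * g k)" by (intro sum_nonneg) auto
  ultimately have *: "g i * g i = 1" "(\<Sum>k\<in>{..<n} - {i}. g k * g k) = 0" using assms by linarith+
  from *(2) have "\<forall>k\<in>{..<n} - {i}. g k * g k = 0"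
    by (subst (asm) sum_nonneg_eq_0_iff) auto
  then show ?thesis using i *(1) by auto
qed

text \<open>Each column is an integer vector of norm 1, so it has a single nonzero entry, a sign.
  Orthogonality prevents two columns from having it in the same row. These matrices are the
  automorphisms of the integer lattice, hence the ambiguity in the oracle's answers.\<close>

lemma int_orthogonal_signed_selection:
  assumes T: "T \<in> carrier_mat n n" "transpose_mat T * T = 1\<^sub>m n"
  obtains f e where "\<And>j. j < n \<Longrightarrow> f j < n" "\<And>j. j < n \<Longrightarrow> e j * e j = 1" "inj_on f {..<n}"
    "T = mat n n (\<lambda>(i, j). if i = f j then e j else (0::int))"
proof -
  have "\<exists>i<n. T $$ (i, j) * T $$ (i, j) = 1 \<and> (\<forall>k<n. k \<noteq> i \<longrightarrow> T $$ (k, j) = 0)" if j: "j < n" for j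
  proof (rule sum_squares_eq_1)
    have "(transpose_mat T * T) $$ (j, j) = (\<Sum>i = 0..<n. T $$ (i, j) * T $$ (i, j))"
      using T(1) j by (auto simp: scalar_prod_def intro!: sum.cong)
    then show "(\<Sum>i<n. T $$ (i, j) * T $$ (i, j)) = 1" using T(2) j by (simp add: lessThan_atLeast0)
  qed
  then obtain f where f: "\<And>j. j < n \<Longrightarrow> f j < n \<and> T $$ (f j, j) * T $$ (f j, j) = 1 \<and> (\<forall>k<n. k \<noteq> f j \<longrightarrow> T $$ (k, j) = 0)"
    by metis
  define e where "e j = T $$ (f j, j)" for j
  have Teq: "T = mat n n (\<lambda>(i, j). if i = f j then e j else 0)"
    using T(1) f by (intro eq_matI) (auto simp: e_def)
  have "inj_on f {..<n}"
  proof (rule inj_onI, rule ccontr)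
    fix i j assume ij: "i \<in> {..<n}" "j \<in> {..<n}" "f i = f j" "i \<noteq> j"
    have "(transpose_mat T * T) $$ (i, j) = e i * e j"
      using signed_selection_entries(2)[of n f T T e i j] f T(1) Teq ij by auto
    then have "e i * e j = 0" using T(2) ij by simp
    then show False using f[of i] f[of j] ij by (auto simp: e_def)
  qed
  show ?thesis
    by (rule that[of f e, OF _ _ \<open>inj_on f {..<n}\<close> Teq]) (use f in \<open>auto simp: e_def\<close>)
qed

lemma graph_weight_cong:
  assumes "\<And>i j. i < n \<Longrightarrow> j < n \<Longrightarrow> [P1 $$ (i, j) = e i * e j * P2 $$ (f i, f j)] (mod q)"
    and "\<And>j. j < n \<Longrightarrow> e j * e j = (1::int)" "inj_on f {..<n}"
    and p: "\<And>a. a < 2 * n \<Longrightarrow> \<pi> a < 2 * n \<and> vertex_index n (\<pi> a) = f (vertex_index n a) \<and> vertex_sign n (\<pi> a) = vertex_sign n a * e (vertex_index n a)"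
    and ab: "a < 2 * n" "b < 2 * n"
  shows "graph_weight q n P1 a b = graph_weight q n P2 (\<pi> a) (\<pi> b)"
proof -
  have ia: "vertex_index n a < n" "vertex_index n b < n" using ab by (auto intro: vertex_index_less)
  have feq: "f (vertex_index n a) = f (vertex_index n b) \<longleftrightarrow> vertex_index n a = vertex_index n b"
    using inj_on_eq_iff[OF assms(3)] ia by auto
  show ?thesis
  proof (cases "vertex_index n a = vertex_index n b")
    case True
    have "\<pi> a = \<pi> b \<longleftrightarrow> a = b"
    proof
      assume "\<pi> a = \<pi> b"
      then have "vertex_sign n a * e (vertex_index n b) * e (vertex_index n b) = vertex_sign n b * e (vertex_index n b) * e (vertex_index n b)"
        using p[OF ab(1)] p[OF ab(2)] True by metis
      then have "vertex_sign n a = vertex_sign n b" using assms(2)[OF ia(2)] by (simp add: mult.assoc)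
      then show "a = b" using vertex_index_sign_eqD[OF ab True] by simp
    qed simp
    moreover have "P1 $$ (vertex_index n b, vertex_index n b) mod q = P2 $$ (f (vertex_index n b), f (vertex_index n b)) mod q"
      using assms(1)[OF ia(2) ia(2)] assms(2)[OF ia(2)] by (simp add: cong_def)
    ultimately show ?thesis using True p[OF ab(1)] p[OF ab(2)] by (simp add: graph_weight_def)
  next
    case False
    have "[vertex_sign n a * vertex_sign n b * P1 $$ (vertex_index n a, vertex_index n b)
      = vertex_sign n a * vertex_sign n b * (e (vertex_index n a) * e (vertex_index n b) * P2 $$ (f (vertex_index n a), f (vertex_index n b)))] (mod q)"
      by (intro cong_mult cong_refl assms(1) ia)
    then show ?thesis using False feq p[OF ab(1)] p[OF ab(2)]
      by (simp add: graph_weight_def cong_def algebra_simps)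
  qed
qed

lemma graph_iso_of_orthogonal:
  assumes T: "T \<in> carrier_mat n n" "transpose_mat T * T = 1\<^sub>m n"
    and P: "P1 \<in> carrier_mat n n" "P2 \<in> carrier_mat n n"
    and PT: "mdvd q (P1 - transpose_mat T * P2 * T)"
  shows "\<exists>\<pi>. \<pi> permutes {..<2 * n} \<and>
    (\<forall>a<2 * n. \<forall>b<2 * n. graph_weight q n P1 a b = graph_weight q n P2 (\<pi> a) (\<pi> b))"
proof -
  obtain f e where f: "\<And>j. j < n \<Longrightarrow> f j < n" and e: "\<And>j. j < n \<Longrightarrow> e j * e j = 1" and inj: "inj_on f {..<n}"
    and Teq: "T = mat n n (\<lambda>(i, j). if i = f j then e j else (0::int))"
    using int_orthogonal_signed_selection[OF T] by blast
  \<comment> \<open>The action of \<open>T\<close> on signed basis vectors: vector \<open>i\<close>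
    with sign \<open>s\<close> goes to vector \<open>f i\<close> with sign \<open>s\<close> times
    \<open>e i\<close>. Outside the vertex set it is the identity, as \<open>permutes\<close>
    demands.\<close>
  define \<pi> where "\<pi> a = (if a < 2 * n then if vertex_sign n a * e (vertex_index n a) = 1 then f (vertex_index n a) else f (vertex_index n a) + n else a)" for a
  have e1: "e j = 1 \<or> e j = - 1" if "j < n" for j
    using e[OF that] by (simp add: square_eq_1_iff)
  have p: "\<pi> a < 2 * n \<and> vertex_index n (\<pi> a) = f (vertex_index n a) \<and> vertex_sign n (\<pi> a) = vertex_sign n a * e (vertex_index n a)" if a: "a < 2 * n" for a
  proof -
    have "f (vertex_index n a) < n" using f vertex_index_less[OF a] by blast
    moreover have "vertex_sign n a * e (vertex_index n a) = 1 \<or> vertex_sign n a * e (vertex_index n a) = - 1"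
      using e1[OF vertex_index_less[OF a]] by (auto simp: vertex_sign_def)
    ultimately show ?thesis using a by (auto simp: \<pi>_def vertex_index_def[of n "f _"] vertex_index_def[of n "f _ + n"] vertex_sign_def[of n "f _"] vertex_sign_def[of n "f _ + n"])
  qed
  have "inj_on \<pi> {..<2 * n}"
  proof (rule inj_onI)
    fix a b assume ab: "a \<in> {..<2 * n}" "b \<in> {..<2 * n}" "\<pi> a = \<pi> b"
    then have "f (vertex_index n a) = f (vertex_index n b)" "vertex_sign n a * e (vertex_index n a) = vertex_sign n b * e (vertex_index n b)"
      using p[of a] p[of b] by auto
    moreover have ii: "vertex_index n a < n" "vertex_index n b < n" using ab vertex_index_less by auto
    ultimately have "vertex_index n a = vertex_index n b" using inj by (auto dest: inj_onD)
    moreover have "vertex_sign n a = vertex_sign n b"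
      using \<open>vertex_sign n a * e (vertex_index n a) = vertex_sign n b * e (vertex_index n b)\<close> \<open>vertex_index n a = vertex_index n b\<close> e1[OF ii(2)] by auto
    ultimately show "a = b" using vertex_index_sign_eqD[of a n b] ab(1,2) by simp
  qed
  moreover have "\<pi> ` {..<2 * n} \<subseteq> {..<2 * n}" using p by auto
  ultimately have "bij_betw \<pi> {..<2 * n} {..<2 * n}"
    by (simp add: bij_betw_def endo_inj_surj)
  then have "\<pi> permutes {..<2 * n}" by (rule bij_imp_permutes) (simp add: \<pi>_def)
  moreover have "graph_weight q n P1 a b = graph_weight q n P2 (\<pi> a) (\<pi> b)" if "a < 2 * n" "b < 2 * n" for a b
  proof (rule graph_weight_cong[OF _ e inj p that])
    fix i j assume ij: "i < n" "j < n"
    have "q dvd (P1 - transpose_mat T * P2 * T) $$ (i, j)"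
      using PT P T ij unfolding mdvd_def by auto
    also have "(P1 - transpose_mat T * P2 * T) $$ (i, j) = P1 $$ (i, j) - e i * e j * P2 $$ (f i, f j)"
      using signed_selection_entries(1)[OF f P(2) Teq ij] ij T P by (simp del: index_mult_mat(1))
    finally show "[P1 $$ (i, j) = e i * e j * P2 $$ (f i, f j)] (mod q)"
      by (simp add: cong_iff_dvd_diff)
  qed
  ultimately show ?thesis by blast
qed

text \<open>\<open>\<pi>\<close> may be any isomorphism that an oracle returns. Edges of weight at
  least \<open>q\<close> go to such edges, so opposite vertices stay opposite, and the images of the
  vertices \<open>(j, +)\<close> alone determine a signed permutation.\<close>

lemma orthogonal_of_graph_iso:
  assumes q: "0 < q" and \<pi>: "\<pi> permutes {..<2 * n}"
    and w: "\<And>a b. a < 2 * n \<Longrightarrow> b < 2 * n \<Longrightarrow> graph_weight q n P1 a b = graph_weight q n P2 (\<pi> a) (\<pi> b)"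
    and P: "P1 \<in> carrier_mat n n" "P2 \<in> carrier_mat n n"
    and S: "S = mat n n (\<lambda>(i, j). if i = vertex_index n (\<pi> j) then vertex_sign n (\<pi> j) else 0)"
  shows "transpose_mat S * S = 1\<^sub>m n" and "mdvd q (P1 - transpose_mat S * P2 * S)"
proof -
  define f where "f j = vertex_index n (\<pi> j)" for j
  define e where "e j = vertex_sign n (\<pi> j)" for j
  have p: "\<pi> a < 2 * n" if "a < 2 * n" for a using permutes_in_image[OF \<pi>, of a] that by simp
  have f: "f j < n" if "j < n" for j using p[of j] that by (simp add: f_def vertex_index_less)
  have Seq: "S = mat n n (\<lambda>(i, j). if i = f j then e j else 0)" unfolding S f_def e_def ..
  have anti: "vertex_index n a = vertex_index n b \<longleftrightarrow> vertex_index n (\<pi> a) = vertex_index n (\<pi> b)" if "a < 2 * n" "b < 2 * n" "a \<noteq> b" for a b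
  proof -
    have "\<pi> a \<noteq> \<pi> b" using inj_eq[OF permutes_inj[OF \<pi>]] that(3) by simp
    then show ?thesis
      using graph_weight_ge_iff[OF q, of n P1 a b] graph_weight_ge_iff[OF q, of n P2 "\<pi> a" "\<pi> b"] w[OF that(1,2)] that
      by auto
  qed
  have inj: "f i = f j \<longleftrightarrow> i = j" if "i < n" "j < n" for i j
    using anti[of i j] that by (auto simp: f_def vertex_index_def[of n i] vertex_index_def[of n j])
  have e: "e j * e j = 1" for j by (simp add: e_def)
  show "transpose_mat S * S = 1\<^sub>m n"
    using signed_selection_entries(2)[OF f P(1) Seq] inj e
    by (intro eq_matI) (auto simp: Seq simp del: index_mult_mat(1))
  have "[P1 $$ (i, j) = e i * e j * P2 $$ (f i, f j)] (mod q)" if ij: "i < n" "j < n" for i j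
  proof (cases "i = j")
    case False
    then show ?thesis using w[of i j] ij inj[OF ij]
      by (simp add: graph_weight_def cong_def f_def e_def vertex_index_def[of n i] vertex_index_def[of n j] vertex_sign_def[of n i] vertex_sign_def[of n j])
  next
    \<comment> \<open>Graphs have no loops, so the diagonal of the projector is stored on the edges
      between opposite vertices and is read off there.\<close>
    case True
    have "vertex_index n (\<pi> i) = vertex_index n (\<pi> (i + n))" using anti[of i "i + n"] ij by (simp add: vertex_index_def[of n i] vertex_index_def[of n "i + n"])
    moreover have "\<pi> i \<noteq> \<pi> (i + n)" using inj_eq[OF permutes_inj[OF \<pi>]] ij by simp
    ultimately show ?thesis using w[of i "i + n"] ij True e
      by (simp add: graph_weight_def cong_def f_def vertex_index_def[of n j] vertex_index_def[of n "j + n"])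
  qed
  then show "mdvd q (P1 - transpose_mat S * P2 * S)"
    unfolding mdvd_def using signed_selection_entries(1)[OF f P(2) Seq] P
    by (auto simp: Seq[THEN arg_cong, of dim_row] Seq[THEN arg_cong, of dim_col] cong_iff_dvd_diff simp del: index_mult_mat(1))
qed

section \<open>Reasoning about programs\<close>

text \<open>A weakest precondition for total correctness whose postcondition also sees the cost. The
  equations below turn symbolic execution of straight line code into simplification.\<close>

definition runs ::
  "(real mat \<Rightarrow> real mat) \<Rightarrow> (real mat \<Rightarrow> real mat \<Rightarrow> real mat option) \<Rightarrow>
   com \<Rightarrow> state \<Rightarrow> (nat \<Rightarrow> state \<Rightarrow> bool) \<Rightarrow> bool" where
  "runs zl gi c s Q \<longleftrightarrow> (\<exists>t s'. steps zl gi c s t s' \<and> Q t s')"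

inductive_cases SkipE: "steps zl gi Skip s t s'"
inductive_cases NAssignE: "steps zl gi (NAssign x a) s t s'"
inductive_cases RAssignE: "steps zl gi (RAssign x i j a) s t s'"
inductive_cases SeqE: "steps zl gi (Seq c1 c2) s t s'"
inductive_cases IfE: "steps zl gi (If b c1 c2) s t s'"
inductive_cases ZLIP_CallE: "steps zl gi (ZLIP_Call a x y) s t s'"

lemma runs_Skip [simp]: "runs zl gi Skip s Q \<longleftrightarrow> Q 1 s"
  unfolding runs_def by (metis SkipE steps.Skip)

lemma runs_NAssign [simp]: "runs zl gi (NAssign x a) s Q \<longleftrightarrow> Q 1 (set_nvar x (nval a s) s)"
  unfolding runs_def by (metis NAssignE steps.NAssign)

lemma runs_RAssign [simp]:
  "runs zl gi (RAssign x i j a) s Q \<longleftrightarrow> Q 1 (set_cell x (nval i s) (nval j s) (rval a s) s)"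
  unfolding runs_def by (metis RAssignE steps.RAssign)

lemma runs_Seq [simp]:
  "runs zl gi (Seq c1 c2) s Q \<longleftrightarrow> runs zl gi c1 s (\<lambda>t1 s1. runs zl gi c2 s1 (\<lambda>t2 s2. Q (t1 + t2) s2))"
  unfolding runs_def by (blast elim: SeqE intro: steps.Seq)

lemma runs_If [simp]:
  "runs zl gi (If b c1 c2) s Q \<longleftrightarrow>
     (if bval b s then runs zl gi c1 s (\<lambda>t. Q (1 + t)) else runs zl gi c2 s (\<lambda>t. Q (1 + t)))"
proof
  assume "runs zl gi (If b c1 c2) s Q"
  then obtain t s' where "steps zl gi (If b c1 c2) s t s'" and Q: "Q t s'"
    unfolding runs_def by blast
  from this(1) show "if bval b s then runs zl gi c1 s (\<lambda>t. Q (1 + t)) else runs zl gi c2 s (\<lambda>t. Q (1 + t))"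
  proof (rule IfE)
    fix ta assume "t = Suc ta" and b: "bval b s" and "steps zl gi c1 s ta s'"
    then have "\<exists>t s'. steps zl gi c1 s t s' \<and> Q (1 + t) s'" using Q by (intro exI[of _ ta] exI[of _ s']) simp
    then show ?thesis using b by (simp add: runs_def)
  next
    fix ta assume "t = Suc ta" and b: "\<not> bval b s" and "steps zl gi c2 s ta s'"
    then have "\<exists>t s'. steps zl gi c2 s t s' \<and> Q (1 + t) s'" using Q by (intro exI[of _ ta] exI[of _ s']) simp
    then show ?thesis using b by (simp add: runs_def)
  qed
next
  assume R: "if bval b s then runs zl gi c1 s (\<lambda>t. Q (1 + t)) else runs zl gi c2 s (\<lambda>t. Q (1 + t))"
  show "runs zl gi (If b c1 c2) s Q"
  proof (cases "bval b s")
    case True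
    with R obtain t s' where "steps zl gi c1 s t s'" "Q (1 + t) s'" by (auto simp: runs_def)
    then show ?thesis unfolding runs_def using steps.IfTrue[OF True] by blast
  next
    case False
    with R obtain t s' where "steps zl gi c2 s t s'" "Q (1 + t) s'" by (auto simp: runs_def)
    then show ?thesis unfolding runs_def using steps.IfFalse[OF False] by blast
  qed
qed

lemma runs_ZLIP_Call [simp]:
  "runs zl gi (ZLIP_Call a x y) s Q \<longleftrightarrow>
     Q (1 + mat_size (get_mat (nval a s) x s)) (set_mat (nval a s) y (zl (get_mat (nval a s) x s)) s)"
  unfolding runs_def by (metis ZLIP_CallE steps.ZLIP_Call)

lemma runs_GI_Call_Some:
  assumes "gi (get_mat (nval a s) x1 s) (get_mat (nval a s) x2 s) = Some P"
    and "Q (1 + mat_size (get_mat (nval a s) x1 s) + mat_size (get_mat (nval a s) x2 s))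
      (set_nvar f 1 (set_mat (nval a s) y P s))"
  shows "runs zl gi (GI_Call a x1 x2 f y) s Q"
  unfolding runs_def using assms steps.GI_Call_Some by blast

lemma runs_mono: "runs zl gi c s Q \<Longrightarrow> (\<And>t s'. Q t s' \<Longrightarrow> R t s') \<Longrightarrow> runs zl gi c s R"
  unfolding runs_def by blast

lemma runs_SeqI:
  assumes "runs zl gi c1 s Q1" "\<And>t1 s1. Q1 t1 s1 \<Longrightarrow> runs zl gi c2 s1 (\<lambda>t2 s2. Q (t1 + t2) s2)"
  shows "runs zl gi (Seq c1 c2) s Q"
  unfolding runs_Seq by (rule runs_mono[OF assms])

text \<open>
  The index \<open>k\<close> of the invariant is the variant that bounds the number of iterations.
\<close>

lemma runs_While:
  assumes step: "\<And>k s. I k s \<Longrightarrow> bval b s \<Longrightarrow> runs zl gi c s (\<lambda>t s'. t \<le> T \<and> (\<exists>k'<k. I k' s'))"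
    and "I k s"
  shows "runs zl gi (While b c) s (\<lambda>t s'. t \<le> 1 + k * (T + 1) \<and> (\<exists>k'\<le>k. I k' s') \<and> \<not> bval b s')"
  using \<open>I k s\<close>
proof (induction k arbitrary: s rule: less_induct)
  case (less k)
  show ?case
  proof (cases "bval b s")
    case False
    then have "steps zl gi (While b c) s 1 s" by (rule steps.WhileFalse)
    then show ?thesis using less.prems False unfolding runs_def by fastforce
  next
    case True
    obtain t1 s1 k1 where 1: "steps zl gi c s t1 s1" "t1 \<le> T" "k1 < k" "I k1 s1"
      using step[OF less.prems True] unfolding runs_def by blast
    obtain t2 s2 k2 where 2: "steps zl gi (While b c) s1 t2 s2" "t2 \<le> 1 + k1 * (T + 1)"
      "k2 \<le> k1" "I k2 s2" "\<not> bval b s2"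
      using less.IH[OF 1(3,4)] unfolding runs_def by blast
    have "(k1 + 1) * (T + 1) \<le> k * (T + 1)" using 1(3) by (intro mult_le_mono1) simp
    then have "1 + t1 + t2 \<le> 1 + k * (T + 1)" using 1 2 by simp
    moreover have "k2 \<le> k" using 1 2 by simp
    ultimately show ?thesis
      unfolding runs_def using steps.WhileTrue[OF True 1(1) 2(1)] 2 by blast
  qed
qed

definition For :: "vname \<Rightarrow> nexp \<Rightarrow> com \<Rightarrow> com" where
  "For x e c = Seq (NAssign x (NConst 0))
     (While (NLess (NVar x) e) (Seq c (NAssign x (NPlus (NVar x) (NConst 1)))))"

text \<open>An iteration costs \<open>T\<close> for the body, one step for the test and one for the
  increment. The leading 2 pays for the initialization and the last test. The variant handed to the
  while rule is the number of iterations still to come.\<close>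

lemma runs_For:
  assumes I0: "I 0 (set_nvar x 0 s)"
    and bound: "\<And>k s. I k s \<Longrightarrow> fst s x = k \<Longrightarrow> nval e s = m"
    and step: "\<And>k s. k < m \<Longrightarrow> I k s \<Longrightarrow> fst s x = k \<Longrightarrow>
      runs zl gi c s (\<lambda>t s'. t \<le> T \<and> fst s' x = k \<and> I (Suc k) (set_nvar x (Suc k) s'))"
  shows "runs zl gi (For x e c) s (\<lambda>t s'. t \<le> 2 + m * (T + 2) \<and> I m s')"
proof -
  define J where "J k s \<longleftrightarrow> (\<exists>i\<le>m. k = m - i \<and> fst s x = i \<and> I i s)" for k s
  have "runs zl gi (While (NLess (NVar x) e) (Seq c (NAssign x (NPlus (NVar x) (NConst 1)))))
      (set_nvar x 0 s) (\<lambda>t s'. t \<le> 1 + m * (T + 1 + 1) \<and> (\<exists>k'\<le>m. J k' s') \<and> \<not> bval (NLess (NVar x) e) s')"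
  proof (rule runs_While)
    show "J m (set_nvar x 0 s)" using I0 by (auto simp: J_def set_nvar_def)
    fix k s assume "J k s" and b: "bval (NLess (NVar x) e) s"
    then obtain i where i: "i \<le> m" "k = m - i" "fst s x = i" "I i s" by (auto simp: J_def)
    have "i < m" using b bound[OF i(4,3)] i by simp
    show "runs zl gi (Seq c (NAssign x (NPlus (NVar x) (NConst 1)))) s (\<lambda>t s'. t \<le> T + 1 \<and> (\<exists>k'<k. J k' s'))"
      unfolding runs_Seq runs_NAssign
      by (rule runs_mono[OF step[OF \<open>i < m\<close> i(4,3)]])
        (use \<open>i < m\<close> i in \<open>auto simp: J_def set_nvar_def intro!: exI[of _ "m - Suc i"]\<close>)
  qed
  then have "runs zl gi (While (NLess (NVar x) e) (Seq c (NAssign x (NPlus (NVar x) (NConst 1)))))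
      (set_nvar x 0 s) (\<lambda>t s'. t \<le> 1 + m * (T + 2) \<and> I m s')"
    by (rule runs_mono) (use bound in \<open>auto simp: J_def\<close>)
  then show ?thesis unfolding For_def runs_Seq runs_NAssign
    by (auto elim!: runs_mono)
qed

section \<open>Frame conditions and nested loops\<close>

definition same :: "vname set \<Rightarrow> vname set \<Rightarrow> state \<Rightarrow> state \<Rightarrow> bool" where
  "same N A s s' \<longleftrightarrow> (\<forall>x. x \<notin> N \<longrightarrow> fst s' x = fst s x) \<and> (\<forall>x. x \<notin> A \<longrightarrow> snd s' x = snd s x)"

lemma same_refl [simp]: "same N A s s"
  by (simp add: same_def)

lemma same_trans: "same N A s s' \<Longrightarrow> same N' A' s' s'' \<Longrightarrow> N \<union> N' \<subseteq> N'' \<Longrightarrow> A \<union> A' \<subseteq> A'' \<Longrightarrow> same N'' A'' s s''"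
  unfolding same_def by (metis Un_iff subsetD)

lemma same_mono: "same N A s s' \<Longrightarrow> N \<subseteq> N'' \<Longrightarrow> A \<subseteq> A'' \<Longrightarrow> same N'' A'' s s'"
  by (auto simp: same_def)

lemma same_fst: "same N A s s' \<Longrightarrow> x \<notin> N \<Longrightarrow> fst s' x = fst s x"
  by (simp add: same_def)

lemma same_snd: "same N A s s' \<Longrightarrow> x \<notin> A \<Longrightarrow> snd s' x = snd s x"
  by (simp add: same_def)

lemma same_set_nvar: "same N A s s' \<Longrightarrow> x \<in> N \<Longrightarrow> same N A s (set_nvar x k s')"
  by (auto simp: same_def set_nvar_def)

lemma same_set_cell: "same N A s s' \<Longrightarrow> x \<in> A \<Longrightarrow> same N A s (set_cell x i j r s')"
  by (auto simp: same_def set_cell_def)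

lemma fst_set_nvar [simp]: "fst (set_nvar x k s) y = (if y = x then k else fst s y)"
  by (simp add: set_nvar_def)

lemma snd_set_nvar [simp]: "snd (set_nvar x k s) = snd s"
  by (simp add: set_nvar_def)

lemma fst_set_cell [simp]: "fst (set_cell x i j r s) = fst s"
  by (simp add: set_cell_def)

lemma snd_set_cell [simp]:
  "snd (set_cell x i j r s) y a b = (if y = x \<and> a = i \<and> b = j then r else snd s y a b)"
  by (simp add: set_cell_def)

lemma fst_set_mat [simp]: "fst (set_mat d x A s) = fst s"
  by (simp add: set_mat_def)

lemma snd_set_mat [simp]:
  "snd (set_mat d x A s) y a b = (if y = x \<and> a < d \<and> b < d then A $$ (a, b) else snd s y a b)"
  by (simp add: set_mat_def)

definition For2 :: "vname \<Rightarrow> nexp \<Rightarrow> vname \<Rightarrow> nexp \<Rightarrow> com \<Rightarrow> com" where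
  "For2 x e1 y e2 c = For x e1 (For y e2 c)"

text \<open>The body may overwrite any scratch name in \<open>N\<close> and \<open>A\<close> other
  than its loop counters, but of \<open>Z\<close> only the current cell. This makes the result a
  plain function of the indices, independent of the order of the iterations.\<close>

lemma runs_For2:
  assumes xy: "x \<in> N" "y \<in> N" "x \<noteq> y" and Z: "Z \<in> A"
    and bound: "\<And>s. same N A s0 s \<Longrightarrow> nval e1 s = m1 \<and> nval e2 s = m2"
    and body: "\<And>i j s. i < m1 \<Longrightarrow> j < m2 \<Longrightarrow> same N A s0 s \<Longrightarrow> fst s x = i \<Longrightarrow> fst s y = j \<Longrightarrow>
      snd s Z i j = snd s0 Z i j \<Longrightarrow>
      runs zl gi c s (\<lambda>t s'. t \<le> T \<and> same N A s s' \<and> fst s' x = i \<and> fst s' y = j \<and>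
        (\<forall>a b. snd s' Z a b = (if a = i \<and> b = j then f i j else snd s Z a b)))"
  shows "runs zl gi (For2 x e1 y e2 c) s0 (\<lambda>t s'. t \<le> 2 + m1 * (m2 * (T + 2) + 4) \<and> same N A s0 s' \<and>
     (\<forall>a b. snd s' Z a b = (if a < m1 \<and> b < m2 then f a b else snd s0 Z a b)))"
proof -
  define I where "I i s \<longleftrightarrow> same N A s0 s \<and>
    (\<forall>a b. snd s Z a b = (if a < i \<and> b < m2 then f a b else snd s0 Z a b))" for i s
  have "runs zl gi (For2 x e1 y e2 c) s0 (\<lambda>t s'. t \<le> 2 + m1 * ((2 + m2 * (T + 2)) + 2) \<and> I m1 s')"
    unfolding For2_def
  proof (rule runs_For)
    show "I 0 (set_nvar x 0 s0)" using xy by (simp add: I_def same_set_nvar)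
    show "nval e1 s = m1" if "I k s" for k s using that bound by (simp add: I_def)
    fix i s assume i: "i < m1" and I: "I i s" and x: "fst s x = i"
    define K where "K j s \<longleftrightarrow> same N A s0 s \<and> fst s x = i \<and>
      (\<forall>a b. snd s Z a b = (if a < i \<and> b < m2 \<or> a = i \<and> b < j then f a b else snd s0 Z a b))" for j s
    have "runs zl gi (For y e2 c) s (\<lambda>t s'. t \<le> 2 + m2 * (T + 2) \<and> K m2 s')"
    proof (rule runs_For)
      show "K 0 (set_nvar y 0 s)" using I xy x by (auto simp: I_def K_def same_set_nvar)
      show "nval e2 s = m2" if "K k s" for k s using that bound by (simp add: K_def)
      fix j s assume j: "j < m2" and K: "K j s" and y: "fst s y = j"
      have sm: "same N A s0 s" and x: "fst s x = i"
        and Zs: "\<And>a b. snd s Z a b = (if a < i \<and> b < m2 \<or> a = i \<and> b < j then f a b else snd s0 Z a b)"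
        using K by (auto simp: K_def)
      have "snd s Z i j = snd s0 Z i j" by (simp add: Zs)
      from body[OF i j sm x y this]
      show "runs zl gi c s (\<lambda>t s'. t \<le> T \<and> fst s' y = j \<and> K (Suc j) (set_nvar y (Suc j) s'))"
        by (rule runs_mono)
          (use sm xy in \<open>auto simp: K_def Zs less_Suc_eq intro!: same_set_nvar intro: same_trans[OF sm]\<close>)
    qed
    then show "runs zl gi (For y e2 c) s (\<lambda>t s'. t \<le> 2 + m2 * (T + 2) \<and> fst s' x = i \<and> I (Suc i) (set_nvar x (Suc i) s'))"
      by (rule runs_mono) (use xy in \<open>auto simp: K_def I_def less_Suc_eq intro!: same_set_nvar\<close>)
  qed
  then show ?thesis by (rule runs_mono) (auto simp: I_def algebra_simps)
qed

section \<open>Reduction modulo an integer\<close>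

abbreviation sc :: "vname \<Rightarrow> rexp" where
  "sc x \<equiv> RCell x (NConst 0) (NConst 0)"

abbreviation sset :: "vname \<Rightarrow> rexp \<Rightarrow> com" where
  "sset x e \<equiv> RAssign x (NConst 0) (NConst 0) e"

text \<open>
  Reals cannot be rounded in one step, so \<open>r\<close> is reduced modulo \<open>m\<close> by subtracting the multiples \<open>m 2\<^sup>j\<close>
  in descending order of \<open>j\<close>; this takes time linear in the bit length of \<open>r / m\<close>.
\<close>

definition reduce_init :: com where
  "reduce_init =
    Seq (If (RLess (sc ''r'') (RConst 0))
          (Seq (NAssign ''g'' (NConst 1)) (sset ''r'' (RMinus (RConst 0) (sc ''r''))))
          (NAssign ''g'' (NConst 0)))
      (sset ''w'' (sc ''m''))"

definition reduce_double :: com where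
  "reduce_double = While (BNot (RLess (sc ''r'') (sc ''w''))) (sset ''w'' (RPlus (sc ''w'') (sc ''w'')))"

definition reduce_halve :: com where
  "reduce_halve = While (RLess (sc ''m'') (sc ''w''))
           (Seq (sset ''w'' (RDivide (sc ''w'') (RConst 2)))
             (If (RLess (sc ''r'') (sc ''w'')) Skip (sset ''r'' (RMinus (sc ''r'') (sc ''w'')))))"

text \<open>For a negative number the residue of its absolute value is reflected to
  \<open>m - r\<close>. Residue 0 is left alone, as reflection would turn it into
  \<open>m\<close>.\<close>

definition reduce_sign :: com where
  "reduce_sign = If (BAnd (NLess (NConst 0) (NVar ''g'')) (RLess (RConst 0) (sc ''r'')))
     (sset ''r'' (RMinus (sc ''m'') (sc ''r''))) Skip"

definition reduce :: com where
  "reduce = Seq reduce_init (Seq reduce_double (Seq reduce_halve reduce_sign))"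

text \<open>After \<open>j\<close> doublings \<open>w\<close> is at least \<open>2^j\<close>, since
  \<open>\<mu>\<close> is a positive integer; hence at most \<open>K\<close> rounds are needed to
  exceed \<open>a\<close>.\<close>

lemma runs_reduce_doubling:
  fixes a \<mu> :: int
  assumes r: "snd s ''r'' 0 0 = of_int a" and w: "snd s ''w'' 0 0 = of_int \<mu>"
    and \<mu>: "0 < \<mu>" and a: "a < 2 ^ K"
  shows "runs zl gi reduce_double s
    (\<lambda>t s'. t \<le> 1 + K * 2 \<and> same {} {''w''} s s' \<and> (\<exists>j\<le>K. snd s' ''w'' 0 0 = of_int (\<mu> * 2 ^ j) \<and> a < \<mu> * 2 ^ j))"
proof -
  define I where "I k s' \<longleftrightarrow> same {} {''w''} s s' \<and> (\<exists>j\<le>K. k = K - j \<and> snd s' ''w'' 0 0 = of_int (\<mu> * 2 ^ j))" for k s'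
  have rI: "snd s' ''r'' 0 0 = of_int a" if "I k s'" for k s'
    using that same_snd[of "{}" "{''w''}" s s' "''r''"] r by (simp add: I_def)
  have "runs zl gi reduce_double s
    (\<lambda>t s'. t \<le> 1 + K * (1 + 1) \<and> (\<exists>k'\<le>K. I k' s') \<and> \<not> bval (BNot (RLess (sc ''r'') (sc ''w''))) s')"
    unfolding reduce_double_def
  proof (rule runs_While)
    show "I K s" using w by (auto simp: I_def intro!: exI[of _ 0])
    fix k s' assume I: "I k s'" and b: "bval (BNot (RLess (sc ''r'') (sc ''w''))) s'"
    then obtain j where j: "j \<le> K" "k = K - j" "snd s' ''w'' 0 0 = of_int (\<mu> * 2 ^ j)" by (auto simp: I_def)
    have "\<mu> * 2 ^ j \<le> a" using b j(3) rI[OF I] by (simp only: bval.simps rval.simps nval.simps not_less of_int_le_iff)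
    moreover have "1 * 2 ^ j \<le> \<mu> * 2 ^ j" using \<mu> by (intro mult_right_mono) auto
    ultimately have "(2::int) ^ j < 2 ^ K" using a by linarith
    then have "j < K" by simp
    have "I (K - Suc j) (set_cell ''w'' 0 0 (rval (RPlus (sc ''w'') (sc ''w'')) s') s')"
      using I j \<open>j < K\<close> by (auto simp: I_def intro!: same_set_cell exI[of _ "Suc j"])
    moreover have "K - Suc j < k" using j \<open>j < K\<close> by auto
    ultimately show "runs zl gi (sset ''w'' (RPlus (sc ''w'') (sc ''w''))) s' (\<lambda>t s''. t \<le> 1 \<and> (\<exists>k'<k. I k' s''))"
      by auto
  qed
  then show ?thesis
  proof (rule runs_mono)
    fix t s' assume *: "t \<le> 1 + K * (1 + 1) \<and> (\<exists>k'\<le>K. I k' s') \<and> \<not> bval (BNot (RLess (sc ''r'') (sc ''w''))) s'"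
    then obtain k' where I: "I k' s'" by blast
    then obtain j where j: "j \<le> K" "snd s' ''w'' 0 0 = of_int (\<mu> * 2 ^ j)" by (auto simp: I_def)
    have "real_of_int a < of_int (\<mu> * 2 ^ j)" using * j rI[OF I] by (simp only: bval.simps rval.simps nval.simps) simp
    then have "a < \<mu> * 2 ^ j" by (simp only: of_int_less_iff)
    then show "t \<le> 1 + K * 2 \<and> same {} {''w''} s s' \<and> (\<exists>j\<le>K. snd s' ''w'' 0 0 = of_int (\<mu> * 2 ^ j) \<and> a < \<mu> * 2 ^ j)"
      using * j I by (auto simp: I_def)
  qed
qed

text \<open>Before each round the remainder is less than \<open>w\<close>, so after halving
  \<open>w\<close> at most one subtraction is needed to restore this. The exponent of 2 in
  \<open>w\<close> is the variant, and the halving is exact because \<open>w\<close> is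
  \<open>\<mu>\<close> times a power of 2.\<close>

lemma runs_reduce_halving:
  fixes a \<mu> :: int
  assumes r: "snd s ''r'' 0 0 = of_int a" and w: "snd s ''w'' 0 0 = of_int (\<mu> * 2 ^ j)"
    and m: "snd s ''m'' 0 0 = of_int \<mu>" and \<mu>: "0 < \<mu>" and a: "0 \<le> a" "a < \<mu> * 2 ^ j"
  shows "runs zl gi reduce_halve s
    (\<lambda>t s'. t \<le> 1 + j * 4 \<and> same {} {''r'', ''w''} s s' \<and> snd s' ''r'' 0 0 = of_int (a mod \<mu>))" (is "runs zl gi _ s ?Q")
proof -
  define I where "I k s' \<longleftrightarrow> same {} {''r'', ''w''} s s' \<and> snd s' ''w'' 0 0 = of_int (\<mu> * 2 ^ k) \<and>
     (\<exists>b. snd s' ''r'' 0 0 = of_int b \<and> 0 \<le> b \<and> b < \<mu> * 2 ^ k \<and> b mod \<mu> = a mod \<mu>)" for k s'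
  have mI: "snd s' ''m'' 0 0 = of_int \<mu>" if "I k s'" for k s'
    using that same_snd[of "{}" "{''r'', ''w''}" s s' "''m''"] m by (simp add: I_def)
  have "runs zl gi reduce_halve s (\<lambda>t s'. t \<le> 1 + j * (3 + 1) \<and> (\<exists>k'\<le>j. I k' s') \<and> \<not> bval (RLess (sc ''m'') (sc ''w'')) s')"
    unfolding reduce_halve_def
  proof (rule runs_While)
    show "I j s" using assms by (auto simp: I_def)
    fix k s' assume I: "I k s'" and b: "bval (RLess (sc ''m'') (sc ''w'')) s'"
    then obtain c where c: "snd s' ''w'' 0 0 = of_int (\<mu> * 2 ^ k)" "snd s' ''r'' 0 0 = of_int c" "0 \<le> c"
      "c < \<mu> * 2 ^ k" "c mod \<mu> = a mod \<mu>" by (auto simp: I_def)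
    have "k \<noteq> 0" using b c mI[OF I] by (auto intro!: Nat.gr0I)
    then obtain k' where k: "k = Suc k'" by (cases k) auto
    have half: "snd s' ''w'' 0 0 / 2 = of_int (\<mu> * 2 ^ k')" using c(1) k by simp
    have "\<mu> * 2 ^ k = \<mu> * 2 ^ k' + \<mu> * 2 ^ k'" using k by simp
    then have lt: "c - \<mu> * 2 ^ k' < \<mu> * 2 ^ k'" using c by linarith
    have md: "(c - \<mu> * 2 ^ k') mod \<mu> = a mod \<mu>"
      using c(5) by (simp add: mod_diff_eq[symmetric])
    show "runs zl gi (Seq (sset ''w'' (RDivide (sc ''w'') (RConst 2)))
             (If (RLess (sc ''r'') (sc ''w'')) Skip (sset ''r'' (RMinus (sc ''r'') (sc ''w''))))) s'
        (\<lambda>t s''. t \<le> 3 \<and> (\<exists>k'<k. I k' s''))"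
    proof (cases "c < \<mu> * 2 ^ k'")
      case True
      then have "real_of_int c < of_int (\<mu> * 2 ^ k')" by (simp only: of_int_less_iff)
      then show ?thesis
        using I c k half True by (auto simp: I_def simp del: of_int_mult of_int_power intro!: same_set_cell exI[of _ k'])
    next
      case False
      then have "\<not> real_of_int c < of_int (\<mu> * 2 ^ k')" by (metis of_int_less_iff)
      moreover have "of_int c - real_of_int (\<mu> * 2 ^ k') = of_int (c - \<mu> * 2 ^ k')" by (simp only: of_int_diff)
      ultimately show ?thesis
        using I c k half False lt md
        by (auto simp: I_def simp del: of_int_mult of_int_power of_int_diff
          intro!: same_set_cell exI[of _ k'] exI[of _ "c - \<mu> * 2 ^ k'"])
    qed
  qed
  then show ?thesis
  proof (rule runs_mono)
    fix t s' assume *: "t \<le> 1 + j * (3 + 1) \<and> (\<exists>k'\<le>j. I k' s') \<and> \<not> bval (RLess (sc ''m'') (sc ''w'')) s'"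
    then obtain k where I: "I k s'" by blast
    then obtain c where c: "snd s' ''w'' 0 0 = of_int (\<mu> * 2 ^ k)" "snd s' ''r'' 0 0 = of_int c" "0 \<le> c"
      "c < \<mu> * 2 ^ k" "c mod \<mu> = a mod \<mu>" by (auto simp: I_def)
    have "\<not> real_of_int \<mu> < of_int (\<mu> * 2 ^ k)" using * c mI[OF I] by (simp only: bval.simps rval.simps nval.simps) simp
    then have "\<mu> * 2 ^ k \<le> \<mu>" by (simp only: of_int_less_iff not_less)
    then have "c < \<mu>" using c by linarith
    then have "c = a mod \<mu>" using c by simp
    then show "?Q t s'" using * c I by (auto simp: I_def)
  qed
qed

lemma runs_reduce:
  fixes \<rho> \<mu> :: int
  assumes r: "snd s ''r'' 0 0 = of_int \<rho>" and m: "snd s ''m'' 0 0 = of_int \<mu>"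
    and \<mu>: "0 < \<mu>" and K: "\<bar>\<rho>\<bar> < 2 ^ K"
  shows "runs zl gi reduce s (\<lambda>t s'. t \<le> 10 + 6 * K \<and> same {''g''} {''r'', ''w''} s s' \<and>
     snd s' ''r'' 0 0 = of_int (\<rho> mod \<mu>))"
  (is "runs _ _ _ _ ?Q")
proof -
  have 1: "runs zl gi reduce_init s
    (\<lambda>t s'. t \<le> 4 \<and> same {''g''} {''r'', ''w''} s s' \<and> snd s' ''r'' 0 0 = of_int \<bar>\<rho>\<bar> \<and>
      snd s' ''w'' 0 0 = of_int \<mu> \<and> snd s' ''m'' 0 0 = of_int \<mu> \<and> fst s' ''g'' = (if \<rho> < 0 then 1 else 0))"
    unfolding reduce_init_def using r m by (auto intro!: same_set_cell same_set_nvar)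
  show ?thesis
    unfolding reduce_def
  proof (rule runs_SeqI[OF 1], elim conjE)
    fix t1 :: nat and s1 assume t1: "t1 \<le> 4" and s1: "same {''g''} {''r'', ''w''} s s1" "snd s1 ''r'' 0 0 = of_int \<bar>\<rho>\<bar>"
      "snd s1 ''w'' 0 0 = of_int \<mu>" "snd s1 ''m'' 0 0 = of_int \<mu>" "fst s1 ''g'' = (if \<rho> < 0 then 1 else 0)"
    show "runs zl gi (Seq reduce_double (Seq reduce_halve reduce_sign)) s1
      (\<lambda>t. ?Q (t1 + t))"
    proof (rule runs_SeqI[OF runs_reduce_doubling[OF s1(2,3) \<mu> K]], elim conjE exE)
      fix t2 :: nat and s2 j assume t2: "t2 \<le> 1 + K * 2" and s2: "same {} {''w''} s1 s2" "j \<le> K"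
        "snd s2 ''w'' 0 0 = real_of_int (\<mu> * 2 ^ j)" "\<bar>\<rho>\<bar> < \<mu> * 2 ^ j"
      have r2: "snd s2 ''r'' 0 0 = of_int \<bar>\<rho>\<bar>" and m2: "snd s2 ''m'' 0 0 = of_int \<mu>"
        using s1 same_snd[OF s2(1)] by auto
      show "runs zl gi (Seq reduce_halve reduce_sign) s2
         (\<lambda>t. ?Q (t1 + (t2 + t)))"
      proof (rule runs_SeqI[OF runs_reduce_halving[OF r2 s2(3) m2 \<mu> abs_ge_zero s2(4)]], elim conjE)
        fix t3 :: nat and s3 assume t3: "t3 \<le> 1 + j * 4" and s3: "same {} {''r'', ''w''} s2 s3"
          "snd s3 ''r'' 0 0 = real_of_int (\<bar>\<rho>\<bar> mod \<mu>)"
        have sm: "same {''g''} {''r'', ''w''} s s3"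
          by (rule same_trans[OF same_trans[OF s1(1) s2(1) subset_refl subset_refl] s3(1)]) auto
        have m3: "snd s3 ''m'' 0 0 = of_int \<mu>" using m2 same_snd[OF s3(1)] by auto
        have g3: "fst s3 ''g'' = (if \<rho> < 0 then 1 else 0)"
          using s1(5) same_fst[OF s2(1), of "''g''"] same_fst[OF s3(1), of "''g''"] by auto
        have neg: "\<rho> mod \<mu> = (if (- \<rho>) mod \<mu> = 0 then 0 else \<mu> - (- \<rho>) mod \<mu>)"
          using zmod_zminus1_eq_if[of "- \<rho>" \<mu>] by simp
        have nn: "0 \<le> (- \<rho>) mod \<mu>" using \<mu> by simp
        show "runs zl gi reduce_sign s3
           (\<lambda>t. ?Q (t1 + (t2 + (t3 + t))))"
        proof (cases "\<rho> < 0")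
          case True
          show ?thesis
          proof (cases "(- \<rho>) mod \<mu> = 0")
            case True
            then show ?thesis using \<open>\<rho> < 0\<close> t1 t2 t3 s2(2) sm m3 g3 s3(2) neg
              by (simp add: reduce_sign_def)
          next
            case False
            then have "0 < (- \<rho>) mod \<mu>" using nn by simp
            then have "0 < real_of_int ((- \<rho>) mod \<mu>)" by (simp only: of_int_0_less_iff)
            then show ?thesis using \<open>\<rho> < 0\<close> False t1 t2 t3 s2(2) sm m3 g3 s3(2)
              by (simp add: reduce_sign_def neg same_set_cell)
          qed
        next
          case False
          then show ?thesis using t1 t2 t3 s2(2) sm g3 s3(2) by (simp add: reduce_sign_def)
        qed
      qed
    qed
  qed
qed

section \<open>Modular inverses\<close>

text \<open>The machine has no integer division, so the quotient is obtained as
  \<open>(a - a mod b) / b\<close> from the remainder. Only the Bezout coefficient of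
  \<open>x\<close> is carried along, reduced modulo \<open>q\<close>, since the coefficient of
  \<open>q\<close> has no influence modulo \<open>q\<close>.\<close>

definition euclid_step :: com where
  "euclid_step =
    Seq (Seq (sset ''r'' (sc ''a'')) (sset ''m'' (sc ''b''))) (Seq reduce
    (Seq (Seq (sset ''c'' (sc ''r''))
      (Seq (sset ''r'' (RMinus (sc ''u'') (RTimes (RDivide (RMinus (sc ''a'') (sc ''c'')) (sc ''b'')) (sc ''v''))))
        (sset ''m'' (sc ''q'')))) (Seq reduce
    (Seq (sset ''a'' (sc ''b'')) (Seq (sset ''b'' (sc ''c''))
      (Seq (sset ''u'' (sc ''v'')) (sset ''v'' (sc ''r''))))))))"

lemma runs_euclid_step:
  fixes \<alpha> \<beta> \<upsilon> \<nu> q :: int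
  assumes s: "snd s ''a'' 0 0 = of_int \<alpha>" "snd s ''b'' 0 0 = of_int \<beta>" "snd s ''u'' 0 0 = of_int \<upsilon>"
      "snd s ''v'' 0 0 = of_int \<nu>" "snd s ''q'' 0 0 = of_int q"
    and \<alpha>: "0 \<le> \<alpha>" "\<alpha> \<le> q" and \<beta>: "0 < \<beta>" and q: "q < 2 ^ N"
    and \<upsilon>: "0 \<le> \<upsilon>" "\<upsilon> < q" and \<nu>: "0 \<le> \<nu>" "\<nu> < q"
  shows "runs zl gi euclid_step s (\<lambda>t s'. t \<le> 29 + 18 * N \<and>
    same {''g''} {''r'', ''w'', ''m'', ''c'', ''a'', ''b'', ''u'', ''v''} s s' \<and>
    snd s' ''a'' 0 0 = of_int \<beta> \<and> snd s' ''b'' 0 0 = of_int (\<alpha> mod \<beta>) \<and>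
    snd s' ''u'' 0 0 = of_int \<nu> \<and> snd s' ''v'' 0 0 = of_int ((\<upsilon> - (\<alpha> div \<beta>) * \<nu>) mod q))"
  (is "runs _ _ _ _ ?Q")
  unfolding euclid_step_def
proof (rule runs_SeqI)
  let ?A = "{''r'', ''w'', ''m'', ''c'', ''a'', ''b'', ''u'', ''v''}"
  show "runs zl gi (Seq (sset ''r'' (sc ''a'')) (sset ''m'' (sc ''b''))) s (\<lambda>t1 s1. t1 = 2 \<and>
     same {} {''r'', ''m''} s s1 \<and> snd s1 ''r'' 0 0 = of_int \<alpha> \<and> snd s1 ''m'' 0 0 = of_int \<beta>)"
    using s by (auto intro!: same_set_cell)
  fix t1 :: nat and s1 assume "t1 = 2 \<and>
     same {} {''r'', ''m''} s s1 \<and> snd s1 ''r'' 0 0 = of_int \<alpha> \<and> snd s1 ''m'' 0 0 = of_int \<beta>"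
  then have t1: "t1 = 2" and s1: "same {} {''r'', ''m''} s s1" "snd s1 ''r'' 0 0 = of_int \<alpha>" "snd s1 ''m'' 0 0 = of_int \<beta>"
    by auto
  have K1: "\<bar>\<alpha>\<bar> < 2 ^ N" using \<alpha> q by linarith
  show "runs zl gi (Seq reduce (Seq (Seq (sset ''c'' (sc ''r''))
      (Seq (sset ''r'' (RMinus (sc ''u'') (RTimes (RDivide (RMinus (sc ''a'') (sc ''c'')) (sc ''b'')) (sc ''v''))))
        (sset ''m'' (sc ''q'')))) (Seq reduce
    (Seq (sset ''a'' (sc ''b'')) (Seq (sset ''b'' (sc ''c''))
      (Seq (sset ''u'' (sc ''v'')) (sset ''v'' (sc ''r'')))))))) s1 (\<lambda>t. ?Q (t1 + t))"
  proof (rule runs_SeqI[OF runs_reduce[OF s1(2,3) \<beta> K1]], elim conjE, rule runs_SeqI)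
    fix t2 :: nat and s2 assume t2: "t2 \<le> 10 + 6 * N" and s2: "same {''g''} {''r'', ''w''} s1 s2"
      "snd s2 ''r'' 0 0 = of_int (\<alpha> mod \<beta>)"
    have sm2: "same {''g''} ?A s s2" by (rule same_trans[OF s1(1) s2(1)]) auto
    have v2: "snd s2 x = snd s x" if "x \<notin> {''r'', ''w'', ''m''}" for x
      using same_snd[OF s1(1)] same_snd[OF s2(1)] that by auto
    have quot: "(real_of_int \<alpha> - of_int (\<alpha> mod \<beta>)) / of_int \<beta> = of_int (\<alpha> div \<beta>)"
    proof -
      have "real_of_int \<alpha> - of_int (\<alpha> mod \<beta>) = of_int (\<beta> * (\<alpha> div \<beta>))"
        by (simp only: of_int_diff[symmetric] minus_mod_eq_mult_div)
      then show ?thesis using \<beta> by simp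
    qed
    then have quot': "(real_of_int \<alpha> - of_int (\<alpha> mod \<beta>)) * of_int \<nu> / of_int \<beta> = of_int (\<alpha> div \<beta>) * of_int \<nu>"
      by (metis times_divide_eq_left)
    show "runs zl gi (Seq (sset ''c'' (sc ''r''))
      (Seq (sset ''r'' (RMinus (sc ''u'') (RTimes (RDivide (RMinus (sc ''a'') (sc ''c'')) (sc ''b'')) (sc ''v''))))
        (sset ''m'' (sc ''q'')))) s2 (\<lambda>t3 s3. t3 = 3 \<and> same {} {''c'', ''r'', ''m''} s2 s3 \<and>
         snd s3 ''c'' 0 0 = of_int (\<alpha> mod \<beta>) \<and>
         snd s3 ''r'' 0 0 = of_int (\<upsilon> - (\<alpha> div \<beta>) * \<nu>) \<and> snd s3 ''m'' 0 0 = of_int q)"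
      using s s2(2) quot' v2[of "''a''"] v2[of "''b''"] v2[of "''u''"] v2[of "''v''"] v2[of "''q''"]
      by (simp add: same_set_cell)
    fix t3 :: nat and s3 assume "t3 = 3 \<and> same {} {''c'', ''r'', ''m''} s2 s3 \<and>
         snd s3 ''c'' 0 0 = of_int (\<alpha> mod \<beta>) \<and>
         snd s3 ''r'' 0 0 = of_int (\<upsilon> - (\<alpha> div \<beta>) * \<nu>) \<and> snd s3 ''m'' 0 0 = of_int q"
    then have t3: "t3 = 3" and s3: "same {} {''c'', ''r'', ''m''} s2 s3"
      "snd s3 ''r'' 0 0 = of_int (\<upsilon> - (\<alpha> div \<beta>) * \<nu>)" "snd s3 ''m'' 0 0 = of_int q"
      and c3: "snd s3 ''c'' 0 0 = of_int (\<alpha> mod \<beta>)"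
      by blast+
    have sm3: "same {''g''} ?A s s3" by (rule same_trans[OF sm2 s3(1)]) auto
    have v3: "snd s3 x = snd s x" if "x \<notin> {''r'', ''w'', ''m'', ''c''}" for x
      using v2[of x] same_snd[OF s3(1), of x] that by auto
    have "\<alpha> div \<beta> * \<nu> \<le> q * \<nu>"
    proof (rule mult_right_mono)
      show "\<alpha> div \<beta> \<le> q" using zdiv_mono2[of \<alpha> 1 \<beta>] \<alpha> \<beta> by simp
    qed (use \<nu> in auto)
    moreover have "q * \<nu> < q * q" using \<nu> \<alpha> by (intro mult_strict_left_mono) auto
    moreover have "q * q \<le> 2 ^ N * 2 ^ N" using q \<upsilon> by (intro mult_mono) auto
    moreover have "q \<le> 2 ^ N * 2 ^ N"
    proof -
      have "q * 1 \<le> 2 ^ N * 2 ^ N" using q \<upsilon> by (intro mult_mono) auto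
      then show ?thesis by simp
    qed
    moreover have "0 \<le> \<alpha> div \<beta> * \<nu>" using \<alpha> \<beta> \<nu> by (simp add: pos_imp_zdiv_nonneg_iff)
    \<comment> \<open>Quotient and coefficient are both at most \<open>q\<close>, so the number to
      be reduced has at most \<open>2 N\<close> bits. Together with the \<open>N\<close> bits of the
      first reduction this explains \<open>18 * N\<close> in the time bound.\<close>
    ultimately have K2: "\<bar>\<upsilon> - (\<alpha> div \<beta>) * \<nu>\<bar> < 2 ^ (N + N)"
      unfolding power_add using \<upsilon> by linarith
    have q0: "0 < q" using \<upsilon> by simp
    show "runs zl gi (Seq reduce
    (Seq (sset ''a'' (sc ''b'')) (Seq (sset ''b'' (sc ''c''))
      (Seq (sset ''u'' (sc ''v'')) (sset ''v'' (sc ''r'')))))) s3 (\<lambda>t. ?Q (t1 + (t2 + (t3 + t))))"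
    proof (rule runs_SeqI[OF runs_reduce[OF s3(2,3) q0 K2]], elim conjE)
      fix t4 :: nat and s4 assume t4: "t4 \<le> 10 + 6 * (N + N)" and s4: "same {''g''} {''r'', ''w''} s3 s4"
        "snd s4 ''r'' 0 0 = real_of_int ((\<upsilon> - (\<alpha> div \<beta>) * \<nu>) mod q)"
      have sm4: "same {''g''} ?A s s4" by (rule same_trans[OF sm3 s4(1)]) auto
      have b4: "snd s4 ''b'' 0 0 = of_int \<beta>" and n4: "snd s4 ''v'' 0 0 = of_int \<nu>"
        using v3[of "''b''"] v3[of "''v''"] s same_snd[OF s4(1), of "''b''"] same_snd[OF s4(1), of "''v''"] by auto
      have c4: "snd s4 ''c'' 0 0 = of_int (\<alpha> mod \<beta>)" using c3 same_snd[OF s4(1), of "''c''"] by simp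
      show "runs zl gi (Seq (sset ''a'' (sc ''b'')) (Seq (sset ''b'' (sc ''c''))
      (Seq (sset ''u'' (sc ''v'')) (sset ''v'' (sc ''r''))))) s4
       (\<lambda>t. ?Q (t1 + (t2 + (t3 + (t4 + t)))))"
        using t1 t2 t3 t4 sm4 b4 n4 c4 s4(2) by (simp add: same_set_cell)
    qed
  qed
qed

definition euclid :: com where
  "euclid = Seq (Seq (sset ''a'' (sc ''q'')) (Seq (sset ''b'' (sc ''x''))
      (Seq (sset ''u'' (RConst 0)) (sset ''v'' (RConst 1)))))
    (While (RLess (RConst 0) (sc ''b'')) euclid_step)"

text \<open>The product of the two current remainders at least halves in each round, because
  \<open>b < a\<close> gives a quotient of at least 1 and hence \<open>2 (a mod b)\<close> at most
  \<open>a\<close>. It starts below \<open>q^2\<close>, so \<open>2 N\<close> rounds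
  suffice.\<close>

lemma runs_euclid:
  fixes q \<xi> :: int
  assumes s: "snd s ''q'' 0 0 = of_int q" "snd s ''x'' 0 0 = of_int \<xi>"
    and q: "1 < q" "q < 2 ^ N" and \<xi>: "0 \<le> \<xi>" "\<xi> < q"
  shows "runs zl gi euclid s (\<lambda>t s'. t \<le> 5 + 2 * N * (30 + 18 * N) \<and>
    same {''g''} {''r'', ''w'', ''m'', ''c'', ''a'', ''b'', ''u'', ''v''} s s' \<and>
    snd s' ''a'' 0 0 = of_int (gcd \<xi> q) \<and>
    (\<exists>\<upsilon>. snd s' ''u'' 0 0 = of_int \<upsilon> \<and> 0 \<le> \<upsilon> \<and> \<upsilon> < q \<and> [\<upsilon> * \<xi> = gcd \<xi> q] (mod q)))"
  (is "runs _ _ _ _ ?Q")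
  unfolding euclid_def
proof (rule runs_SeqI)
  let ?A = "{''r'', ''w'', ''m'', ''c'', ''a'', ''b'', ''u'', ''v''}"
  define I where "I k s' \<longleftrightarrow> same {''g''} ?A s s' \<and> (\<exists>\<alpha> \<beta> \<upsilon> \<nu>.
     snd s' ''a'' 0 0 = of_int \<alpha> \<and> snd s' ''b'' 0 0 = of_int \<beta> \<and> snd s' ''u'' 0 0 = of_int \<upsilon> \<and>
     snd s' ''v'' 0 0 = of_int \<nu> \<and> 0 < \<alpha> \<and> \<alpha> \<le> q \<and> 0 \<le> \<beta> \<and> \<beta> < \<alpha> \<and> 0 \<le> \<upsilon> \<and> \<upsilon> < q \<and> 0 \<le> \<nu> \<and> \<nu> < q \<and>
     gcd \<alpha> \<beta> = gcd \<xi> q \<and> [\<upsilon> * \<xi> = \<alpha>] (mod q) \<and> [\<nu> * \<xi> = \<beta>] (mod q) \<and> \<alpha> * \<beta> < 2 ^ k)" for k :: nat and s'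
  have "q * \<xi> < 2 ^ (2 * N)"
  proof -
    have "q * \<xi> \<le> q * q" using \<xi> q by (intro mult_left_mono) auto
    also have "\<dots> < 2 ^ N * 2 ^ N" using q by (intro mult_strict_mono) auto
    finally show ?thesis by (simp add: power_add[symmetric] mult_2)
  qed
  then have "I (2 * N) (set_cell ''v'' 0 0 1 (set_cell ''u'' 0 0 0 (set_cell ''b'' 0 0 (snd s ''x'' 0 0) (set_cell ''a'' 0 0 (snd s ''q'' 0 0) s))))"
    unfolding I_def using s q \<xi>
    by (auto simp: cong_def gcd.commute intro!: same_set_cell exI[of _ q] exI[of _ \<xi>] exI[of _ 0] exI[of _ 1])
  then show "runs zl gi (Seq (sset ''a'' (sc ''q'')) (Seq (sset ''b'' (sc ''x''))
      (Seq (sset ''u'' (RConst 0)) (sset ''v'' (RConst 1))))) s (\<lambda>t s'. t = 4 \<and> I (2 * N) s')"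
    by simp
  fix t1 :: nat and s1 assume s1: "t1 = 4 \<and> I (2 * N) s1"
  have "runs zl gi (While (RLess (RConst 0) (sc ''b'')) euclid_step) s1 (\<lambda>t s'. t \<le> 1 + (2 * N) * (29 + 18 * N + 1) \<and>
      (\<exists>k'\<le>2 * N. I k' s') \<and> \<not> bval (RLess (RConst 0) (sc ''b'')) s')"
  proof (rule runs_While)
    show "I (2 * N) s1" using s1 by simp
    fix k s' assume I: "I k s'" and b: "bval (RLess (RConst 0) (sc ''b'')) s'"
    then obtain \<alpha> \<beta> \<upsilon> \<nu> where *: "snd s' ''a'' 0 0 = of_int \<alpha>" "snd s' ''b'' 0 0 = of_int \<beta>" "snd s' ''u'' 0 0 = of_int \<upsilon>"
     "snd s' ''v'' 0 0 = of_int \<nu>" "0 < \<alpha>" "\<alpha> \<le> q" "0 \<le> \<beta>" "\<beta> < \<alpha>" "0 \<le> \<upsilon>" "\<upsilon> < q" "0 \<le> \<nu>" "\<nu> < q"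
     "gcd \<alpha> \<beta> = gcd \<xi> q" "[\<upsilon> * \<xi> = \<alpha>] (mod q)" "[\<nu> * \<xi> = \<beta>] (mod q)" "\<alpha> * \<beta> < 2 ^ k"
      unfolding I_def by blast
    have \<beta>: "0 < \<beta>" using b *(2) by simp
    have sm: "same {''g''} ?A s s'" using I by (simp add: I_def)
    have qs: "snd s' ''q'' 0 0 = of_int q" using same_snd[OF sm, of "''q''"] s by simp
    have "0 < \<alpha> * \<beta>" using *(5) \<beta> by simp
    have k: "k \<noteq> 0"
    proof
      assume "k = 0"
      then show False using *(16) \<open>0 < \<alpha> * \<beta>\<close> by simp
    qed
    then obtain k' where k': "k = Suc k'" by (cases k) auto
    have mod: "0 \<le> \<alpha> mod \<beta>" "\<alpha> mod \<beta> < \<beta>" using \<beta> by auto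
    have "1 * \<beta> \<le> (\<alpha> div \<beta>) * \<beta>" using \<beta> *(8) by (intro mult_right_mono) (auto simp: pos_imp_zdiv_pos_iff int_one_le_iff_zero_less)
    then have "2 * (\<alpha> mod \<beta>) \<le> \<alpha>" using mod div_mult_mod_eq[of \<alpha> \<beta>] by linarith
    then have "\<beta> * (2 * (\<alpha> mod \<beta>)) \<le> \<beta> * \<alpha>" using \<beta> by (intro mult_left_mono) auto
    then have dec: "\<beta> * (\<alpha> mod \<beta>) < 2 ^ k'" using *(16) k' by (simp add: mult.commute)
    have g: "gcd \<beta> (\<alpha> mod \<beta>) = gcd \<xi> q" using *(13) gcd_red_int[of \<alpha> \<beta>] by simp
    define \<nu>' where "\<nu>' = (\<upsilon> - (\<alpha> div \<beta>) * \<nu>) mod q"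
    have n': "0 \<le> \<nu>'" "\<nu>' < q" unfolding \<nu>'_def using q by auto
    have "[\<nu>' * \<xi> = (\<upsilon> - (\<alpha> div \<beta>) * \<nu>) * \<xi>] (mod q)"
      unfolding \<nu>'_def by (intro cong_mult cong_refl) (simp add: cong_def)
    also have "(\<upsilon> - (\<alpha> div \<beta>) * \<nu>) * \<xi> = \<upsilon> * \<xi> - (\<alpha> div \<beta>) * (\<nu> * \<xi>)" by (simp add: algebra_simps)
    also have "[\<upsilon> * \<xi> - (\<alpha> div \<beta>) * (\<nu> * \<xi>) = \<alpha> - (\<alpha> div \<beta>) * \<beta>] (mod q)"
      by (intro cong_diff cong_mult cong_refl *)
    also have "\<alpha> - (\<alpha> div \<beta>) * \<beta> = \<alpha> mod \<beta>" by (simp add: minus_div_mult_eq_mod)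
    finally have cg: "[\<nu>' * \<xi> = \<alpha> mod \<beta>] (mod q)" .
    show "runs zl gi euclid_step s' (\<lambda>t s''. t \<le> 29 + 18 * N \<and> (\<exists>k'<k. I k' s''))"
    proof (rule runs_mono[OF runs_euclid_step[OF *(1-4) qs less_imp_le[OF *(5)] *(6) \<beta> q(2) *(9-12)]], elim conjE, intro conjI)
      fix t :: nat and s'' assume r: "same {''g''} ?A s' s''" "snd s'' ''a'' 0 0 = of_int \<beta>"
        "snd s'' ''b'' 0 0 = of_int (\<alpha> mod \<beta>)" "snd s'' ''u'' 0 0 = of_int \<nu>"
        "snd s'' ''v'' 0 0 = of_int ((\<upsilon> - (\<alpha> div \<beta>) * \<nu>) mod q)"
      have "same {''g''} ?A s s''" by (rule same_trans[OF sm r(1)]) auto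
      moreover have "\<beta> \<le> q" using *(6,8) by linarith
      ultimately have "I k' s''" unfolding I_def
        using r(2-5)[folded \<nu>'_def] \<beta> mod n' *(11,12,15) g cg dec by blast
      then show "\<exists>k'<k. I k' s''" using k' by auto
    qed
  qed
  then show "runs zl gi (While (RLess (RConst 0) (sc ''b'')) euclid_step) s1 (\<lambda>t. ?Q (t1 + t))"
  proof (rule runs_mono, elim conjE exE)
    fix t :: nat and s' k assume t: "t \<le> 1 + 2 * N * (29 + 18 * N + 1)" and I: "I k s'" and b: "\<not> bval (RLess (RConst 0) (sc ''b'')) s'"
    from I obtain \<alpha> \<beta> \<upsilon> \<nu> where *: "snd s' ''a'' 0 0 = of_int \<alpha>" "snd s' ''b'' 0 0 = of_int \<beta>" "snd s' ''u'' 0 0 = of_int \<upsilon>"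
     "0 < \<alpha>" "0 \<le> \<beta>" "0 \<le> \<upsilon>" "\<upsilon> < q" "gcd \<alpha> \<beta> = gcd \<xi> q" "[\<upsilon> * \<xi> = \<alpha>] (mod q)" and sm: "same {''g''} ?A s s'"
      unfolding I_def by blast
    have "\<beta> = 0" using b *(2,5) by simp
    then have "\<alpha> = gcd \<xi> q" using *(4,8) by simp
    then show "t1 + t \<le> 5 + 2 * N * (30 + 18 * N) \<and> same {''g''} ?A s s' \<and> snd s' ''a'' 0 0 = of_int (gcd \<xi> q) \<and>
    (\<exists>\<upsilon>. snd s' ''u'' 0 0 = of_int \<upsilon> \<and> 0 \<le> \<upsilon> \<and> \<upsilon> < q \<and> [\<upsilon> * \<xi> = gcd \<xi> q] (mod q))"
      using t s1 sm * by (auto simp: algebra_simps)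
  qed
qed

section \<open>The elimination program\<close>

text \<open>Loops have no early exit, so the flag \<open>f\<close> switches off the remaining rounds
  once a pivot is found. After \<open>euclid\<close> the cell \<open>a\<close> holds a positive
  integer gcd, so \<open>a < 2\<close> tests for a unit, and \<open>u\<close> is then its
  inverse.\<close>

definition find_pivot_body :: com where
  "find_pivot_body = If (NLess (NVar ''f'') (NConst 1))
        (Seq (sset ''x'' (RCell ''X'' (NVar ''i'') (NVar ''j'')))
        (Seq euclid
          (If (RLess (sc ''a'') (RConst 2))
            (Seq (NAssign ''f'' (NConst 1)) (Seq (NAssign ''p'' (NVar ''j'')) (sset ''d'' (sc ''u''))))
            Skip)))
        Skip"

definition find_pivot :: com where
  "find_pivot =
    Seq (NAssign ''f'' (NConst 0))
    (For ''j'' (NVar ''n'') find_pivot_body)"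

lemma runs_find_pivot:
  fixes q :: int and x :: "nat \<Rightarrow> int"
  assumes s: "fst s ''n'' = n" "fst s ''i'' = i" "snd s ''q'' 0 0 = of_int q"
    and q: "1 < q" "q < 2 ^ N"
    and x: "\<And>j. j < n \<Longrightarrow> snd s ''X'' i j = of_int (x j) \<and> 0 \<le> x j \<and> x j < q"
  shows "runs zl gi find_pivot s (\<lambda>t s'. t \<le> 3 + n * (13 + 2 * N * (30 + 18 * N)) \<and>
    same {''g'', ''f'', ''j'', ''p''} {''r'', ''w'', ''m'', ''c'', ''a'', ''b'', ''u'', ''v'', ''x'', ''d''} s s' \<and>
    (fst s' ''f'' = 0 \<and> (\<forall>j<n. \<not> coprime (x j) q) \<or>
     fst s' ''f'' = 1 \<and> fst s' ''p'' < n \<and>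
     (\<exists>\<delta>. snd s' ''d'' 0 0 = of_int \<delta> \<and> 0 \<le> \<delta> \<and> \<delta> < q \<and> [\<delta> * x (fst s' ''p'') = 1] (mod q))))"
  (is "runs _ _ _ _ ?Q")
  unfolding find_pivot_def
proof (rule runs_SeqI)
  let ?N = "{''g'', ''f'', ''j'', ''p''}"
  let ?A = "{''r'', ''w'', ''m'', ''c'', ''a'', ''b'', ''u'', ''v'', ''x'', ''d''}"
  let ?B = "{''r'', ''w'', ''m'', ''c'', ''a'', ''b'', ''u'', ''v''}"
  define found where "found s' \<longleftrightarrow> fst s' ''f'' = 1 \<and> fst s' ''p'' < n \<and>
     (\<exists>\<delta>. snd s' ''d'' 0 0 = of_int \<delta> \<and> 0 \<le> \<delta> \<and> \<delta> < q \<and> [\<delta> * x (fst s' ''p'') = 1] (mod q))" for s' :: state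
  define I where "I k s' \<longleftrightarrow> same ?N ?A s s' \<and>
     (fst s' ''f'' = 0 \<and> (\<forall>j<k. \<not> coprime (x j) q) \<or> found s')" for k and s' :: state
  have found_j: "found (set_nvar ''j'' k s') \<longleftrightarrow> found s'" for k s' by (simp add: found_def)
  show "runs zl gi (NAssign ''f'' (NConst 0)) s (\<lambda>t s'. t = 1 \<and> s' = set_nvar ''f'' 0 s)" by simp
  fix t1 :: nat and s1 assume s1: "t1 = 1 \<and> s1 = set_nvar ''f'' 0 s"
  have "runs zl gi (For ''j'' (NVar ''n'') find_pivot_body) s1 (\<lambda>t s'. t \<le> 2 + n * ((11 + 2 * N * (30 + 18 * N)) + 2) \<and> I n s')"
  proof (rule runs_For)
    show "I 0 (set_nvar ''j'' 0 s1)" using s1 by (simp add: I_def same_set_nvar)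
    show "nval (NVar ''n'') s' = n" if "I k s'" for k s'
      using that same_fst[of ?N ?A s s' "''n''"] s(1) by (simp add: I_def)
    fix k s' assume k: "k < n" and I: "I k s'" and j: "fst s' ''j'' = k"
    have sm: "same ?N ?A s s'" using I by (simp add: I_def)
    show "runs zl gi find_pivot_body s' (\<lambda>t s'. t \<le> 11 + 2 * N * (30 + 18 * N) \<and> fst s' ''j'' = k \<and> I (Suc k) (set_nvar ''j'' (Suc k) s'))"
    proof (cases "fst s' ''f'' = 0")
      case False
      then have "found s'" using I by (simp add: I_def)
      then show ?thesis using False j sm by (simp add: find_pivot_body_def I_def found_j same_set_nvar)
    next
      case True
      then have nf: "\<not> found s'" and nc: "\<forall>j<k. \<not> coprime (x j) q" using I by (auto simp: I_def found_def)
      define s2 where "s2 = set_cell ''x'' 0 0 (snd s' ''X'' i k) s'"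
      have s2: "same ?N ?A s s2" "same {} {''x''} s' s2" using sm by (auto simp: s2_def same_set_cell)
      have "snd s2 ''x'' 0 0 = of_int (x k)" "snd s2 ''q'' 0 0 = of_int q"
        using same_snd[OF sm, of "''X''"] same_snd[OF sm, of "''q''"] x[OF k] s(3) by (simp_all add: s2_def)
      from runs_euclid[OF this(2,1) q] x[OF k]
      have e: "runs zl gi euclid s2 (\<lambda>t s'. t \<le> 5 + 2 * N * (30 + 18 * N) \<and>
        same {''g''} ?B s2 s' \<and> snd s' ''a'' 0 0 = of_int (gcd (x k) q) \<and>
        (\<exists>\<upsilon>. snd s' ''u'' 0 0 = of_int \<upsilon> \<and> 0 \<le> \<upsilon> \<and> \<upsilon> < q \<and> [\<upsilon> * x k = gcd (x k) q] (mod q)))" by blast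
      have b: "bval (NLess (NVar ''f'') (NConst 1)) s'" using True by simp
      have x2: "set_cell ''x'' (nval (NConst 0) s') (nval (NConst 0) s') (rval (RCell ''X'' (NVar ''i'') (NVar ''j'')) s') s' = s2"
        using same_fst[OF sm, of "''i''"] j s(2) by (simp add: s2_def)
      show ?thesis
        unfolding find_pivot_body_def runs_If if_P[OF b] runs_Seq[of _ _ "sset _ _"] runs_RAssign[of _ _ "''x''"] x2
      proof (rule runs_SeqI[OF e], elim conjE exE)
        fix t3 :: nat and s3 \<upsilon> assume t3: "t3 \<le> 5 + 2 * N * (30 + 18 * N)" and s3: "same {''g''} ?B s2 s3"
          "snd s3 ''a'' 0 0 = of_int (gcd (x k) q)" "snd s3 ''u'' 0 0 = of_int \<upsilon>" "0 \<le> \<upsilon>" "\<upsilon> < q"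
          "[\<upsilon> * x k = gcd (x k) q] (mod q)"
        have sm3: "same ?N ?A s s3" by (rule same_trans[OF s2(1) s3(1)]) auto
        have j3: "fst s3 ''j'' = k" and f3: "fst s3 ''f'' = 0"
          using same_fst[OF s3(1), of "''j''"] same_fst[OF s3(1), of "''f''"] j True by (simp_all add: s2_def)
        show "runs zl gi (If (RLess (sc ''a'') (RConst 2))
            (Seq (NAssign ''f'' (NConst 1)) (Seq (NAssign ''p'' (NVar ''j'')) (sset ''d'' (sc ''u''))))
            Skip) s3 (\<lambda>t s'. 1 + (1 + (t3 + t)) \<le> 11 + 2 * N * (30 + 18 * N) \<and> fst s' ''j'' = k \<and> I (Suc k) (set_nvar ''j'' (Suc k) s'))"
        proof (cases "gcd (x k) q = 1")
          case False
          have "0 < gcd (x k) q" using q by simp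
          with False have "1 < gcd (x k) q" by linarith
          then have "\<not> real_of_int (gcd (x k) q) < 2" by linarith
          moreover have "\<not> coprime (x k) q" using False by (simp add: coprime_iff_gcd_eq_1)
          ultimately show ?thesis
            using t3 sm3 j3 f3 nc s3(2) by (simp add: I_def same_set_nvar less_Suc_eq)
        next
          case True
          then have "[\<upsilon> * x k = 1] (mod q)" using s3(6) by simp
          then show ?thesis
            using t3 sm3 j3 k s3(2-5) True by (auto simp: I_def found_def intro!: same_set_nvar same_set_cell)
        qed
      qed
    qed
  qed
  then show "runs zl gi (For ''j'' (NVar ''n'') find_pivot_body) s1 (\<lambda>t. ?Q (t1 + t))"
    by (rule runs_mono) (use s1 in \<open>simp add: I_def found_def\<close>)
qed

abbreviation twice_n :: nexp where
  "twice_n \<equiv> NPlus (NVar ''n'') (NVar ''n'')"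

definition pivot_value :: com where
  "pivot_value = Seq (sset ''r'' (RMinus (RCell ''X'' (NVar ''k'') (NVar ''l''))
          (RTimes (RTimes (sc ''d'') (RCell ''X'' (NVar ''k'') (NVar ''p''))) (RCell ''X'' (NVar ''i'') (NVar ''l'')))))
        (sset ''m'' (sc ''q''))"

text \<open>Every new entry depends on the old pivot row and pivot column, so an update in place
  would destroy its own input. The array \<open>Y\<close> is only a buffer here and unrelated to the
  ghost matrix \<open>Y\<close>.\<close>

definition pivot_update :: com where
  "pivot_update =
    Seq (For2 ''k'' twice_n ''l'' twice_n
      (Seq pivot_value
      (Seq reduce (RAssign ''Y'' (NVar ''k'') (NVar ''l'') (sc ''r'')))))
    (For2 ''k'' twice_n ''l'' twice_n
      (RAssign ''X'' (NVar ''k'') (NVar ''l'') (RCell ''Y'' (NVar ''k'') (NVar ''l''))))"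

lemma runs_pivot_update:
  fixes q \<delta> :: int and X :: "nat \<Rightarrow> nat \<Rightarrow> int"
  assumes s: "fst s ''n'' = n" "fst s ''i'' = i" "fst s ''p'' = j" "snd s ''q'' 0 0 = of_int q" "snd s ''d'' 0 0 = of_int \<delta>"
    and q: "1 < q" "q < 2 ^ N" and \<delta>: "0 \<le> \<delta>" "\<delta> < q" and ij: "i < n" "j < n"
    and X: "\<And>a b. a < 2 * n \<Longrightarrow> b < 2 * n \<Longrightarrow> snd s ''X'' a b = of_int (X a b) \<and> 0 \<le> X a b \<and> X a b < q"
  shows "runs zl gi pivot_update s (\<lambda>t s'. t \<le> 4 + 2 * n * (2 * n * (24 + 18 * N) + 8) \<and>
    same {''g'', ''k'', ''l''} {''r'', ''w'', ''m'', ''X'', ''Y''} s s' \<and>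
    (\<forall>a<2 * n. \<forall>b<2 * n. snd s' ''X'' a b = of_int ((X a b - \<delta> * X a j * X i b) mod q)))"
  (is "runs _ _ _ _ ?Q")
  unfolding pivot_update_def
proof (rule runs_SeqI)
  let ?N = "{''g'', ''k'', ''l''}"
  let ?A = "{''r'', ''w'', ''m'', ''Y''}"
  define f where "f a b = (X a b - \<delta> * X a j * X i b) mod q" for a b
  show "runs zl gi (For2 ''k'' twice_n ''l'' twice_n
      (Seq pivot_value
      (Seq reduce (RAssign ''Y'' (NVar ''k'') (NVar ''l'') (sc ''r''))))) s
    (\<lambda>t s'. t \<le> 2 + (n + n) * ((n + n) * ((19 + 18 * N) + 2) + 4) \<and> same ?N ?A s s' \<and>
     (\<forall>a b. snd s' ''Y'' a b = (if a < n + n \<and> b < n + n then of_int (f a b) else snd s ''Y'' a b)))"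
  proof (rule runs_For2)
    show "nval twice_n s' = n + n \<and> nval twice_n s' = n + n" if "same ?N ?A s s'" for s'
      using same_fst[OF that, of "''n''"] s by simp
    fix a b s' assume ab: "a < n + n" "b < n + n" and sm: "same ?N ?A s s'" and k: "fst s' ''k'' = a" and l: "fst s' ''l'' = b"
    have v: "fst s' ''p'' = j" "fst s' ''i'' = i" "snd s' ''d'' 0 0 = of_int \<delta>" "snd s' ''q'' 0 0 = of_int q"
      "snd s' ''X'' = snd s ''X''"
      using same_fst[OF sm, of "''p''"] same_fst[OF sm, of "''i''"] same_snd[OF sm, of "''d''"]
        same_snd[OF sm, of "''q''"] same_snd[OF sm, of "''X''"] s by auto
    have q0: "0 < q" using q by simp
    have X4: "0 \<le> X a b" "X a b < q" "0 \<le> X a j" "X a j < q" "0 \<le> X i b" "X i b < q"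
      using X ab ij by auto
    \<comment> \<open>The subtracted term is a product of three factors below \<open>q\<close>, so
      \<open>3 N\<close> bits bound the number to be reduced.\<close>
    have b1: "\<delta> * X a j * X i b \<le> q * q * q"
      using X4 \<delta> by (intro mult_mono) auto
    have b2: "q * q * q < 2 ^ N * 2 ^ N * 2 ^ N"
      using q by (intro mult_strict_mono) auto
    have b3: "q \<le> 2 ^ N * 2 ^ N * 2 ^ N"
    proof -
      have "1 * 1 * q \<le> 2 ^ N * 2 ^ N * 2 ^ N" using q by (intro mult_mono) auto
      then show ?thesis by simp
    qed
    have b0: "0 \<le> \<delta> * X a j * X i b" using X4 \<delta> by simp
    have K: "\<bar>X a b - \<delta> * X a j * X i b\<bar> < 2 ^ (N + N + N)"
      unfolding power_add using b0 b1 b2 b3 X4 by linarith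
    define s2 where "s2 = set_cell ''m'' 0 0 (of_int q) (set_cell ''r'' 0 0 (of_int (X a b - \<delta> * X a j * X i b)) s')"
    have s2: "same ?N ?A s' s2" "snd s2 ''r'' 0 0 = of_int (X a b - \<delta> * X a j * X i b)" "snd s2 ''m'' 0 0 = of_int q"
      by (auto simp: s2_def same_set_cell)
    have 1: "runs zl gi pivot_value s' (\<lambda>t1 s1. t1 = 2 \<and> s1 = s2)"
      using k l v X ab ij by (simp add: pivot_value_def s2_def)
    show "runs zl gi (Seq pivot_value
      (Seq reduce (RAssign ''Y'' (NVar ''k'') (NVar ''l'') (sc ''r'')))) s' (\<lambda>t s''. t \<le> 19 + 18 * N \<and>
        same ?N ?A s' s'' \<and> fst s'' ''k'' = a \<and> fst s'' ''l'' = b \<and>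
        (\<forall>a' b'. snd s'' ''Y'' a' b' = (if a' = a \<and> b' = b then of_int (f a b) else snd s' ''Y'' a' b')))"
    proof (rule runs_SeqI[OF 1], elim conjE, simp only:, rule runs_SeqI[OF runs_reduce[OF s2(2,3) q0 K]], elim conjE)
      fix t3 :: nat and s3 assume t3: "t3 \<le> 10 + 6 * (N + N + N)" and s3: "same {''g''} {''r'', ''w''} s2 s3"
        "snd s3 ''r'' 0 0 = of_int ((X a b - \<delta> * X a j * X i b) mod q)"
      have "same ?N ?A s' s3" by (rule same_trans[OF s2(1) s3(1)]) auto
      moreover have "fst s3 ''k'' = a" "fst s3 ''l'' = b" "snd s3 ''Y'' = snd s' ''Y''"
        using same_fst[OF s3(1), of "''k''"] same_fst[OF s3(1), of "''l''"] same_snd[OF s3(1), of "''Y''"] k l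
        by (auto simp: s2_def set_cell_def)
      ultimately show "runs zl gi (RAssign ''Y'' (NVar ''k'') (NVar ''l'') (sc ''r'')) s3
        (\<lambda>t s''. 2 + (t3 + t) \<le> 19 + 18 * N \<and>
        same ?N ?A s' s'' \<and> fst s'' ''k'' = a \<and> fst s'' ''l'' = b \<and>
        (\<forall>a' b'. snd s'' ''Y'' a' b' = (if a' = a \<and> b' = b then of_int (f a b) else snd s' ''Y'' a' b')))"
        using t3 s3(2) by (simp add: f_def same_set_cell)
    qed
  qed auto
  fix t1 :: nat and s1 assume *: "t1 \<le> 2 + (n + n) * ((n + n) * ((19 + 18 * N) + 2) + 4) \<and> same ?N ?A s s1 \<and>
     (\<forall>a b. snd s1 ''Y'' a b = (if a < n + n \<and> b < n + n then of_int (f a b) else snd s ''Y'' a b))"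
  have "runs zl gi (For2 ''k'' twice_n ''l'' twice_n
      (RAssign ''X'' (NVar ''k'') (NVar ''l'') (RCell ''Y'' (NVar ''k'') (NVar ''l'')))) s1
    (\<lambda>t s'. t \<le> 2 + (n + n) * ((n + n) * (1 + 2) + 4) \<and> same ?N {''X''} s1 s' \<and>
     (\<forall>a b. snd s' ''X'' a b = (if a < n + n \<and> b < n + n then snd s1 ''Y'' a b else snd s1 ''X'' a b)))"
  proof (rule runs_For2)
    show "nval twice_n s' = n + n \<and> nval twice_n s' = n + n" if "same ?N {''X''} s1 s'" for s'
      using same_fst[OF that, of "''n''"] same_fst[of ?N ?A s s1 "''n''"] * s by simp
    fix a b s' assume "same ?N {''X''} s1 s'" "fst s' ''k'' = a" "fst s' ''l'' = b"
    then show "runs zl gi (RAssign ''X'' (NVar ''k'') (NVar ''l'') (RCell ''Y'' (NVar ''k'') (NVar ''l''))) s'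
      (\<lambda>t s''. t \<le> 1 \<and> same ?N {''X''} s' s'' \<and> fst s'' ''k'' = a \<and> fst s'' ''l'' = b \<and>
        (\<forall>a' b'. snd s'' ''X'' a' b' = (if a' = a \<and> b' = b then snd s1 ''Y'' a b else snd s' ''X'' a' b')))"
      using same_snd[of ?N "{''X''}" s1 s' "''Y''"] by (simp add: same_set_cell)
  qed auto
  then show "runs zl gi (For2 ''k'' twice_n ''l'' twice_n
      (RAssign ''X'' (NVar ''k'') (NVar ''l'') (RCell ''Y'' (NVar ''k'') (NVar ''l'')))) s1
    (\<lambda>t. ?Q (t1 + t))"
  proof (rule runs_mono, elim conjE, intro conjI)
    fix t :: nat and s' assume t: "t \<le> 2 + (n + n) * ((n + n) * (1 + 2) + 4)" and sm: "same ?N {''X''} s1 s'"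
      and X': "\<forall>a b. snd s' ''X'' a b = (if a < n + n \<and> b < n + n then snd s1 ''Y'' a b else snd s1 ''X'' a b)"
    have "t1 + t \<le> (2 + (n + n) * ((n + n) * ((19 + 18 * N) + 2) + 4)) + (2 + (n + n) * ((n + n) * (1 + 2) + 4))"
      using * t by (intro add_mono) auto
    also have "\<dots> = 4 + 2 * n * (2 * n * (24 + 18 * N) + 8)" by (simp add: algebra_simps)
    finally show "t1 + t \<le> 4 + 2 * n * (2 * n * (24 + 18 * N) + 8)" .
    show "same ?N {''r'', ''w'', ''m'', ''X'', ''Y''} s s'"
      by (rule same_trans[OF _ sm, of ?N ?A]) (use * in auto)
    show "\<forall>a<2 * n. \<forall>b<2 * n. snd s' ''X'' a b = of_int ((X a b - \<delta> * X a j * X i b) mod q)"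
      using X' * by (simp add: f_def)
  qed
qed

definition eliminate :: com where
  "eliminate = For ''i'' (NVar ''n'')
     (Seq find_pivot (If (NLess (NConst 0) (NVar ''f'')) pivot_update Skip))"

text \<open>One pass over the rows is enough. If row \<open>i\<close> contains no unit,
  \<open>p\<close> divides it; otherwise the pivot clears it modulo \<open>q\<close>. A later pivot
  subtracts from each earlier row a multiple of that row's entry in the pivot column, which
  \<open>p\<close> already divides, so finished rows stay divisible by \<open>p\<close>.\<close>

lemma runs_eliminate:
  fixes q p :: int and X :: "nat \<Rightarrow> nat \<Rightarrow> int"
  assumes s: "fst s ''n'' = n" "snd s ''q'' 0 0 = of_int q"
    and q: "q = p ^ e" "prime p" "0 < e" "1 < q" "q < 2 ^ N"
    and X: "\<And>a b. a < 2 * n \<Longrightarrow> b < 2 * n \<Longrightarrow> snd s ''X'' a b = of_int (X a b) \<and> 0 \<le> X a b \<and> X a b < q"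
    and inv: "elim_inv q n G X Y S" and G: "G \<in> carrier_mat n n"
  shows "runs zl gi eliminate s (\<lambda>t s'.
    t \<le> 2 + n * (10 + n * (13 + 2 * N * (30 + 18 * N)) + 2 * n * (2 * n * (24 + 18 * N) + 8)) \<and>
    same {''g'', ''f'', ''j'', ''p'', ''i'', ''k'', ''l''}
      {''r'', ''w'', ''m'', ''c'', ''a'', ''b'', ''u'', ''v'', ''x'', ''d'', ''X'', ''Y''} s s' \<and>
    (\<exists>X Y S. (\<forall>a<2 * n. \<forall>b<2 * n. snd s' ''X'' a b = of_int (X a b) \<and> 0 \<le> X a b \<and> X a b < q) \<and>
       elim_inv q n G X Y S \<and> (\<forall>a<n. \<forall>b<n. \<not> coprime (X a b) q)))"
proof -
  let ?N = "{''g'', ''f'', ''j'', ''p'', ''i'', ''k'', ''l''}"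
  let ?A = "{''r'', ''w'', ''m'', ''c'', ''a'', ''b'', ''u'', ''v'', ''x'', ''d'', ''X'', ''Y''}"
  \<comment> \<open>Since \<open>q\<close> is a power of \<open>p\<close>, being a unit modulo
    \<open>q\<close> is decided modulo \<open>p\<close>.\<close>
  have ncop: "\<not> coprime y q \<longleftrightarrow> p dvd y" for y
  proof
    assume "\<not> coprime y q"
    then have "\<not> coprime p y" using q(1) by (auto simp: coprime_commute)
    then show "p dvd y" using prime_imp_coprime q(2) by blast
  next
    assume "p dvd y"
    moreover have "p dvd q" using q(1,3) by simp
    ultimately show "\<not> coprime y q" using coprime_common_divisor not_prime_unit q(2) by blast
  qed
  define cells where "cells X s' \<longleftrightarrow> (\<forall>a<2 * n. \<forall>b<2 * n. snd s' ''X'' a b = of_int (X a b) \<and> 0 \<le> X a b \<and> X a b < q)"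
    for X :: "nat \<Rightarrow> nat \<Rightarrow> int" and s' :: state
  define I where "I i s' \<longleftrightarrow> same ?N ?A s s' \<and>
     (\<exists>X Y S. cells X s' \<and> elim_inv q n G X Y S \<and> (\<forall>a<i. \<forall>b<n. p dvd X a b))" for i s'
  let ?T = "8 + n * (13 + 2 * N * (30 + 18 * N)) + 2 * n * (2 * n * (24 + 18 * N) + 8)"
  have "runs zl gi eliminate s (\<lambda>t s'. t \<le> 2 + n * (?T + 2) \<and> I n s')"
    unfolding eliminate_def
  proof (rule runs_For)
    show "I 0 (set_nvar ''i'' 0 s)" unfolding I_def cells_def using X inv by (auto intro!: same_set_nvar)
    show "nval (NVar ''n'') s' = n" if "I k s'" for k s'
      using that same_fst[of ?N ?A s s' "''n''"] s(1) by (simp add: I_def)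
    fix i s1 assume i: "i < n" and I: "I i s1" and si: "fst s1 ''i'' = i"
    have sm1: "same ?N ?A s s1" using I by (simp add: I_def)
    obtain X Y S where X: "cells X s1" and inv: "elim_inv q n G X Y S" and rows: "\<forall>a<i. \<forall>b<n. p dvd X a b"
      using I unfolding I_def by blast
    have n1: "fst s1 ''n'' = n" and q1: "snd s1 ''q'' 0 0 = of_int q"
      using same_fst[OF sm1, of "''n''"] same_snd[OF sm1, of "''q''"] s by auto
    have Xi: "snd s1 ''X'' i j = of_int (X i j) \<and> 0 \<le> X i j \<and> X i j < q" if "j < n" for j
      using X i that by (simp add: cells_def)
    let ?A1 = "{''r'', ''w'', ''m'', ''c'', ''a'', ''b'', ''u'', ''v'', ''x'', ''d''}"
    show "runs zl gi (Seq find_pivot (If (NLess (NConst 0) (NVar ''f'')) pivot_update Skip)) s1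
      (\<lambda>t s'. t \<le> ?T \<and> fst s' ''i'' = i \<and> I (Suc i) (set_nvar ''i'' (Suc i) s'))"
    proof (rule runs_SeqI[OF runs_find_pivot[OF n1 si q1 q(4,5) Xi]], assumption, elim conjE)
      fix t2 :: nat and s2 assume t2: "t2 \<le> 3 + n * (13 + 2 * N * (30 + 18 * N))"
        and s2: "same {''g'', ''f'', ''j'', ''p''} ?A1 s1 s2"
        and alt: "fst s2 ''f'' = 0 \<and> (\<forall>j<n. \<not> coprime (X i j) q) \<or>
     fst s2 ''f'' = 1 \<and> fst s2 ''p'' < n \<and>
     (\<exists>\<delta>. snd s2 ''d'' 0 0 = of_int \<delta> \<and> 0 \<le> \<delta> \<and> \<delta> < q \<and> [\<delta> * X i (fst s2 ''p'') = 1] (mod q))"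
      have sm2: "same ?N ?A s s2" by (rule same_trans[OF sm1 s2]) auto
      have i2: "fst s2 ''i'' = i" and n2: "fst s2 ''n'' = n" and q2: "snd s2 ''q'' 0 0 = of_int q"
        and X2: "snd s2 ''X'' = snd s1 ''X''"
        using same_fst[OF s2, of "''i''"] same_fst[OF s2, of "''n''"] same_snd[OF s2, of "''q''"]
          same_snd[OF s2, of "''X''"] si n1 q1 by auto
      from alt show "runs zl gi (If (NLess (NConst 0) (NVar ''f'')) pivot_update Skip) s2
        (\<lambda>t s'. t2 + t \<le> ?T \<and> fst s' ''i'' = i \<and> I (Suc i) (set_nvar ''i'' (Suc i) s'))"
      proof (elim disjE conjE exE)
        assume f: "fst s2 ''f'' = 0" and nc: "\<forall>j<n. \<not> coprime (X i j) q"
        have "cells X (set_nvar ''i'' (Suc i) s2)" using X by (simp add: cells_def X2)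
        moreover have "\<forall>a<Suc i. \<forall>b<n. p dvd X a b" using rows nc ncop by (auto simp: less_Suc_eq)
        moreover have "same ?N ?A s (set_nvar ''i'' (Suc i) s2)" using sm2 by (auto intro!: same_set_nvar)
        ultimately have "I (Suc i) (set_nvar ''i'' (Suc i) s2)" unfolding I_def using inv by blast
        then show ?thesis using f t2 i2 by simp
      next
        fix \<delta> assume f: "fst s2 ''f'' = 1" and j: "fst s2 ''p'' < n" and \<delta>: "snd s2 ''d'' 0 0 = of_int \<delta>" "0 \<le> \<delta>" "\<delta> < q"
          "[\<delta> * X i (fst s2 ''p'') = 1] (mod q)"
        define j where "j = fst s2 ''p''"
        have jn: "j < n" using j by (simp add: j_def)
        have d1: "[\<delta> * X i j = 1] (mod q)" using \<delta>(4) by (simp add: j_def)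
        have X2': "snd s2 ''X'' a b = of_int (X a b) \<and> 0 \<le> X a b \<and> X a b < q" if "a < 2 * n" "b < 2 * n" for a b
          using X that by (simp add: cells_def X2)
        define X' where "X' a b = (X a b - \<delta> * X a j * X i b) mod q" for a b
        have "\<exists>Y'. elim_inv q n G X' Y' (insert j S)"
          by (rule elim_inv_pivot[OF inv G i jn d1 q(4)]) (simp add: X'_def cong_def)
        then obtain Y' where inv': "elim_inv q n G X' Y' (insert j S)" by blast
        have pq: "p dvd q" using q by simp
        have rows': "\<forall>a<Suc i. \<forall>b<n. p dvd X' a b"
        proof (intro allI impI)
          fix a b assume a: "a < Suc i" and b: "b < n"
          show "p dvd X' a b"
          proof (cases "a = i")
            case True
            have "X i b - \<delta> * X i j * X i b = (1 - \<delta> * X i j) * X i b" by (simp add: algebra_simps)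
            moreover have "q dvd 1 - \<delta> * X i j" using d1 by (simp add: cong_iff_dvd_diff dvd_diff_commute)
            ultimately have "X' a b = 0" using True by (simp add: X'_def)
            then show ?thesis by simp
          next
            case False
            then have "p dvd X a b" "p dvd X a j" using rows a b jn by auto
            then show ?thesis using pq by (simp add: X'_def dvd_mod)
          qed
        qed
        have p2: "fst s2 ''p'' = j" by (simp add: j_def)
        have "runs zl gi pivot_update s2 (\<lambda>t s'. 1 + (t2 + t) \<le> ?T \<and> fst s' ''i'' = i \<and> I (Suc i) (set_nvar ''i'' (Suc i) s'))"
        proof (rule runs_mono[OF runs_pivot_update[OF n2 i2 p2 q2 \<delta>(1) q(4,5) \<delta>(2,3) i jn X2']], assumption, assumption, elim conjE, intro conjI)
          fix t :: nat and s3 assume t: "t \<le> 4 + 2 * n * (2 * n * (24 + 18 * N) + 8)"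
            and s3: "same {''g'', ''k'', ''l''} {''r'', ''w'', ''m'', ''X'', ''Y''} s2 s3"
            and X3: "\<forall>a<2 * n. \<forall>b<2 * n. snd s3 ''X'' a b = of_int ((X a b - \<delta> * X a j * X i b) mod q)"
          show "1 + (t2 + t) \<le> ?T" using t2 t by linarith
          show "fst s3 ''i'' = i" using same_fst[OF s3, of "''i''"] i2 by simp
          have "same ?N ?A s s3" by (rule same_trans[OF sm2 s3]) auto
          then have "same ?N ?A s (set_nvar ''i'' (Suc i) s3)" by (auto intro!: same_set_nvar)
          moreover have "cells X' (set_nvar ''i'' (Suc i) s3)" using X3 q by (simp add: cells_def X'_def)
          ultimately show "I (Suc i) (set_nvar ''i'' (Suc i) s3)" unfolding I_def using inv' rows' by blast
        qed
        then show ?thesis using f by simp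
      qed
    qed
  qed
  then show ?thesis
    by (rule runs_mono) (auto simp: I_def cells_def ncop algebra_simps)
qed

section \<open>Array programs\<close>

lemma snd_set_cell_other: "y \<noteq> x \<Longrightarrow> snd (set_cell x i j r s) y = snd s y"
  by (simp add: set_cell_def)

definition dot_time :: "nat \<Rightarrow> nat" where
  "dot_time n = 2 + n * (n * (n * 3 + 6) + 4)"

text \<open>The summand is a parameter, so products with a transposed factor need no transposition:
  the expression \<open>e\<close> simply swaps its indices.\<close>

definition dotprod :: "vname \<Rightarrow> rexp \<Rightarrow> com" where
  "dotprod Z e = For2 ''i'' (NVar ''n'') ''j'' (NVar ''n'')
     (Seq (sset ''t'' (RConst 0))
     (Seq (For ''k'' (NVar ''n'') (sset ''t'' (RPlus (sc ''t'') e)))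
       (RAssign Z (NVar ''i'') (NVar ''j'') (sc ''t''))))"

lemma runs_dotprod:
  assumes n: "fst s ''n'' = n" and Z: "Z \<noteq> ''t''"
    and e: "\<And>s' i j k. same {''i'', ''j'', ''k''} {''t'', Z} s s' \<Longrightarrow> i < n \<Longrightarrow> j < n \<Longrightarrow> k < n \<Longrightarrow>
      fst s' ''i'' = i \<Longrightarrow> fst s' ''j'' = j \<Longrightarrow> fst s' ''k'' = k \<Longrightarrow> rval e s' = f i j k"
  shows "runs zl gi (dotprod Z e) s (\<lambda>t s'. t \<le> dot_time n \<and>
    same {''i'', ''j'', ''k''} {''t'', Z} s s' \<and>
    (\<forall>a b. snd s' Z a b = (if a < n \<and> b < n then \<Sum>k<n. f a b k else snd s Z a b)))"
proof -
  let ?N = "{''i'', ''j'', ''k''}" and ?A = "{''t'', Z}"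
  have "runs zl gi (dotprod Z e) s (\<lambda>t s'. t \<le> 2 + n * (n * ((n * 3 + 4) + 2) + 4) \<and>
    same ?N ?A s s' \<and>
    (\<forall>a b. snd s' Z a b = (if a < n \<and> b < n then \<Sum>k<n. f a b k else snd s Z a b)))"
    unfolding dotprod_def
  proof (rule runs_For2)
    show "nval (NVar ''n'') s' = n \<and> nval (NVar ''n'') s' = n" if "same ?N ?A s s'" for s'
      using same_fst[OF that, of "''n''"] n by simp
    fix i j s1 assume ij: "i < n" "j < n" and sm: "same ?N ?A s s1" and i: "fst s1 ''i'' = i" and j: "fst s1 ''j'' = j"
    define s2 where "s2 = set_cell ''t'' 0 0 0 s1"
    have s2: "same ?N {''t''} s1 s2" by (simp add: s2_def same_set_cell)
    define I where "I k s' \<longleftrightarrow> same ?N {''t''} s1 s' \<and> fst s' ''i'' = i \<and> fst s' ''j'' = j \<and>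
      snd s' ''t'' 0 0 = (\<Sum>l<k. f i j l)" for k s'
    have loop: "runs zl gi (For ''k'' (NVar ''n'') (sset ''t'' (RPlus (sc ''t'') e))) s2
      (\<lambda>t s'. t \<le> 2 + n * (1 + 2) \<and> I n s')"
    proof (rule runs_For)
      show "I 0 (set_nvar ''k'' 0 s2)" using s2 i j by (simp add: I_def s2_def same_set_nvar)
      show "nval (NVar ''n'') s' = n" if "I k s'" for k s'
        using same_fst[of ?N "{''t''}" s1 s' "''n''"] same_fst[OF sm, of "''n''"] that n by (simp add: I_def)
      fix k s' assume k: "k < n" "fst s' ''k'' = k" and I: "I k s'"
      have "same ?N ?A s s'" by (rule same_trans[OF sm, of ?N "{''t''}"]) (use I in \<open>auto simp: I_def\<close>)
      then have "rval e s' = f i j k" using e ij k I by (simp add: I_def)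
      then show "runs zl gi (sset ''t'' (RPlus (sc ''t'') e)) s'
        (\<lambda>t s''. t \<le> 1 \<and> fst s'' ''k'' = k \<and> I (Suc k) (set_nvar ''k'' (Suc k) s''))"
        using I k by (simp add: I_def same_set_nvar same_set_cell)
    qed
    have "runs zl gi (Seq (sset ''t'' (RConst 0))
     (Seq (For ''k'' (NVar ''n'') (sset ''t'' (RPlus (sc ''t'') e)))
       (RAssign Z (NVar ''i'') (NVar ''j'') (sc ''t'')))) s1 (\<lambda>t s'. t \<le> n * 3 + 4 \<and> same ?N ?A s1 s' \<and>
         fst s' ''i'' = i \<and> fst s' ''j'' = j \<and>
         (\<forall>a b. snd s' Z a b = (if a = i \<and> b = j then \<Sum>k<n. f i j k else snd s1 Z a b)))"
    proof (rule runs_SeqI[of _ _ _ _ "\<lambda>t s'. t = 1 \<and> s' = s2"])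
      show "runs zl gi (sset ''t'' (RConst 0)) s1 (\<lambda>t s'. t = 1 \<and> s' = s2)" by (simp add: s2_def)
      fix t1 :: nat and s1' assume "t1 = 1 \<and> s1' = s2"
      then have t1: "t1 = 1" and s1': "s1' = s2" by auto
      show "runs zl gi (Seq (For ''k'' (NVar ''n'') (sset ''t'' (RPlus (sc ''t'') e)))
       (RAssign Z (NVar ''i'') (NVar ''j'') (sc ''t''))) s1' (\<lambda>t s'. t1 + t \<le> n * 3 + 4 \<and> same ?N ?A s1 s' \<and>
         fst s' ''i'' = i \<and> fst s' ''j'' = j \<and>
         (\<forall>a b. snd s' Z a b = (if a = i \<and> b = j then \<Sum>k<n. f i j k else snd s1 Z a b)))"
        unfolding s1'
      proof (rule runs_SeqI[OF loop], elim conjE)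
        fix t2 :: nat and s3 assume t2: "t2 \<le> 2 + n * (1 + 2)" and I: "I n s3"
        have "same ?N ?A s1 s3" by (rule same_mono[of ?N "{''t''}"]) (use I in \<open>auto simp: I_def\<close>)
        moreover have "snd s3 Z = snd s1 Z" using same_snd[of ?N "{''t''}" s1 s3 Z] I Z by (simp add: I_def)
        ultimately show "runs zl gi (RAssign Z (NVar ''i'') (NVar ''j'') (sc ''t'')) s3 (\<lambda>t s'. t1 + (t2 + t) \<le> n * 3 + 4 \<and> same ?N ?A s1 s' \<and>
         fst s' ''i'' = i \<and> fst s' ''j'' = j \<and>
         (\<forall>a b. snd s' Z a b = (if a = i \<and> b = j then \<Sum>k<n. f i j k else snd s1 Z a b)))"
          using t1 t2 I by (simp add: I_def same_set_cell)
      qed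
    qed
    then show "runs zl gi (Seq (sset ''t'' (RConst 0))
     (Seq (For ''k'' (NVar ''n'') (sset ''t'' (RPlus (sc ''t'') e)))
       (RAssign Z (NVar ''i'') (NVar ''j'') (sc ''t'')))) s1 (\<lambda>t s'. t \<le> n * 3 + 4 \<and> same ?N ?A s1 s' \<and>
         fst s' ''i'' = i \<and> fst s' ''j'' = j \<and>
         (\<forall>a b. snd s' Z a b = (if a = i \<and> b = j then \<Sum>k<n. f i j k else snd s1 Z a b)))" .
  qed auto
  then show ?thesis by (rule runs_mono) (auto simp: dot_time_def add.commute)
qed

lemma runs_assign_For2:
  assumes xy: "x \<noteq> y" and Z: "\<And>s'. same {x, y} {Z} s s' \<Longrightarrow> nval e1 s' = m1 \<and> nval e2 s' = m2"
    and e: "\<And>s' i j. same {x, y} {Z} s s' \<Longrightarrow> i < m1 \<Longrightarrow> j < m2 \<Longrightarrow> fst s' x = i \<Longrightarrow> fst s' y = j \<Longrightarrow> rval e s' = f i j"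
  shows "runs zl gi (For2 x e1 y e2 (RAssign Z (NVar x) (NVar y) e)) s (\<lambda>t s'. t \<le> 2 + m1 * (m2 * 3 + 4) \<and>
    same {x, y} {Z} s s' \<and> (\<forall>a b. snd s' Z a b = (if a < m1 \<and> b < m2 then f a b else snd s Z a b)))"
proof -
  have "runs zl gi (For2 x e1 y e2 (RAssign Z (NVar x) (NVar y) e)) s (\<lambda>t s'. t \<le> 2 + m1 * (m2 * (1 + 2) + 4) \<and>
    same {x, y} {Z} s s' \<and> (\<forall>a b. snd s' Z a b = (if a < m1 \<and> b < m2 then f a b else snd s Z a b)))"
    by (rule runs_For2) (use assms in \<open>auto intro!: same_set_cell\<close>)
  then show ?thesis by (rule runs_mono) (auto simp: mult.commute)
qed

text \<open>The initial letter refers to \<open>nexp\<close>: this is the test for equality, not its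
  negation.\<close>

abbreviation NEq :: "nexp \<Rightarrow> nexp \<Rightarrow> bexp" where
  "NEq a b \<equiv> BAnd (BNot (NLess a b)) (BNot (NLess b a))"

definition reduce_q :: com where
  "reduce_q = Seq (sset ''m'' (sc ''q'')) reduce"

lemma runs_reduce_q:
  fixes \<rho> q :: int
  assumes "snd s ''r'' 0 0 = of_int \<rho>" "snd s ''q'' 0 0 = of_int q" "0 < q" "\<bar>\<rho>\<bar> < 2 ^ K"
  shows "runs zl gi reduce_q s (\<lambda>t s'. t \<le> 11 + 6 * K \<and> same {''g''} {''r'', ''w'', ''m''} s s' \<and>
     snd s' ''r'' 0 0 = of_int (\<rho> mod q))"
  unfolding reduce_q_def
proof (rule runs_SeqI[of _ _ _ _ "\<lambda>t s'. t = 1 \<and> s' = set_cell ''m'' 0 0 (of_int q) s"], simp add: assms, elim conjE, simp only:)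
  fix t1 :: nat and s1 :: state
  have sm: "same {} {''m''} s (set_cell ''m'' 0 0 (of_int q) s)" by (simp add: same_set_cell)
  show "runs zl gi reduce (set_cell ''m'' 0 0 (of_int q) s) (\<lambda>t s'. 1 + t \<le> 11 + 6 * K \<and>
    same {''g''} {''r'', ''w'', ''m''} s s' \<and> snd s' ''r'' 0 0 = of_int (\<rho> mod q))"
  proof (rule runs_mono[OF runs_reduce[OF _ _ assms(3,4)]])
    fix t s' assume *: "t \<le> 10 + 6 * K \<and> same {''g''} {''r'', ''w''} (set_cell ''m'' 0 0 (of_int q) s) s' \<and>
      snd s' ''r'' 0 0 = real_of_int (\<rho> mod q)"
    have "same {''g''} {''r'', ''w'', ''m''} s s'" by (rule same_trans[OF sm]) (use * in auto)
    then show "1 + t \<le> 11 + 6 * K \<and> same {''g''} {''r'', ''w'', ''m''} s s' \<and> snd s' ''r'' 0 0 = of_int (\<rho> mod q)"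
      using * by simp
  qed (use assms in auto)
qed

section \<open>Filling the block matrix and the weighted graph\<close>

definition init_X_value :: com where
  "init_X_value = If (NLess (NVar ''k'') (NVar ''n''))
        (If (NLess (NVar ''l'') (NVar ''n''))
          (Seq (sset ''r'' (RCell ''G'' (NVar ''k'') (NVar ''l''))) reduce_q)
          (If (NEq (NVar ''l'') (NPlus (NVar ''n'') (NVar ''k''))) (sset ''r'' (RConst 1)) (sset ''r'' (RConst 0))))
        (If (NEq (NVar ''k'') (NPlus (NVar ''n'') (NVar ''l''))) (sset ''r'' (RConst 1)) (sset ''r'' (RConst 0)))"

definition init_X :: com where
  "init_X = For2 ''k'' twice_n ''l'' twice_n
     (Seq init_X_value
      (RAssign ''X'' (NVar ''k'') (NVar ''l'') (sc ''r'')))"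

definition start_X :: "int \<Rightarrow> nat \<Rightarrow> int mat \<Rightarrow> nat \<Rightarrow> nat \<Rightarrow> int" where
  "start_X q n G a b = (if a < n \<and> b < n then G $$ (a, b) mod q else if b = n + a \<or> a = n + b then 1 else 0)"

lemma runs_init_X:
  fixes q :: int and G :: "int mat"
  assumes s: "fst s ''n'' = n" "snd s ''q'' 0 0 = of_int q"
    and G: "\<And>a b. a < n \<Longrightarrow> b < n \<Longrightarrow> snd s ''G'' a b = of_int (G $$ (a, b)) \<and> \<bar>G $$ (a, b)\<bar> < 2 ^ K"
    and q: "1 < q"
  shows "runs zl gi init_X s (\<lambda>t s'. t \<le> 2 + 2 * n * (2 * n * (17 + 6 * K) + 4) \<and>
    same {''g'', ''k'', ''l''} {''r'', ''w'', ''m'', ''X''} s s' \<and>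
    (\<forall>a<2 * n. \<forall>b<2 * n. snd s' ''X'' a b = of_int (start_X q n G a b)))"
proof -
  let ?N = "{''g'', ''k'', ''l''}" and ?A = "{''r'', ''w'', ''m'', ''X''}"
  have "runs zl gi init_X s (\<lambda>t s'. t \<le> 2 + (n + n) * ((n + n) * ((15 + 6 * K) + 2) + 4) \<and>
    same ?N ?A s s' \<and>
    (\<forall>a b. snd s' ''X'' a b = (if a < n + n \<and> b < n + n then of_int (start_X q n G a b) else snd s ''X'' a b)))"
    unfolding init_X_def
  proof (rule runs_For2)
    show "nval twice_n s' = n + n \<and> nval twice_n s' = n + n" if "same ?N ?A s s'" for s'
      using same_fst[OF that, of "''n''"] s by simp
    fix a b s1 assume ab: "a < n + n" "b < n + n" and sm: "same ?N ?A s s1" and k: "fst s1 ''k'' = a" and l: "fst s1 ''l'' = b"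
    have n1: "fst s1 ''n'' = n" and q1: "snd s1 ''q'' 0 0 = of_int q" and G1: "snd s1 ''G'' = snd s ''G''"
      using same_fst[OF sm, of "''n''"] same_snd[OF sm, of "''q''"] same_snd[OF sm, of "''G''"] s by auto
    show "runs zl gi (Seq init_X_value
      (RAssign ''X'' (NVar ''k'') (NVar ''l'') (sc ''r''))) s1 (\<lambda>t s'. t \<le> 15 + 6 * K \<and> same ?N ?A s1 s' \<and>
        fst s' ''k'' = a \<and> fst s' ''l'' = b \<and>
        (\<forall>a' b'. snd s' ''X'' a' b' = (if a' = a \<and> b' = b then of_int (start_X q n G a b) else snd s1 ''X'' a' b')))"
    proof (cases "a < n \<and> b < n")
      case True
      define s2 where "s2 = set_cell ''r'' 0 0 (of_int (G $$ (a, b))) s1"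
      have s2: "same ?N ?A s1 s2" "snd s2 ''r'' 0 0 = of_int (G $$ (a, b))" "snd s2 ''q'' 0 0 = of_int q"
        using q1 by (auto simp: s2_def same_set_cell)
      have q0: "0 < q" using q by simp
      have Gab: "\<bar>G $$ (a, b)\<bar> < 2 ^ K" and r2: "set_cell ''r'' 0 0 (snd s1 ''G'' a b) s1 = s2"
        using G True by (auto simp: s2_def G1)
      have red: "runs zl gi reduce_q s2 (\<lambda>t s'. t \<le> 11 + 6 * K \<and> same ?N ?A s1 s' \<and> fst s' ''k'' = a \<and> fst s' ''l'' = b \<and>
        snd s' ''X'' = snd s1 ''X'' \<and> snd s' ''r'' 0 0 = of_int (start_X q n G a b))"
      proof (rule runs_mono[OF runs_reduce_q[OF s2(2,3) q0 Gab]], elim conjE, intro conjI)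
        fix t :: nat and s' assume *: "same {''g''} {''r'', ''w'', ''m''} s2 s'" "snd s' ''r'' 0 0 = of_int (G $$ (a, b) mod q)"
        show "same ?N ?A s1 s'" by (rule same_trans[OF s2(1) *(1)]) auto
        show "fst s' ''k'' = a" "fst s' ''l'' = b" "snd s' ''X'' = snd s1 ''X''"
          using same_fst[OF *(1), of "''k''"] same_fst[OF *(1), of "''l''"] same_snd[OF *(1), of "''X''"] k l
          by (auto simp: s2_def set_cell_def)
        show "snd s' ''r'' 0 0 = of_int (start_X q n G a b)" using * True by (simp add: start_X_def)
      qed
      have b: "bval (NLess (NVar ''k'') (NVar ''n'')) s1" "bval (NLess (NVar ''l'') (NVar ''n'')) s1"
        using True k l n1 by auto
      show ?thesis
        unfolding init_X_value_def runs_Seq runs_If if_P[OF b(1)] if_P[OF b(2)] runs_RAssign[of _ _ "''r''"] rval.simps nval.simps k l r2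
        by (rule runs_mono[OF red]) (auto intro!: same_set_cell)
    next
      case False
      then show ?thesis using k l n1 ab by (auto simp: init_X_value_def start_X_def intro!: same_set_cell)
    qed
  qed auto
  then show ?thesis by (rule runs_mono) (auto simp: mult_2 add.assoc)
qed

lemma elim_inv_start_X:
  assumes "G \<in> carrier_mat n n" "1 < q"
  shows "elim_inv q n G (start_X q n G) (0\<^sub>m n n) {}"
    and "0 \<le> start_X q n G a b \<and> start_X q n G a b < q"
  using assms by (auto intro!: elim_inv_init simp: start_X_def cong_def)

text \<open>The array \<open>P\<close> is filled with the negated projector, so the minus sign
  stands where the two vertices carry the same sign. The variables \<open>k\<close> and
  \<open>l\<close> are the vertices, \<open>i\<close> and \<open>j\<close> their indices without
  sign.\<close>

definition graph_value :: com where
  "graph_value = If (NEq (NVar ''i'') (NVar ''j''))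
        (If (NEq (NVar ''k'') (NVar ''l'')) (sset ''r'' (RConst 0))
          (Seq (sset ''r'' (RMinus (RConst 0) (RCell ''P'' (NVar ''i'') (NVar ''i''))))
            (Seq reduce_q (sset ''r'' (RPlus (sc ''q'') (sc ''r''))))))
        (Seq
          (If (NLess (NVar ''k'') (NVar ''n''))
            (If (NLess (NVar ''l'') (NVar ''n''))
              (sset ''r'' (RMinus (RConst 0) (RCell ''P'' (NVar ''i'') (NVar ''j''))))
              (sset ''r'' (RCell ''P'' (NVar ''i'') (NVar ''j''))))
            (If (NLess (NVar ''l'') (NVar ''n''))
              (sset ''r'' (RCell ''P'' (NVar ''i'') (NVar ''j'')))
              (sset ''r'' (RMinus (RConst 0) (RCell ''P'' (NVar ''i'') (NVar ''j''))))))
          reduce_q)"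

definition graph_row :: com where
  "graph_row = If (NLess (NVar ''k'') (NVar ''n'')) (NAssign ''i'' (NVar ''k'')) (NAssign ''i'' (NMinus (NVar ''k'') (NVar ''n'')))"

definition graph_col :: com where
  "graph_col = If (NLess (NVar ''l'') (NVar ''n'')) (NAssign ''j'' (NVar ''l'')) (NAssign ''j'' (NMinus (NVar ''l'') (NVar ''n'')))"

definition graph_array :: com where
  "graph_array = For2 ''k'' twice_n ''l'' twice_n
    (Seq graph_row
    (Seq graph_col
    (Seq graph_value
      (RAssign ''A'' (NVar ''k'') (NVar ''l'') (sc ''r'')))))"

lemma runs_graph_array:
  fixes q :: int and P :: "int mat"
  assumes s: "fst s ''n'' = n" "snd s ''q'' 0 0 = of_int q"
    and P: "\<And>a b. a < n \<Longrightarrow> b < n \<Longrightarrow> snd s ''P'' a b = - of_int (P $$ (a, b)) \<and> \<bar>P $$ (a, b)\<bar> < 2 ^ K"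
    and q: "1 < q"
  shows "runs zl gi graph_array s (\<lambda>t s'. t \<le> 2 + 2 * n * (2 * n * (22 + 6 * K) + 4) \<and>
    same {''g'', ''i'', ''j'', ''k'', ''l''} {''r'', ''w'', ''m'', ''A''} s s' \<and>
    (\<forall>a<2 * n. \<forall>b<2 * n. snd s' ''A'' a b = of_int (graph_weight q n P a b)))"
proof -
  let ?N = "{''g'', ''i'', ''j'', ''k'', ''l''}" and ?A = "{''r'', ''w'', ''m'', ''A''}"
  have "runs zl gi graph_array s (\<lambda>t s'. t \<le> 2 + (n + n) * ((n + n) * ((20 + 6 * K) + 2) + 4) \<and>
    same ?N ?A s s' \<and>
    (\<forall>a b. snd s' ''A'' a b = (if a < n + n \<and> b < n + n then of_int (graph_weight q n P a b) else snd s ''A'' a b)))"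
    unfolding graph_array_def
  proof (rule runs_For2)
    show "nval twice_n s' = n + n \<and> nval twice_n s' = n + n" if "same ?N ?A s s'" for s'
      using same_fst[OF that, of "''n''"] s by simp
    fix a b s1 assume ab: "a < n + n" "b < n + n" and sm: "same ?N ?A s s1" and k: "fst s1 ''k'' = a" and l: "fst s1 ''l'' = b"
    have n1: "fst s1 ''n'' = n" and q1: "snd s1 ''q'' 0 0 = of_int q" and P1: "snd s1 ''P'' = snd s ''P''"
      using same_fst[OF sm, of "''n''"] same_snd[OF sm, of "''q''"] same_snd[OF sm, of "''P''"] s by auto
    have ij: "vertex_index n a < n" "vertex_index n b < n" using ab by (auto intro!: vertex_index_less)
    have q0: "0 < q" using q by simp
    define s3 where "s3 = set_nvar ''j'' (vertex_index n b) (set_nvar ''i'' (vertex_index n a) s1)"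
    have s3: "same ?N ?A s1 s3" "fst s3 ''k'' = a" "fst s3 ''l'' = b" "fst s3 ''i'' = vertex_index n a" "fst s3 ''j'' = vertex_index n b"
      "fst s3 ''n'' = n" "snd s3 = snd s1"
      using k l n1 by (auto simp: s3_def same_set_nvar)
    define rest where "rest s4 \<longleftrightarrow> same ?N ?A s1 s4 \<and> fst s4 ''k'' = a \<and> fst s4 ''l'' = b \<and>
        snd s4 ''A'' = snd s1 ''A''" for s4
    have red: "runs zl gi reduce_q (set_cell ''r'' 0 0 (of_int x) s3) (\<lambda>t s'. t \<le> 11 + 6 * K \<and> rest s' \<and>
        snd s' ''q'' 0 0 = of_int q \<and> snd s' ''r'' 0 0 = of_int (x mod q))" if "\<bar>x\<bar> < 2 ^ K" for x :: int
    proof (rule runs_mono[OF runs_reduce_q[OF _ _ q0 that]])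
      fix t s' assume *: "t \<le> 11 + 6 * K \<and> same {''g''} {''r'', ''w'', ''m''} (set_cell ''r'' 0 0 (of_int x) s3) s' \<and>
        snd s' ''r'' 0 0 = real_of_int (x mod q)"
      then have sm': "same {''g''} {''r'', ''w'', ''m''} (set_cell ''r'' 0 0 (of_int x) s3) s'" by blast
      have sm0: "same ?N ?A s1 (set_cell ''r'' 0 0 (of_int x) s3)" using s3(1) by (simp add: same_set_cell)
      have "same ?N ?A s1 s'" by (rule same_trans[OF sm0 sm']) auto
      then show "t \<le> 11 + 6 * K \<and> rest s' \<and> snd s' ''q'' 0 0 = of_int q \<and> snd s' ''r'' 0 0 = of_int (x mod q)"
        using * same_fst[OF sm', of "''k''"] same_fst[OF sm', of "''l''"] same_snd[OF sm', of "''A''"]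
          same_snd[OF sm', of "''q''"] s3 q1
        by (simp add: rest_def set_cell_def)
    qed (use s3 q1 in auto)
    have P3: "snd s3 ''P'' (vertex_index n a) (vertex_index n b) = - of_int (P $$ (vertex_index n a, vertex_index n b))"
      "snd s3 ''P'' (vertex_index n a) (vertex_index n a) = - of_int (P $$ (vertex_index n a, vertex_index n a))"
      using P ij s3(7) P1 by auto
    define w where "w = graph_weight q n P a b"
    have mid: "runs zl gi graph_value s3 (\<lambda>t s'. t \<le> 15 + 6 * K \<and> rest s' \<and> snd s' ''r'' 0 0 = of_int w)"
    proof (cases "vertex_index n a = vertex_index n b")
      case True
      show ?thesis
      proof (cases "a = b")
        case True
        then show ?thesis using s3 \<open>vertex_index n a = vertex_index n b\<close>
          by (simp add: graph_value_def rest_def w_def graph_weight_def same_set_cell snd_set_cell_other)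
      next
        case False
        have "\<bar>P $$ (vertex_index n a, vertex_index n a)\<bar> < 2 ^ K" using P ij by blast
        note r = red[OF this]
        have w: "w = q + P $$ (vertex_index n a, vertex_index n a) mod q" using True False by (simp add: w_def graph_weight_def)
        have "runs zl gi (Seq reduce_q (sset ''r'' (RPlus (sc ''q'') (sc ''r'')))) (set_cell ''r'' 0 0 (of_int (P $$ (vertex_index n a, vertex_index n a))) s3)
           (\<lambda>t s'. t \<le> 12 + 6 * K \<and> rest s' \<and> snd s' ''r'' 0 0 = of_int w)"
          unfolding runs_Seq
          by (rule runs_mono[OF r]) (auto simp: rest_def w set_cell_def intro!: same_set_cell[unfolded set_cell_def])
        then show ?thesis
          using True False s3(2-6) P3(2) by (auto simp: graph_value_def elim!: runs_mono)
      qed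
    next
      case False
      have "\<bar>P $$ (vertex_index n a, vertex_index n b)\<bar> < 2 ^ K" using P ij by blast
      then have "\<bar>vertex_sign n a * vertex_sign n b * P $$ (vertex_index n a, vertex_index n b)\<bar> < 2 ^ K" by (simp add: vertex_sign_def abs_mult)
      note r = red[OF this]
      have w: "w = (vertex_sign n a * vertex_sign n b * P $$ (vertex_index n a, vertex_index n b)) mod q" using False by (simp add: w_def graph_weight_def)
      have sel: "(if a < n then if b < n then - snd s3 ''P'' (vertex_index n a) (vertex_index n b) else snd s3 ''P'' (vertex_index n a) (vertex_index n b)
         else if b < n then snd s3 ''P'' (vertex_index n a) (vertex_index n b) else - snd s3 ''P'' (vertex_index n a) (vertex_index n b))
        = of_int (vertex_sign n a * vertex_sign n b * P $$ (vertex_index n a, vertex_index n b))"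
        using P3(1) by (auto simp: vertex_sign_def)
      have "runs zl gi reduce_q (set_cell ''r'' 0 0 (of_int (vertex_sign n a * vertex_sign n b * P $$ (vertex_index n a, vertex_index n b))) s3)
         (\<lambda>t s'. t \<le> 11 + 6 * K \<and> rest s' \<and> snd s' ''r'' 0 0 = of_int w)"
        by (rule runs_mono[OF r]) (simp add: w)
      then show ?thesis unfolding sel[symmetric]
        using False s3(2-6) by (cases "a < n"; cases "b < n") (auto simp: graph_value_def elim!: runs_mono)
    qed
    have i_asg: "runs zl gi graph_row
      s1 (\<lambda>t s'. t = 2 \<and> s' = set_nvar ''i'' (vertex_index n a) s1)"
      using k n1 by (simp add: graph_row_def vertex_index_def)
    have j_asg: "runs zl gi graph_col
      (set_nvar ''i'' (vertex_index n a) s1) (\<lambda>t s'. t = 2 \<and> s' = s3)"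
      using l n1 by (simp add: graph_col_def vertex_index_def s3_def)
    show "runs zl gi (Seq graph_row
    (Seq graph_col
    (Seq graph_value
      (RAssign ''A'' (NVar ''k'') (NVar ''l'') (sc ''r''))))) s1 (\<lambda>t s'. t \<le> 20 + 6 * K \<and> same ?N ?A s1 s' \<and>
        fst s' ''k'' = a \<and> fst s' ''l'' = b \<and>
        (\<forall>a' b'. snd s' ''A'' a' b' = (if a' = a \<and> b' = b then of_int (graph_weight q n P a b) else snd s1 ''A'' a' b')))"
    proof (rule runs_SeqI[OF i_asg], elim conjE, simp only:, rule runs_SeqI[OF j_asg], elim conjE, simp only:, rule runs_SeqI[OF mid], elim conjE)
      fix t4 :: nat and s4 assume "t4 \<le> 15 + 6 * K" "rest s4" "snd s4 ''r'' 0 0 = of_int w"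
      then show "runs zl gi (RAssign ''A'' (NVar ''k'') (NVar ''l'') (sc ''r'')) s4 (\<lambda>t s'. 2 + (2 + (t4 + t)) \<le> 20 + 6 * K \<and> same ?N ?A s1 s' \<and>
        fst s' ''k'' = a \<and> fst s' ''l'' = b \<and>
        (\<forall>a' b'. snd s' ''A'' a' b' = (if a' = a \<and> b' = b then of_int (graph_weight q n P a b) else snd s1 ''A'' a' b')))"
        by (simp add: rest_def w_def same_set_cell)
    qed
  qed auto
  then show ?thesis by (rule runs_mono) (auto simp: mult_2 add.assoc)
qed

section \<open>The program for one lattice\<close>

text \<open>\<open>O1\<close> and the answer \<open>Q\<close> map the integer lattice onto the same
  lattice, so \<open>Q^T O1\<close> is an automorphism of the integer lattice, that is, an integral
  orthogonal matrix.\<close>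

lemma orthonormal_int_factor:
  assumes "orthonormal_mat n O1" "lattice_iso_by n Q (mat_image O1 (Zn n)) (Zn n)"
  obtains T where "T \<in> carrier_mat n n" "transpose_mat T * T = 1\<^sub>m n" "O1 = Q * rmat T"
proof -
  have Q: "orthonormal_mat n Q" and eq: "mat_image O1 (Zn n) = mat_image Q (Zn n)"
    using assms(2) by (auto simp: lattice_iso_by_def)
  have O1: "O1 \<in> carrier_mat n n" and Qc: "Q \<in> carrier_mat n n"
    using assms(1) Q by (auto simp: orthonormal_mat_def)
  obtain T where T: "T \<in> carrier_mat n n" "O1 = Q * rmat T"
  proof (rule int_cols_factor[OF O1 Q])
    fix z :: "int vec" assume "z \<in> carrier_vec n"
    then have "O1 *\<^sub>v rvec z \<in> mat_image Q (Zn n)" unfolding eq[symmetric] by (auto simp: mat_image_def Zn_def)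
    then show "\<exists>x\<in>carrier_vec n. O1 *\<^sub>v rvec z = Q *\<^sub>v rvec x" by (auto simp: mat_image_def Zn_def)
  qed
  have "rmat T = transpose_mat Q * O1"
    unfolding T(2) using orthonormal_cancel(1)[OF Q, of "rmat T"] T(1) by simp
  then have "orthonormal_mat n (rmat T)"
    using orthonormal_mult[OF orthonormal_cancel(5)[OF Q] assms(1)] by simp
  then have "transpose_mat T * T = 1\<^sub>m n" using orthonormal_int[OF T(1)] by simp
  then show ?thesis using that T by blast
qed

lemma gram_orthogonal:
  assumes "T \<in> carrier_mat n n" "transpose_mat T * T = 1\<^sub>m n" "U \<in> carrier_mat n n"
  shows "transpose_mat (T * U) * (T * U) = transpose_mat U * (U :: int mat)"
proof -
  have c: "transpose_mat T \<in> carrier_mat n n" "transpose_mat U \<in> carrier_mat n n" using assms by auto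
  have "transpose_mat (T * U) * (T * U) = transpose_mat U * ((transpose_mat T * T) * U)"
    using assms(1,3) c by (simp add: transpose_mult[of _ n n _ n] sq_mat_simps[where n = n])
  then show ?thesis using assms by simp
qed

lemma trivial_hull_orthogonal:
  assumes T: "T \<in> carrier_mat n n" "transpose_mat T * T = 1\<^sub>m n" and U: "trivial_hull q n U"
  shows "trivial_hull q n (T * U)"
proof -
  have Uc: "U \<in> carrier_mat n n" using U by (simp add: trivial_hull_def)
  show ?thesis
    unfolding trivial_hull_def gram_orthogonal[OF T Uc]
  proof (intro conjI ballI impI)
    fix z :: "int vec" assume z: "z \<in> carrier_vec n" and "vdvd q ((transpose_mat U * U) *\<^sub>v z)"
    then have "vdvd q (U *\<^sub>v z)" using U by (auto simp: trivial_hull_def)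
    then have "vdvd q (T *\<^sub>v (U *\<^sub>v z))" by (rule vdvd_mult_vec) (use T Uc in simp)
    then show "vdvd q ((T * U) *\<^sub>v z)" using T Uc z by simp
  qed (use T Uc in auto)
qed

section \<open>Magnitudes and sizes\<close>

lemma real_size_le: "\<bar>x\<bar> \<le> 2 ^ k \<Longrightarrow> real_size x \<le> k + 2"
proof -
  assume x: "\<bar>x\<bar> \<le> 2 ^ k"
  have "1 \<le> (2::real) ^ k" by simp
  with x have "1 + \<bar>x\<bar> \<le> 2 ^ (k + 1)" unfolding power_add power_one_right by linarith
  then have "log 2 (1 + \<bar>x\<bar>) \<le> log 2 (2 ^ (k + 1))" by (subst log_le_cancel_iff) auto
  also have "\<dots> = real (k + 1)" by (subst log_pow_cancel) auto
  finally have "\<lceil>log 2 (1 + \<bar>x\<bar>)\<rceil> \<le> int (k + 1)" by (simp add: ceiling_le_iff)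
  then show ?thesis unfolding real_size_def by linarith
qed

text \<open>The link from input size to magnitude: with \<open>N\<close> the size of the whole
  input, \<open>2^N\<close> bounds \<open>q\<close>, the dimension and every basis entry. All later
  bounds are powers of this one.\<close>

lemma le_real_size: "\<bar>x\<bar> < 2 ^ real_size x"
proof -
  have "1 + \<bar>x\<bar> = 2 powr log 2 (1 + \<bar>x\<bar>)" by simp
  also have "\<dots> \<le> 2 powr real (nat \<lceil>log 2 (1 + \<bar>x\<bar>)\<rceil>)"
    by (intro powr_mono real_nat_ceiling_ge) auto
  also have "\<dots> = 2 ^ nat \<lceil>log 2 (1 + \<bar>x\<bar>)\<rceil>" by (rule powr_realpow) simp
  also have "\<dots> \<le> 2 ^ real_size x" by (rule power_increasing, unfold real_size_def, rule le_add2) simp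
  finally show ?thesis by simp
qed

lemma mat_size_le:
  assumes "A \<in> carrier_mat d d" "\<And>i j. i < d \<Longrightarrow> j < d \<Longrightarrow> \<bar>A $$ (i, j)\<bar> \<le> 2 ^ k"
  shows "mat_size A \<le> d * (d * (k + 2))"
proof -
  have d: "dim_row A = d" "dim_col A = d" using assms(1) by auto
  have "mat_size A \<le> (\<Sum>i<d. \<Sum>j<d. k + 2)"
    unfolding mat_size_def d by (intro sum_mono real_size_le assms(2)) auto
  then show ?thesis by simp
qed

text \<open>The columns have norm 1. Hence the oracle cannot blow up the numbers, whichever of the
  valid answers it gives.\<close>

lemma orthonormal_entry_le:
  assumes "orthonormal_mat n Q" "i < n" "j < n"
  shows "\<bar>Q $$ (i, j)\<bar> \<le> 1"
proof -
  have Q: "Q \<in> carrier_mat n n" using assms by (simp add: orthonormal_mat_def)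
  have "(\<Sum>k = 0..<n. Q $$ (k, j) * Q $$ (k, j)) = (transpose_mat Q * Q) $$ (j, j)"
    using Q assms by (auto simp: scalar_prod_def intro!: sum.cong)
  also have "\<dots> = 1" using assms by (simp add: orthonormal_mat_def)
  finally have s: "(\<Sum>k = 0..<n. Q $$ (k, j) * Q $$ (k, j)) = 1" .
  have "Q $$ (i, j) * Q $$ (i, j) \<le> (\<Sum>k = 0..<n. Q $$ (k, j) * Q $$ (k, j))"
    using assms by (intro member_le_sum) auto
  then have "(Q $$ (i, j))\<^sup>2 \<le> 1" unfolding s by (simp add: power2_eq_square)
  then show ?thesis by (simp add: abs_square_le_1)
qed

text \<open>Exponents simply add up, with \<open>c\<close> accounting for the number of summands.
  The result is needed both for integers and for reals.\<close>

lemma sum_prod_le_power: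
  fixes f g :: "nat \<Rightarrow> 'a :: linordered_idom"
  assumes "\<And>k. k < n \<Longrightarrow> \<bar>f k\<bar> \<le> 2 ^ a" "\<And>k. k < n \<Longrightarrow> \<bar>g k\<bar> \<le> 2 ^ b" "n \<le> 2 ^ c"
  shows "\<bar>\<Sum>k<n. f k * g k\<bar> \<le> 2 ^ (a + b + c)"
proof -
  have "\<bar>\<Sum>k<n. f k * g k\<bar> \<le> (\<Sum>k<n. \<bar>f k * g k\<bar>)" by (rule sum_abs)
  also have "\<dots> \<le> (\<Sum>k<n. 2 ^ a * 2 ^ b)"
    unfolding abs_mult using assms by (intro sum_mono mult_mono) auto
  also have "\<dots> = of_nat n * 2 ^ (a + b)" by (simp add: power_add)
  also have "\<dots> \<le> of_nat (2 ^ c) * 2 ^ (a + b)"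
    using assms(3) by (intro mult_right_mono) (simp_all only: of_nat_le_iff zero_le_power zero_le_numeral)
  also have "\<dots> = 2 ^ (a + b + c)" by (simp add: power_add mult.commute)
  finally show ?thesis .
qed

section \<open>Elimination, oracle query and graph for a single basis\<close>

definition gram_eliminate :: com where
  "gram_eliminate =
    Seq (dotprod ''G'' (RTimes (RCell ''B'' (NVar ''k'') (NVar ''i'')) (RCell ''B'' (NVar ''k'') (NVar ''j''))))
    (Seq init_X eliminate)"

definition gram_time :: "nat \<Rightarrow> nat \<Rightarrow> nat" where
  "gram_time n N = dot_time n + (2 + 2 * n * (2 * n * (17 + 6 * (3 * N + 1)) + 4)) +
      (2 + n * (10 + n * (13 + 2 * N * (30 + 18 * N)) + 2 * n * (2 * n * (24 + 18 * N) + 8)))"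

lemma runs_gram_eliminate:
  fixes q p :: int and U :: "int mat" and B :: "real mat"
  assumes s: "fst s ''n'' = n" "snd s ''q'' 0 0 = of_int q"
    and B: "B \<in> carrier_mat n n" "\<And>i j. i < n \<Longrightarrow> j < n \<Longrightarrow> snd s ''B'' i j = B $$ (i, j) \<and> \<bar>B $$ (i, j)\<bar> \<le> 2 ^ N"
    and q: "q = p ^ e" "prime p" "0 < e" "1 < q" "q < 2 ^ N" and n: "n \<le> 2 ^ N"
    and O1: "orthonormal_mat n O1" and U: "U \<in> carrier_mat n n" "B = O1 * rmat U"
  shows "runs zl gi gram_eliminate s (\<lambda>t s'.
    t \<le> gram_time n N \<and>
    same {''g'', ''f'', ''j'', ''p'', ''i'', ''k'', ''l''}
      {''r'', ''w'', ''m'', ''c'', ''a'', ''b'', ''u'', ''v'', ''x'', ''d'', ''X'', ''Y'', ''t'', ''G''} s s' \<and>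
    (\<exists>X Y S. (\<forall>a<2 * n. \<forall>b<2 * n. snd s' ''X'' a b = of_int (X a b) \<and> 0 \<le> X a b \<and> X a b < q) \<and>
       elim_inv q n (transpose_mat U * U) X Y S \<and> (\<forall>a<n. \<forall>b<n. \<not> coprime (X a b) q)))"
  (is "runs _ _ _ _ ?Q")
  unfolding gram_eliminate_def
proof (rule runs_SeqI)
  let ?N = "{''g'', ''f'', ''j'', ''p'', ''i'', ''k'', ''l''}"
  let ?A = "{''r'', ''w'', ''m'', ''c'', ''a'', ''b'', ''u'', ''v'', ''x'', ''d'', ''X'', ''Y'', ''t'', ''G''}"
  define G where "G = transpose_mat U * U"
  have G: "G \<in> carrier_mat n n" using U by (simp add: G_def)
  show "runs zl gi (dotprod ''G'' (RTimes (RCell ''B'' (NVar ''k'') (NVar ''i'')) (RCell ''B'' (NVar ''k'') (NVar ''j'')))) s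
    (\<lambda>t s'. t \<le> dot_time n \<and> same {''i'', ''j'', ''k''} {''t'', ''G''} s s' \<and>
      (\<forall>a b. snd s' ''G'' a b = (if a < n \<and> b < n then \<Sum>k<n. snd s ''B'' k a * snd s ''B'' k b else snd s ''G'' a b)))"
    by (rule runs_dotprod[OF s(1)]) (auto simp: same_snd)
  fix t1 :: nat and s1 assume "t1 \<le> dot_time n \<and> same {''i'', ''j'', ''k''} {''t'', ''G''} s s1 \<and>
      (\<forall>a b. snd s1 ''G'' a b = (if a < n \<and> b < n then \<Sum>k<n. snd s ''B'' k a * snd s ''B'' k b else snd s ''G'' a b))"
  then have t1: "t1 \<le> dot_time n" and s1: "same {''i'', ''j'', ''k''} {''t'', ''G''} s s1"
    and G1: "\<And>a b. a < n \<Longrightarrow> b < n \<Longrightarrow> snd s1 ''G'' a b = (\<Sum>k<n. snd s ''B'' k a * snd s ''B'' k b)" by auto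
  have n1: "fst s1 ''n'' = n" and q1: "snd s1 ''q'' 0 0 = of_int q"
    using same_fst[OF s1, of "''n''"] same_snd[OF s1, of "''q''"] s by auto
  \<comment> \<open>The program multiplies the real matrix \<open>B^T\<close> by \<open>B\<close>,
    but \<open>O1\<close> cancels and the result is the integral matrix \<open>U^T U\<close>. Its
    entries have \<open>N + N\<close> bits from the factors and \<open>N\<close> from the summation;
    one more makes the bound strict.\<close>
  have G1': "snd s1 ''G'' a b = of_int (G $$ (a, b)) \<and> \<bar>G $$ (a, b)\<bar> < 2 ^ (3 * N + 1)" if ab: "a < n" "b < n" for a b
  proof -
    have "rmat G = transpose_mat (rmat U) * rmat U"
      unfolding G_def using U by (simp add: of_int_hom.mat_hom_mult[of _ n n _ n] map_mat_transpose)
    also have "\<dots> = transpose_mat B * B"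
    proof -
      have O1c: "O1 \<in> carrier_mat n n" "transpose_mat O1 \<in> carrier_mat n n" using O1 by (auto simp: orthonormal_mat_def)
      have "transpose_mat B * B = transpose_mat (rmat U) * (transpose_mat O1 * (O1 * rmat U))"
        unfolding U(2) using O1c U(1)
        by (simp add: transpose_mult[of _ n n _ n] assoc_mult_mat[of _ n n _ n _ n])
      then show ?thesis using orthonormal_cancel(1)[OF O1, of "rmat U"] U by simp
    qed
    finally have "real_of_int (G $$ (a, b)) = (transpose_mat B * B) $$ (a, b)"
      using ab G by (metis carrier_matD index_map_mat(1))
    also have "\<dots> = (\<Sum>k<n. B $$ (k, a) * B $$ (k, b))"
      using ab B(1) by (auto simp: scalar_prod_def lessThan_atLeast0 intro!: sum.cong)
    finally have Gs: "real_of_int (G $$ (a, b)) = (\<Sum>k<n. B $$ (k, a) * B $$ (k, b))" .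
    have "\<bar>\<Sum>k<n. B $$ (k, a) * B $$ (k, b)\<bar> \<le> 2 ^ (N + N + N)"
      using B(2) ab n by (intro sum_prod_le_power) auto
    moreover have "N + N + N = 3 * N" by simp
    ultimately have "real_of_int \<bar>G $$ (a, b)\<bar> \<le> of_int (2 ^ (3 * N))" unfolding Gs[symmetric] by simp
    then have "\<bar>G $$ (a, b)\<bar> \<le> 2 ^ (3 * N)" by (simp only: of_int_le_iff)
    also have "(2::int) ^ (3 * N) < 2 ^ (3 * N + 1)" by simp
    finally show ?thesis using G1[OF ab] Gs B(2) ab by simp
  qed
  show "runs zl gi (Seq init_X eliminate) s1 (\<lambda>t. ?Q (t1 + t))"
  proof (rule runs_SeqI[OF runs_init_X[OF n1 q1 G1' q(4)]], assumption, assumption, elim conjE)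
    fix t2 :: nat and s2 assume t2: "t2 \<le> 2 + 2 * n * (2 * n * (17 + 6 * (3 * N + 1)) + 4)"
      and s2: "same {''g'', ''k'', ''l''} {''r'', ''w'', ''m'', ''X''} s1 s2"
      and X2: "\<forall>a<2 * n. \<forall>b<2 * n. snd s2 ''X'' a b = of_int (start_X q n G a b)"
    have sm2: "same ?N ?A s s2" by (rule same_trans[OF s1 s2]) auto
    have n2: "fst s2 ''n'' = n" and q2: "snd s2 ''q'' 0 0 = of_int q"
      using same_fst[OF s2, of "''n''"] same_snd[OF s2, of "''q''"] n1 q1 by auto
    have X2': "snd s2 ''X'' a b = of_int (start_X q n G a b) \<and> 0 \<le> start_X q n G a b \<and> start_X q n G a b < q"
      if "a < 2 * n" "b < 2 * n" for a b
      using X2 that elim_inv_start_X(2)[OF G q(4)] by blast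
    show "runs zl gi eliminate s2 (\<lambda>t. ?Q (t1 + (t2 + t)))"
    proof (rule runs_mono[OF runs_eliminate[OF n2 q2 q X2' elim_inv_start_X(1)[OF G q(4)] G]], assumption, assumption, elim conjE, intro conjI)
      fix t :: nat and s3 assume t: "t \<le> 2 + n * (10 + n * (13 + 2 * N * (30 + 18 * N)) + 2 * n * (2 * n * (24 + 18 * N) + 8))"
        and s3: "same ?N {''r'', ''w'', ''m'', ''c'', ''a'', ''b'', ''u'', ''v'', ''x'', ''d'', ''X'', ''Y''} s2 s3"
        and ex: "\<exists>X Y S. (\<forall>a<2 * n. \<forall>b<2 * n. snd s3 ''X'' a b = of_int (X a b) \<and> 0 \<le> X a b \<and> X a b < q) \<and>
       elim_inv q n G X Y S \<and> (\<forall>a<n. \<forall>b<n. \<not> coprime (X a b) q)"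
      show "same ?N ?A s s3" by (rule same_trans[OF sm2 s3]) auto
      show "\<exists>X Y S. (\<forall>a<2 * n. \<forall>b<2 * n. snd s3 ''X'' a b = of_int (X a b) \<and> 0 \<le> X a b \<and> X a b < q) \<and>
       elim_inv q n (transpose_mat U * U) X Y S \<and> (\<forall>a<n. \<forall>b<n. \<not> coprime (X a b) q)"
        using ex unfolding G_def .
    qed (use t1 t2 in \<open>unfold gram_time_def, linarith\<close>)
  qed
qed

text \<open>The entries of \<open>X\<close> are nonnegative integers, so comparison with 1 is the
  test for zero.\<close>

definition hull_entry :: com where
  "hull_entry = If (BAnd (NEq (NVar ''k'') (NVar ''l'')) (RLess (RCell ''X'' (NPlus (NVar ''n'') (NVar ''k'')) (NVar ''l'')) (RConst 1)))
        (RAssign ''K'' (NVar ''k'') (NVar ''l'') (sc ''q''))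
        (RAssign ''K'' (NVar ''k'') (NVar ''l'') (RCell ''X'' (NPlus (NVar ''n'') (NVar ''k'')) (NVar ''l'')))"

text \<open>The division by \<open>q\<close> is applied to \<open>K\<close> first: its entries then
  lie between 0 and 1, which bounds the query by \<open>2^(2 N)\<close> irrespective of
  \<open>q\<close>.\<close>

definition hull_query :: com where
  "hull_query =
    Seq (For2 ''k'' (NVar ''n'') ''l'' (NVar ''n'') hull_entry)
    (Seq (dotprod ''M'' (RTimes (RCell ''B'' (NVar ''i'') (NVar ''k'')) (RDivide (RCell ''K'' (NVar ''k'') (NVar ''j'')) (sc ''q''))))
      (ZLIP_Call (NVar ''n'') ''M'' ''Q''))"

definition hull_time :: "nat \<Rightarrow> nat \<Rightarrow> nat" where
  "hull_time n N = (2 + n * (n * 4 + 4)) + dot_time n + (1 + n * (n * (2 * N + 2)))"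

lemma runs_hull_query:
  fixes q :: int and X :: "nat \<Rightarrow> nat \<Rightarrow> int" and B :: "real mat"
  assumes s: "fst s ''n'' = n" "snd s ''q'' 0 0 = of_int q"
    and B: "B \<in> carrier_mat n n" "\<And>i j. i < n \<Longrightarrow> j < n \<Longrightarrow> snd s ''B'' i j = B $$ (i, j) \<and> \<bar>B $$ (i, j)\<bar> \<le> 2 ^ N"
    and q: "1 < q" and n: "n \<le> 2 ^ N"
    and X: "\<And>a b. a < 2 * n \<Longrightarrow> b < 2 * n \<Longrightarrow> snd s ''X'' a b = of_int (X a b) \<and> 0 \<le> X a b \<and> X a b < q"
    and M: "M = (1 / real_of_int q) \<cdot>\<^sub>m (B * rmat (hull_basis q n X))"
  shows "runs zl gi hull_query s (\<lambda>t s'.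
    t \<le> hull_time n N \<and>
    same {''i'', ''j'', ''k'', ''l''} {''t'', ''K'', ''M'', ''Q''} s s' \<and>
    (\<forall>a<n. \<forall>b<n. snd s' ''Q'' a b = zl M $$ (a, b)))"
  (is "runs _ _ _ _ ?Q")
  unfolding hull_query_def
proof (rule runs_SeqI)
  let ?N = "{''i'', ''j'', ''k'', ''l''}" and ?A = "{''t'', ''K'', ''M'', ''Q''}"
  define H where "H = hull_basis q n X"
  have H: "H \<in> carrier_mat n n" by (simp add: H_def hull_basis_def)
  have Hq: "0 \<le> H $$ (a, b) \<and> H $$ (a, b) \<le> q" if "a < n" "b < n" for a b
    using X[of "n + a" b] that q by (auto simp: H_def hull_basis_def)
  have "runs zl gi (For2 ''k'' (NVar ''n'') ''l'' (NVar ''n'') hull_entry) s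
    (\<lambda>t s'. t \<le> 2 + n * (n * (2 + 2) + 4) \<and> same {''k'', ''l''} {''K''} s s' \<and>
      (\<forall>a b. snd s' ''K'' a b = (if a < n \<and> b < n then of_int (H $$ (a, b)) else snd s ''K'' a b)))"
  proof (rule runs_For2)
    show "nval (NVar ''n'') s' = n \<and> nval (NVar ''n'') s' = n" if "same {''k'', ''l''} {''K''} s s'" for s'
      using same_fst[OF that, of "''n''"] s by simp
    fix a b s1 assume ab: "a < n" "b < n" and sm: "same {''k'', ''l''} {''K''} s s1" and k: "fst s1 ''k'' = a" and l: "fst s1 ''l'' = b"
    have v: "fst s1 ''n'' = n" "snd s1 ''q'' 0 0 = of_int q" "snd s1 ''X'' (n + a) b = of_int (X (n + a) b)"
      using same_fst[OF sm, of "''n''"] same_snd[OF sm, of "''q''"] same_snd[OF sm, of "''X''"] s X[of "n + a" b] ab by auto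
    have x: "real_of_int (X (n + a) b) < 1 \<longleftrightarrow> X (n + a) b = 0"
      using X[of "n + a" b] ab by (auto simp: zless_imp_add1_zle)
    show "runs zl gi hull_entry s1
      (\<lambda>t s'. t \<le> 2 \<and> same {''k'', ''l''} {''K''} s1 s' \<and> fst s' ''k'' = a \<and> fst s' ''l'' = b \<and>
        (\<forall>a' b'. snd s' ''K'' a' b' = (if a' = a \<and> b' = b then of_int (H $$ (a, b)) else snd s1 ''K'' a' b')))"
      using k l v x ab by (auto simp: hull_entry_def H_def hull_basis_def intro!: same_set_cell)
  qed auto
  then show "runs zl gi (For2 ''k'' (NVar ''n'') ''l'' (NVar ''n'') hull_entry) s
    (\<lambda>t s'. t \<le> 2 + n * (n * 4 + 4) \<and> same {''k'', ''l''} {''K''} s s' \<and>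
      (\<forall>a b. snd s' ''K'' a b = (if a < n \<and> b < n then of_int (H $$ (a, b)) else snd s ''K'' a b)))"
    by (rule runs_mono) (auto simp: mult.commute)
  fix t1 :: nat and s1 assume *: "t1 \<le> 2 + n * (n * 4 + 4) \<and> same {''k'', ''l''} {''K''} s s1 \<and>
      (\<forall>a b. snd s1 ''K'' a b = (if a < n \<and> b < n then of_int (H $$ (a, b)) else snd s ''K'' a b))"
  then have t1: "t1 \<le> 2 + n * (n * 4 + 4)" and s1: "same {''k'', ''l''} {''K''} s s1"
    and K1: "\<And>a b. a < n \<Longrightarrow> b < n \<Longrightarrow> snd s1 ''K'' a b = of_int (H $$ (a, b))" by auto
  have n1: "fst s1 ''n'' = n" and q1: "snd s1 ''q'' 0 0 = of_int q" and B1: "snd s1 ''B'' = snd s ''B''"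
    using same_fst[OF s1, of "''n''"] same_snd[OF s1, of "''q''"] same_snd[OF s1, of "''B''"] s by auto
  have dot: "runs zl gi (dotprod ''M'' (RTimes (RCell ''B'' (NVar ''i'') (NVar ''k'')) (RDivide (RCell ''K'' (NVar ''k'') (NVar ''j'')) (sc ''q'')))) s1
    (\<lambda>t s'. t \<le> dot_time n \<and> same {''i'', ''j'', ''k''} {''t'', ''M''} s1 s' \<and>
      (\<forall>a b. snd s' ''M'' a b = (if a < n \<and> b < n then \<Sum>k<n. snd s ''B'' a k * (snd s1 ''K'' k b / of_int q) else snd s1 ''M'' a b)))"
    by (rule runs_dotprod[OF n1]) (auto simp: same_snd B1 q1)
  show "runs zl gi (Seq (dotprod ''M'' (RTimes (RCell ''B'' (NVar ''i'') (NVar ''k'')) (RDivide (RCell ''K'' (NVar ''k'') (NVar ''j'')) (sc ''q''))))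
      (ZLIP_Call (NVar ''n'') ''M'' ''Q'')) s1 (\<lambda>t. ?Q (t1 + t))"
  proof (rule runs_SeqI[OF dot], elim conjE)
    fix t2 :: nat and s2 assume t2: "t2 \<le> dot_time n" and s2: "same {''i'', ''j'', ''k''} {''t'', ''M''} s1 s2"
      and M2: "\<forall>a b. snd s2 ''M'' a b = (if a < n \<and> b < n then \<Sum>k<n. snd s ''B'' a k * (snd s1 ''K'' k b / of_int q) else snd s1 ''M'' a b)"
    have n2: "fst s2 ''n'' = n" using same_fst[OF s2, of "''n''"] n1 by simp
    have Ms: "M $$ (a, b) = (\<Sum>k<n. B $$ (a, k) * (of_int (H $$ (k, b)) / of_int q))" if "a < n" "b < n" for a b
      unfolding M H_def[symmetric] using that B(1) H
      by (auto simp: scalar_prod_def lessThan_atLeast0 sum_divide_distrib intro!: sum.cong)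
    have Mc: "M \<in> carrier_mat n n" unfolding M H_def[symmetric] using B(1) H by simp
    have get: "get_mat n ''M'' s2 = M"
      using Mc M2 K1 Ms B(2) by (intro eq_matI) (auto simp: get_mat_def intro!: sum.cong)
    have "mat_size M \<le> n * (n * (2 * N + 2))"
    proof (rule mat_size_le[OF Mc])
      fix a b assume ab: "a < n" "b < n"
      have "\<bar>of_int (H $$ (k, b)) / real_of_int q\<bar> \<le> 2 ^ 0" if "k < n" for k
        using Hq[OF that ab(2)] q by simp
      then have "\<bar>M $$ (a, b)\<bar> \<le> 2 ^ (N + 0 + N)"
        unfolding Ms[OF ab] using B(2) ab n by (intro sum_prod_le_power) auto
      then show "\<bar>M $$ (a, b)\<bar> \<le> 2 ^ (2 * N)" by (simp add: mult_2)
    qed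
    moreover have "same ?N ?A s (set_mat n ''Q'' (zl M) s2)"
    proof -
      have "same ?N ?A s s2" by (rule same_trans[OF s1 s2]) auto
      then show ?thesis by (auto simp: same_def set_mat_def)
    qed
    ultimately show "runs zl gi (ZLIP_Call (NVar ''n'') ''M'' ''Q'') s2 (\<lambda>t. ?Q (t1 + (t2 + t)))"
      using t1 t2 n2 get by (simp add: hull_time_def)
  qed
qed

text \<open>
  The last block of \<open>X\<close> holds \<open>- Y\<close>, so the array \<open>P\<close> holds the negated projector.
\<close>

definition projector_graph :: com where
  "projector_graph =
    Seq (dotprod ''U'' (RTimes (RCell ''Q'' (NVar ''k'') (NVar ''i'')) (RCell ''B'' (NVar ''k'') (NVar ''j''))))
    (Seq (dotprod ''V'' (RTimes (RCell ''U'' (NVar ''i'') (NVar ''k''))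
        (RCell ''X'' (NPlus (NVar ''n'') (NVar ''k'')) (NPlus (NVar ''n'') (NVar ''j'')))))
    (Seq (dotprod ''P'' (RTimes (RCell ''V'' (NVar ''i'') (NVar ''k'')) (RCell ''U'' (NVar ''j'') (NVar ''k''))))
      graph_array))"

definition graph_time :: "nat \<Rightarrow> nat \<Rightarrow> nat" where
  "graph_time n N = 3 * dot_time n + (2 + 2 * n * (2 * n * (22 + 6 * (7 * N + 1)) + 4))"

lemma runs_projector_graph:
  fixes q :: int and X :: "nat \<Rightarrow> nat \<Rightarrow> int" and U :: "int mat"
  assumes s: "fst s ''n'' = n" "snd s ''q'' 0 0 = of_int q"
    and B: "\<And>i j. i < n \<Longrightarrow> j < n \<Longrightarrow> snd s ''B'' i j = B $$ (i, j) \<and> \<bar>B $$ (i, j)\<bar> \<le> 2 ^ N"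
    and Q: "orthonormal_mat n Q" "\<And>i j. i < n \<Longrightarrow> j < n \<Longrightarrow> snd s ''Q'' i j = Q $$ (i, j)"
    and q: "1 < q" "q < 2 ^ N" and n: "n \<le> 2 ^ N"
    and X: "\<And>a b. a < 2 * n \<Longrightarrow> b < 2 * n \<Longrightarrow> snd s ''X'' a b = of_int (X a b) \<and> 0 \<le> X a b \<and> X a b < q"
    and U: "U \<in> carrier_mat n n" "B = Q * rmat U"
    and Z: "Z = mat n n (\<lambda>(a, b). - X (n + a) (n + b))"
  shows "runs zl gi projector_graph s (\<lambda>t s'.
    t \<le> graph_time n N \<and>
    same {''g'', ''i'', ''j'', ''k'', ''l''} {''t'', ''U'', ''V'', ''P'', ''r'', ''w'', ''m'', ''A''} s s' \<and>
    (\<forall>a<2 * n. \<forall>b<2 * n. snd s' ''A'' a b = of_int (graph_weight q n (U * Z * transpose_mat U) a b)))"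
  (is "runs _ _ _ _ ?Q")
  unfolding projector_graph_def
proof (rule runs_SeqI)
  let ?N = "{''g'', ''i'', ''j'', ''k'', ''l''}" and ?A = "{''t'', ''U'', ''V'', ''P'', ''r'', ''w'', ''m'', ''A''}"
  let ?T = "dot_time n"
  have Qc: "Q \<in> carrier_mat n n" using Q by (simp add: orthonormal_mat_def)
  have Bc: "B \<in> carrier_mat n n" using U Qc by simp
  have Zc: "Z \<in> carrier_mat n n" by (simp add: Z)
  show "runs zl gi (dotprod ''U'' (RTimes (RCell ''Q'' (NVar ''k'') (NVar ''i'')) (RCell ''B'' (NVar ''k'') (NVar ''j'')))) s
    (\<lambda>t s'. t \<le> ?T \<and> same {''i'', ''j'', ''k''} {''t'', ''U''} s s' \<and>
      (\<forall>a b. snd s' ''U'' a b = (if a < n \<and> b < n then \<Sum>k<n. snd s ''Q'' k a * snd s ''B'' k b else snd s ''U'' a b)))"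
    by (rule runs_dotprod[OF s(1)]) (auto simp: same_snd)
  fix t1 :: nat and s1 assume "t1 \<le> ?T \<and> same {''i'', ''j'', ''k''} {''t'', ''U''} s s1 \<and>
      (\<forall>a b. snd s1 ''U'' a b = (if a < n \<and> b < n then \<Sum>k<n. snd s ''Q'' k a * snd s ''B'' k b else snd s ''U'' a b))"
  then have t1: "t1 \<le> ?T" and s1: "same {''i'', ''j'', ''k''} {''t'', ''U''} s s1"
    and U1: "\<And>a b. a < n \<Longrightarrow> b < n \<Longrightarrow> snd s1 ''U'' a b = (\<Sum>k<n. snd s ''Q'' k a * snd s ''B'' k b)" by auto
  have "rmat U = transpose_mat Q * B" unfolding U(2) using orthonormal_cancel(1)[OF Q(1), of "rmat U"] U(1) by simp
  then have "real_of_int (U $$ (a, b)) = (\<Sum>k<n. Q $$ (k, a) * B $$ (k, b))" if "a < n" "b < n" for a b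
  proof -
    assume e: "rmat U = transpose_mat Q * B"
    have "real_of_int (U $$ (a, b)) = (rmat U) $$ (a, b)" using that U by simp
    also have "\<dots> = (\<Sum>k<n. Q $$ (k, a) * B $$ (k, b))"
      unfolding e using that Qc Bc by (auto simp: scalar_prod_def lessThan_atLeast0 intro!: sum.cong)
    finally show ?thesis .
  qed
  then have Us: "real_of_int (U $$ (a, b)) = (\<Sum>k<n. Q $$ (k, a) * B $$ (k, b))" if "a < n" "b < n" for a b
    using that by blast
  have Ub: "\<bar>U $$ (a, b)\<bar> \<le> 2 ^ (2 * N)" if ab: "a < n" "b < n" for a b
  proof -
    have "\<bar>\<Sum>k<n. Q $$ (k, a) * B $$ (k, b)\<bar> \<le> 2 ^ (0 + N + N)"
      using B ab n orthonormal_entry_le[OF Q(1)] by (intro sum_prod_le_power) auto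
    then have "real_of_int \<bar>U $$ (a, b)\<bar> \<le> of_int (2 ^ (2 * N))" unfolding Us[OF ab, symmetric] by (simp add: mult_2)
    then show ?thesis by (simp only: of_int_le_iff)
  qed
  have U1': "snd s1 ''U'' a b = of_int (U $$ (a, b))" if "a < n" "b < n" for a b
    using U1[OF that] Us[OF that] B Q(2) that by simp
  have n1: "fst s1 ''n'' = n" and q1: "snd s1 ''q'' 0 0 = of_int q" and X1: "snd s1 ''X'' = snd s ''X''"
    using same_fst[OF s1, of "''n''"] same_snd[OF s1, of "''q''"] same_snd[OF s1, of "''X''"] s by auto
  \<comment> \<open>\<open>W\<close> is the negative of \<open>U Z\<close>. Bounds on bit lengths:
    \<open>2 N\<close> for \<open>U\<close>, then \<open>2 N + N + N\<close> for \<open>W\<close>,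
    and \<open>4 N + 2 N + N = 7 N\<close> for the projector; the third \<open>N\<close> in each sum
    comes from the number of summands.\<close>
  define W where "W a b = (\<Sum>k<n. U $$ (a, k) * X (n + k) (n + b))" for a b
  have Wb: "\<bar>W a b\<bar> \<le> 2 ^ (4 * N)" if "a < n" "b < n" for a b
  proof -
    have "\<bar>X (n + k) (n + b)\<bar> \<le> 2 ^ N" if "k < n" for k
      using X[of "n + k" "n + b"] that \<open>b < n\<close> q by simp
    then have "\<bar>W a b\<bar> \<le> 2 ^ (2 * N + N + N)"
      unfolding W_def using Ub that n by (intro sum_prod_le_power) auto
    then show ?thesis by simp
  qed
  have dotV: "runs zl gi (dotprod ''V'' (RTimes (RCell ''U'' (NVar ''i'') (NVar ''k''))
        (RCell ''X'' (NPlus (NVar ''n'') (NVar ''k'')) (NPlus (NVar ''n'') (NVar ''j''))))) s1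
    (\<lambda>t s'. t \<le> ?T \<and> same {''i'', ''j'', ''k''} {''t'', ''V''} s1 s' \<and>
      (\<forall>a b. snd s' ''V'' a b = (if a < n \<and> b < n then \<Sum>k<n. snd s1 ''U'' a k * snd s1 ''X'' (n + k) (n + b) else snd s1 ''V'' a b)))"
    by (rule runs_dotprod[OF n1]) (auto simp: same_snd same_fst n1)
  show "runs zl gi (Seq (dotprod ''V'' (RTimes (RCell ''U'' (NVar ''i'') (NVar ''k''))
        (RCell ''X'' (NPlus (NVar ''n'') (NVar ''k'')) (NPlus (NVar ''n'') (NVar ''j'')))))
    (Seq (dotprod ''P'' (RTimes (RCell ''V'' (NVar ''i'') (NVar ''k'')) (RCell ''U'' (NVar ''j'') (NVar ''k''))))
      graph_array)) s1 (\<lambda>t. ?Q (t1 + t))"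
  proof (rule runs_SeqI[OF dotV], elim conjE)
    fix t2 :: nat and s2 assume t2: "t2 \<le> ?T" and s2: "same {''i'', ''j'', ''k''} {''t'', ''V''} s1 s2"
      and V2: "\<forall>a b. snd s2 ''V'' a b = (if a < n \<and> b < n then \<Sum>k<n. snd s1 ''U'' a k * snd s1 ''X'' (n + k) (n + b) else snd s1 ''V'' a b)"
    have V2': "snd s2 ''V'' a b = of_int (W a b)" if "a < n" "b < n" for a b
      using V2 U1' X that by (simp add: W_def X1)
    have n2: "fst s2 ''n'' = n" and q2: "snd s2 ''q'' 0 0 = of_int q" and U2: "snd s2 ''U'' = snd s1 ''U''"
      using same_fst[OF s2, of "''n''"] same_snd[OF s2, of "''q''"] same_snd[OF s2, of "''U''"] n1 q1 by auto
    have dotP: "runs zl gi (dotprod ''P'' (RTimes (RCell ''V'' (NVar ''i'') (NVar ''k'')) (RCell ''U'' (NVar ''j'') (NVar ''k'')))) s2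
      (\<lambda>t s'. t \<le> ?T \<and> same {''i'', ''j'', ''k''} {''t'', ''P''} s2 s' \<and>
        (\<forall>a b. snd s' ''P'' a b = (if a < n \<and> b < n then \<Sum>k<n. snd s2 ''V'' a k * snd s2 ''U'' b k else snd s2 ''P'' a b)))"
      by (rule runs_dotprod[OF n2]) (auto simp: same_snd)
    show "runs zl gi (Seq (dotprod ''P'' (RTimes (RCell ''V'' (NVar ''i'') (NVar ''k'')) (RCell ''U'' (NVar ''j'') (NVar ''k''))))
      graph_array) s2 (\<lambda>t. ?Q (t1 + (t2 + t)))"
    proof (rule runs_SeqI[OF dotP], elim conjE)
      fix t3 :: nat and s3 assume t3: "t3 \<le> ?T" and s3: "same {''i'', ''j'', ''k''} {''t'', ''P''} s2 s3"
        and P3: "\<forall>a b. snd s3 ''P'' a b = (if a < n \<and> b < n then \<Sum>k<n. snd s2 ''V'' a k * snd s2 ''U'' b k else snd s2 ''P'' a b)"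
      have n3: "fst s3 ''n'' = n" and q3: "snd s3 ''q'' 0 0 = of_int q"
        using same_fst[OF s3, of "''n''"] same_snd[OF s3, of "''q''"] n2 q2 by auto
      have sm3: "same ?N ?A s s3"
        by (rule same_trans[OF same_trans[OF s1 s2 subset_refl subset_refl] s3]) auto
      define P where "P = U * Z * transpose_mat U"
      have Ps: "P $$ (a, b) = - (\<Sum>k<n. W a k * U $$ (b, k))" if "a < n" "b < n" for a b
      proof -
        define R where "R = U * Z"
        have R: "R \<in> carrier_mat n n" using U(1) Zc by (simp add: R_def)
        have "R $$ (a, k) = - W a k" if "k < n" for k
          using \<open>a < n\<close> that U(1) Zc by (auto simp: R_def W_def Z scalar_prod_def lessThan_atLeast0 sum_negf[symmetric] intro!: sum.cong)
        then have "P $$ (a, b) = (\<Sum>k<n. - W a k * U $$ (b, k))"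
          unfolding P_def R_def[symmetric] using that U(1) R
          by (auto simp: scalar_prod_def lessThan_atLeast0 intro!: sum.cong)
        then show ?thesis by (simp add: sum_negf)
      qed
      have "snd s3 ''P'' a b = - of_int (P $$ (a, b)) \<and> \<bar>P $$ (a, b)\<bar> < 2 ^ (7 * N + 1)" if ab: "a < n" "b < n" for a b
      proof -
        have "\<bar>\<Sum>k<n. W a k * U $$ (b, k)\<bar> \<le> 2 ^ (4 * N + 2 * N + N)"
          using Wb Ub ab n by (intro sum_prod_le_power) auto
        also have "(2::int) ^ (4 * N + 2 * N + N) < 2 ^ (7 * N + 1)" by (simp add: algebra_simps)
        finally show ?thesis using P3 V2' U1' ab by (simp add: Ps U2)
      qed
      from runs_graph_array[OF n3 q3 this q(1)]
      have ga: "runs zl gi graph_array s3 (\<lambda>t s'. t \<le> 2 + 2 * n * (2 * n * (22 + 6 * (7 * N + 1)) + 4) \<and>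
        same ?N {''r'', ''w'', ''m'', ''A''} s3 s' \<and>
        (\<forall>a<2 * n. \<forall>b<2 * n. snd s' ''A'' a b = of_int (graph_weight q n P a b)))" by blast
      show "runs zl gi graph_array s3 (\<lambda>t. ?Q (t1 + (t2 + (t3 + t))))"
      proof (rule runs_mono[OF ga], elim conjE, intro conjI)
        fix t :: nat and s4 assume t: "t \<le> 2 + 2 * n * (2 * n * (22 + 6 * (7 * N + 1)) + 4)" and s4: "same ?N {''r'', ''w'', ''m'', ''A''} s3 s4"
          and A4: "\<forall>a<2 * n. \<forall>b<2 * n. snd s4 ''A'' a b = of_int (graph_weight q n P a b)"
        show "t1 + (t2 + (t3 + t)) \<le> graph_time n N"
          using t1 t2 t3 t unfolding graph_time_def by linarith
        show "same ?N ?A s s4" by (rule same_trans[OF sm3 s4]) auto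
        show "\<forall>a<2 * n. \<forall>b<2 * n. snd s4 ''A'' a b = of_int (graph_weight q n (U * Z * transpose_mat U) a b)"
          using A4 unfolding P_def .
      qed
    qed
  qed
qed

section \<open>Correctness of the reduction\<close>

definition core :: com where
  "core = Seq gram_eliminate (Seq hull_query projector_graph)"

definition core_time :: "nat \<Rightarrow> nat \<Rightarrow> nat" where
  "core_time n N = gram_time n N + (hull_time n N + graph_time n N)"

definition full_lattice :: "int \<Rightarrow> nat \<Rightarrow> int mat \<Rightarrow> bool" where
  "full_lattice q n U \<longleftrightarrow> (\<forall>x\<in>carrier_vec n. \<exists>z\<in>carrier_vec n. U *\<^sub>v z = q \<cdot>\<^sub>v x)"

abbreviation core_arrays :: "vname set" where
  "core_arrays \<equiv> {''r'', ''w'', ''m'', ''c'', ''a'', ''b'', ''u'', ''v'', ''x'', ''d'', ''X'', ''Y'', ''t'', ''G'',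
     ''K'', ''M'', ''Q'', ''U'', ''V'', ''P'', ''A''}"

abbreviation core_vars :: "vname set" where
  "core_vars \<equiv> {''g'', ''f'', ''j'', ''p'', ''i'', ''k'', ''l''}"

text \<open>\<open>O1\<close> and \<open>V\<close> are not known to the program; they only witness
  that \<open>B\<close> is a rotated generating matrix of the code lattice. The oracle's answer
  \<open>Q\<close> differs from \<open>O1\<close> by an integral orthogonal \<open>T\<close>, so the
  graph computed is that of the code moved by \<open>T\<close>.\<close>

lemma runs_core:
  fixes q p :: int and V :: "int mat" and B :: "real mat"
  assumes zl: "ZLIP_oracle zl"
    and s: "fst s ''n'' = n" "snd s ''q'' 0 0 = of_int q"
    and B: "B \<in> carrier_mat n n" "\<And>i j. i < n \<Longrightarrow> j < n \<Longrightarrow> snd s ''B'' i j = B $$ (i, j) \<and> \<bar>B $$ (i, j)\<bar> \<le> 2 ^ N"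
    and q: "q = p ^ e" "prime p" "0 < e" "1 < q" "q < 2 ^ N" and n: "n \<le> 2 ^ N"
    and O1: "orthonormal_mat n O1" and V: "trivial_hull q n V" "full_lattice q n V" "B = O1 * rmat V"
  shows "runs zl gi core s (\<lambda>t s'. t \<le> core_time n N \<and> same core_vars core_arrays s s' \<and>
    (\<exists>T P Q. T \<in> carrier_mat n n \<and> transpose_mat T * T = 1\<^sub>m n \<and> orthonormal_mat n Q \<and>
      (\<forall>i<n. \<forall>j<n. snd s' ''Q'' i j = Q $$ (i, j)) \<and> B = Q * rmat (T * V) \<and> code_projector q n (T * V) P \<and>
      (\<forall>a<2 * n. \<forall>b<2 * n. snd s' ''A'' a b = of_int (graph_weight q n P a b))))"
  (is "runs _ _ _ _ ?Q")
proof -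
  have Vc: "V \<in> carrier_mat n n" using V by (simp add: trivial_hull_def)
  have O1c: "O1 \<in> carrier_mat n n" using O1 by (simp add: orthonormal_mat_def)
  define G where "G = transpose_mat V * V"
  have G: "G \<in> carrier_mat n n" using Vc by (simp add: G_def)
  show ?thesis
    unfolding core_def
  proof (rule runs_SeqI[OF runs_gram_eliminate[OF s B q n O1 Vc V(3)]], assumption, assumption, elim conjE exE)
    fix t1 :: nat and s1 X Y S
    assume t1: "t1 \<le> gram_time n N"
      and s1: "same core_vars {''r'', ''w'', ''m'', ''c'', ''a'', ''b'', ''u'', ''v'', ''x'', ''d'', ''X'', ''Y'', ''t'', ''G''} s s1"
      and X1: "\<forall>a<2 * n. \<forall>b<2 * n. snd s1 ''X'' a b = of_int (X a b) \<and> 0 \<le> X a b \<and> X a b < q"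
      and inv: "elim_inv q n (transpose_mat V * V) X Y S" and nu: "\<forall>a<n. \<forall>b<n. \<not> coprime (X a b) q"
    have D: "mdvd q (G - G * Y * G)"
      unfolding G_def using elim_inv_final[OF inv V(1) q(1-3)] nu by blast
    have inv': "elim_inv q n G X Y S" using inv by (simp add: G_def)
    have Y: "Y \<in> carrier_mat n n" using inv by (simp add: elim_inv_def)
    define M where "M = (1 / real_of_int q) \<cdot>\<^sub>m (B * rmat (hull_basis q n X))"
    have Xl: "0 \<le> X (n + a) b \<and> X (n + a) b < q" if "a < n" "b < n" for a b using X1 that by simp
    note hb = hull_basis[OF inv' G q(4) D Xl]
    have "lattice_basis n M (mat_image O1 (Zn n))"
      unfolding M_def
    proof (rule hull_query_valid[OF q(4) V(1) O1 V(3)])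
      show "hull_basis q n X \<in> carrier_mat n n" by (simp add: hull_basis_def)
      show "mdvd q (transpose_mat V * V * hull_basis q n X)" using hb(1) unfolding G_def by blast
    qed (use hb(2) V(2) in \<open>auto simp: G_def full_lattice_def\<close>)
    moreover have "lattice_iso_by n O1 (mat_image O1 (Zn n)) (Zn n)" using O1 by (simp add: lattice_iso_by_def)
    ultimately have Qiso: "lattice_iso_by n (zl M) (mat_image O1 (Zn n)) (Zn n)"
      using zl unfolding ZLIP_oracle_def by blast
    define Q where "Q = zl M"
    have Q: "orthonormal_mat n Q" using Qiso by (simp add: lattice_iso_by_def Q_def)
    have Qc: "Q \<in> carrier_mat n n" using Q by (simp add: orthonormal_mat_def)
    obtain T where T: "T \<in> carrier_mat n n" "transpose_mat T * T = 1\<^sub>m n" "O1 = Q * rmat T"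
      using orthonormal_int_factor[OF O1 Qiso[folded Q_def]] by blast
    have BT: "B = Q * rmat (T * V)"
      unfolding V(3) T(3) using Qc T(1) Vc
      by (simp add: of_int_hom.mat_hom_mult[of _ n n _ n] assoc_mult_mat[of _ n n _ n _ n])
    have TV: "T * V \<in> carrier_mat n n" using T Vc by simp
    \<comment> \<open>The ghost \<open>Y\<close> is known to the program only modulo
      \<open>q\<close>. The matrix actually stored is \<open>Z\<close>, and the relation between
      \<open>G\<close> and \<open>Y\<close> has to be transferred to it before the projector can be
      formed.\<close>
    define Z where "Z = mat n n (\<lambda>(a, b). - X (n + a) (n + b))"
    have Z: "Z \<in> carrier_mat n n" by (simp add: Z_def)
    have ZY: "mdvd q (Z - Y)"
      unfolding mdvd_def
    proof (intro allI impI)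
      fix a b assume "a < dim_row (Z - Y)" "b < dim_col (Z - Y)"
      then have ab: "a < n" "b < n" using Y by auto
      have "[X (n + a) (n + b) = - Y $$ (a, b)] (mod q)" using inv ab by (simp add: elim_inv_def)
      then have "q dvd X (n + a) (n + b) + Y $$ (a, b)" by (simp add: cong_iff_dvd_diff)
      then have "q dvd - (X (n + a) (n + b) + Y $$ (a, b))" by (simp only: dvd_minus_iff)
      then show "q dvd (Z - Y) $$ (a, b)" using ab Y by (simp add: Z_def)
    qed
    have "G - G * Z * G = (G - G * Y * G) - G * (Z - Y) * G"
      using G Z Y by (simp add: sq_mat_simps[where n = n]) (intro eq_matI, auto simp del: index_mult_mat(1))
    moreover have "mdvd q (G * (Z - Y) * G)"
      using mdvd_mult_right[OF mdvd_mult_left[OF ZY, of G], of G] G Z Y by simp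
    ultimately have DZ: "mdvd q (G - G * Z * G)"
      using mdvd_minus[OF D, of "G * (Z - Y) * G"] G by simp
    have proj: "code_projector q n (T * V) (T * V * Z * transpose_mat (T * V))"
      by (rule code_projectorI[OF trivial_hull_orthogonal[OF T(1,2) V(1)] Z])
        (use DZ in \<open>simp add: gram_orthogonal[OF T(1,2) Vc] G_def\<close>)
    have n1: "fst s1 ''n'' = n" and q1: "snd s1 ''q'' 0 0 = of_int q"
      using same_fst[OF s1, of "''n''"] same_snd[OF s1, of "''q''"] s by auto
    have B1: "snd s1 ''B'' i j = B $$ (i, j) \<and> \<bar>B $$ (i, j)\<bar> \<le> 2 ^ N" if "i < n" "j < n" for i j
      using same_snd[OF s1, of "''B''"] B(2) that by simp
    have X1': "snd s1 ''X'' a b = of_int (X a b) \<and> 0 \<le> X a b \<and> X a b < q" if "a < 2 * n" "b < 2 * n" for a b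
      using X1 that by blast
    show "runs zl gi (Seq hull_query projector_graph) s1 (\<lambda>t. ?Q (t1 + t))"
    proof (rule runs_SeqI[OF runs_hull_query[OF n1 q1 B(1) B1 q(4) n X1' M_def]], assumption, assumption, assumption, assumption, elim conjE)
      fix t2 :: nat and s2
      assume t2: "t2 \<le> hull_time n N"
        and s2: "same {''i'', ''j'', ''k'', ''l''} {''t'', ''K'', ''M'', ''Q''} s1 s2"
        and Q2: "\<forall>a<n. \<forall>b<n. snd s2 ''Q'' a b = zl M $$ (a, b)"
      have n2: "fst s2 ''n'' = n" and q2: "snd s2 ''q'' 0 0 = of_int q"
        using same_fst[OF s2, of "''n''"] same_snd[OF s2, of "''q''"] n1 q1 by auto
      have B2: "snd s2 ''B'' i j = B $$ (i, j) \<and> \<bar>B $$ (i, j)\<bar> \<le> 2 ^ N" if "i < n" "j < n" for i j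
        using same_snd[OF s2, of "''B''"] B1 that by simp
      have X2: "snd s2 ''X'' a b = of_int (X a b) \<and> 0 \<le> X a b \<and> X a b < q" if "a < 2 * n" "b < 2 * n" for a b
        using same_snd[OF s2, of "''X''"] X1' that by simp
      have Q2': "snd s2 ''Q'' a b = Q $$ (a, b)" if "a < n" "b < n" for a b using Q2 that by (simp add: Q_def)
      have sm2: "same core_vars core_arrays s s2" by (rule same_trans[OF s1 s2]) auto
      show "runs zl gi projector_graph s2 (\<lambda>t. ?Q (t1 + (t2 + t)))"
      proof (rule runs_mono[OF runs_projector_graph[OF n2 q2 B2 Q Q2' q(4,5) n X2 TV BT Z_def]], assumption, assumption, assumption, assumption, assumption, assumption, elim conjE, intro conjI)
        fix t3 :: nat and s3
        assume t3: "t3 \<le> graph_time n N"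
          and s3: "same {''g'', ''i'', ''j'', ''k'', ''l''} {''t'', ''U'', ''V'', ''P'', ''r'', ''w'', ''m'', ''A''} s2 s3"
          and A3: "\<forall>a<2 * n. \<forall>b<2 * n. snd s3 ''A'' a b = of_int (graph_weight q n (T * V * Z * transpose_mat (T * V)) a b)"
        show "t1 + (t2 + t3) \<le> core_time n N" unfolding core_time_def by (intro add_mono t1 t2 t3)
        show "same core_vars core_arrays s s3" by (rule same_trans[OF sm2 s3]) auto
        have "\<forall>i<n. \<forall>j<n. snd s3 ''Q'' i j = Q $$ (i, j)" using same_snd[OF s3, of "''Q''"] Q2' by simp
        then show "\<exists>T P Q. T \<in> carrier_mat n n \<and> transpose_mat T * T = 1\<^sub>m n \<and> orthonormal_mat n Q \<and>
      (\<forall>i<n. \<forall>j<n. snd s3 ''Q'' i j = Q $$ (i, j)) \<and> B = Q * rmat (T * V) \<and> code_projector q n (T * V) P \<and>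
      (\<forall>a<2 * n. \<forall>b<2 * n. snd s3 ''A'' a b = of_int (graph_weight q n P a b))"
          using T(1,2) Q BT proj A3 by (intro exI[of _ T] exI[of _ "T * V * Z * transpose_mat (T * V)"] exI[of _ Q] conjI)
      qed
    qed
  qed
qed

section \<open>Valid graph instances and their answers\<close>

lemma graph_weight_sym:
  assumes "\<And>i j. i < n \<Longrightarrow> j < n \<Longrightarrow> [P $$ (i, j) = P $$ (j, i)] (mod q)" "a < 2 * n" "b < 2 * n"
  shows "graph_weight q n P a b = graph_weight q n P b a"
proof (cases "vertex_index n a = vertex_index n b")
  case True
  then show ?thesis by (simp add: graph_weight_def)
next
  case False
  have "[vertex_sign n a * vertex_sign n b * P $$ (vertex_index n a, vertex_index n b) = vertex_sign n a * vertex_sign n b * P $$ (vertex_index n b, vertex_index n a)] (mod q)"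
    by (intro cong_mult cong_refl assms(1) vertex_index_less assms(2,3))
  then show ?thesis using False by (simp add: graph_weight_def cong_def mult.commute)
qed

definition all_pairs :: "nat \<Rightarrow> nat set set" where
  "all_pairs N = {e. e \<subseteq> {..<N} \<and> card e = 2}"

text \<open>The graph is complete, so all information sits in the weights. An edge is a set, hence
  its weight is expressed by \<open>Min\<close> and \<open>Max\<close>; this is consistent because
  the projector is symmetric modulo \<open>q\<close> and the weights are residues.\<close>

lemma graph_weight_adjacency:
  assumes P: "code_projector q n U P"
  shows "mat (2 * n) (2 * n) (\<lambda>(a, b). of_int (graph_weight q n P a b)) =
    adjacency_mat (2 * n) (all_pairs (2 * n)) (\<lambda>e. of_int (graph_weight q n P (Min e) (Max e)))"
proof (rule eq_matI)
  have sym: "[P $$ (i, j) = P $$ (j, i)] (mod q)" if "i < n" "j < n" for i j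
    using P that by (auto simp: code_projector_def mdvd_def cong_iff_dvd_diff)
  fix a b assume "a < dim_row (adjacency_mat (2 * n) (all_pairs (2 * n)) (\<lambda>e. of_int (graph_weight q n P (Min e) (Max e))))"
    "b < dim_col (adjacency_mat (2 * n) (all_pairs (2 * n)) (\<lambda>e. of_int (graph_weight q n P (Min e) (Max e))))"
  then have ab: "a < 2 * n" "b < 2 * n" by (auto simp: adjacency_mat_def)
  have "graph_weight q n P a b = (if {a, b} \<in> all_pairs (2 * n) then graph_weight q n P (Min {a, b}) (Max {a, b}) else 0)"
  proof (cases "a = b")
    case True
    then show ?thesis by (simp add: all_pairs_def graph_weight_def)
  next
    case False
    then show ?thesis
      using ab graph_weight_sym[OF sym ab] by (cases "a < b") (auto simp: all_pairs_def min_def max_def)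
  qed
  then show "mat (2 * n) (2 * n) (\<lambda>(a, b). of_int (graph_weight q n P a b)) $$ (a, b) =
    adjacency_mat (2 * n) (all_pairs (2 * n)) (\<lambda>e. of_int (graph_weight q n P (Min e) (Max e))) $$ (a, b)"
    using ab by (simp add: adjacency_mat_def)
qed (auto simp: adjacency_mat_def)

lemma permutation_conj_entries:
  fixes A :: "real mat"
  assumes \<pi>: "\<pi> permutes {..<N}" and A: "A \<in> carrier_mat N N"
    and R: "R = mat N N (\<lambda>(i, j). if i = \<pi> j then 1 else 0)" and ab: "a < N" "b < N"
  shows "(transpose_mat R * A * R) $$ (a, b) = A $$ (\<pi> a, \<pi> b)"
proof -
  have "\<pi> j < N" if "j < N" for j using permutes_in_image[OF \<pi>, of j] that by simp
  from signed_selection_entries(1)[of N \<pi> A R "\<lambda>_. 1" a b, OF this A _ ab] R show ?thesis by simp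
qed

text \<open>The isomorphism in \<open>iso\<close> only rules out the answer \<open>None\<close>. The
  permutation that is returned may be a different one, so nothing but its compatibility with the
  weights is passed on.\<close>

lemma GI_answer:
  assumes gi: "GI_oracle (2 * n) gi" and P: "code_projector q n U1 P1" "code_projector q n U2 P2"
    and A: "A1 = mat (2 * n) (2 * n) (\<lambda>(a, b). of_int (graph_weight q n P1 a b))"
      "A2 = mat (2 * n) (2 * n) (\<lambda>(a, b). of_int (graph_weight q n P2 a b))"
    and iso: "\<exists>\<pi>. \<pi> permutes {..<2 * n} \<and> (\<forall>a<2 * n. \<forall>b<2 * n. graph_weight q n P1 a b = graph_weight q n P2 (\<pi> a) (\<pi> b))"
  obtains \<pi> where "\<pi> permutes {..<2 * n}"
    "gi A1 A2 = Some (mat (2 * n) (2 * n) (\<lambda>(i, j). if i = \<pi> j then 1 else 0))"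
    "\<And>a b. a < 2 * n \<Longrightarrow> b < 2 * n \<Longrightarrow> graph_weight q n P1 a b = graph_weight q n P2 (\<pi> a) (\<pi> b)"
proof -
  have Ac: "A1 \<in> carrier_mat (2 * n) (2 * n)" "A2 \<in> carrier_mat (2 * n) (2 * n)" by (auto simp: A)
  have wg: "weighted_graph (2 * n) (all_pairs (2 * n))" by (simp add: weighted_graph_def all_pairs_def)
  have ans: "case gi A1 A2 of None \<Rightarrow> \<not> (\<exists>P. graph_iso_by (2 * n) P A1 A2) | Some P \<Rightarrow> graph_iso_by (2 * n) P A1 A2"
    using gi wg unfolding GI_oracle_def Let_def A(1)[unfolded graph_weight_adjacency[OF P(1)]]
      A(2)[unfolded graph_weight_adjacency[OF P(2)]] by blast
  obtain \<pi> where \<pi>: "\<pi> permutes {..<2 * n}" "\<forall>a<2 * n. \<forall>b<2 * n. graph_weight q n P1 a b = graph_weight q n P2 (\<pi> a) (\<pi> b)"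
    using iso by blast
  define R :: "real mat" where "R = mat (2 * n) (2 * n) (\<lambda>(i, j). if i = \<pi> j then 1 else 0)"
  have p: "\<rho> j < 2 * n" if "\<rho> permutes {..<2 * n}" "j < 2 * n" for \<rho> :: "nat \<Rightarrow> nat" and j
    using permutes_in_image[OF that(1), of j] that(2) by simp
  have "A1 = transpose_mat R * A2 * R"
  proof (rule eq_matI)
    fix a b assume "a < dim_row (transpose_mat R * A2 * R)" "b < dim_col (transpose_mat R * A2 * R)"
    then have ab: "a < 2 * n" "b < 2 * n" by (auto simp: R_def)
    show "A1 $$ (a, b) = (transpose_mat R * A2 * R) $$ (a, b)"
      unfolding permutation_conj_entries[OF \<pi>(1) Ac(2) R_def ab] using ab p[OF \<pi>(1)] \<pi>(2) by (simp add: A)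
  qed (auto simp: A R_def)
  then have "graph_iso_by (2 * n) R A1 A2"
    using \<pi>(1) unfolding graph_iso_by_def permutation_mat_def R_def by blast
  then obtain R' where R': "gi A1 A2 = Some R'" "graph_iso_by (2 * n) R' A1 A2"
    using ans by (cases "gi A1 A2") auto
  then obtain \<rho> where \<rho>: "\<rho> permutes {..<2 * n}" "R' = mat (2 * n) (2 * n) (\<lambda>(i, j). if i = \<rho> j then 1 else 0)"
    "A1 = transpose_mat R' * A2 * R'"
    unfolding graph_iso_by_def permutation_mat_def by blast
  have "graph_weight q n P1 a b = graph_weight q n P2 (\<rho> a) (\<rho> b)" if ab: "a < 2 * n" "b < 2 * n" for a b
  proof -
    have "real_of_int (graph_weight q n P1 a b) = A1 $$ (a, b)" using ab by (simp add: A)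
    also have "\<dots> = (transpose_mat R' * A2 * R') $$ (a, b)" using \<rho>(3) by simp
    also have "\<dots> = A2 $$ (\<rho> a, \<rho> b)" by (rule permutation_conj_entries[OF \<rho>(1) Ac(2) \<rho>(2) ab])
    also have "\<dots> = of_int (graph_weight q n P2 (\<rho> a) (\<rho> b))" using ab p[OF \<rho>(1)] by (simp add: A)
    finally show ?thesis by simp
  qed
  then show ?thesis using that[OF \<rho>(1)] R'(1) \<rho>(2) by blast
qed

section \<open>Comparing two lattices by their projectors\<close>

lemma mat_factor_of_image:
  fixes V1 V2 :: "int mat"
  assumes V: "V1 \<in> carrier_mat n n" "V2 \<in> carrier_mat n n"
    and sub: "(\<lambda>z. V2 *\<^sub>v z) ` carrier_vec n \<subseteq> (\<lambda>z. V1 *\<^sub>v z) ` carrier_vec n"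
  obtains W where "W \<in> carrier_mat n n" "V2 = V1 * W"
proof -
  have Vr: "rmat V1 \<in> carrier_mat n n" "rmat V2 \<in> carrier_mat n n" using V by auto
  obtain W where W: "W \<in> carrier_mat n n" "rmat V2 = rmat V1 * rmat W"
  proof (rule int_factor_of_cols[OF Vr])
    fix j assume j: "j < n"
    have "V2 *\<^sub>v unit_vec n j \<in> (\<lambda>z. V1 *\<^sub>v z) ` carrier_vec n"
      by (rule subsetD[OF sub]) (rule imageI, simp)
    then obtain y where y: "y \<in> carrier_vec n" "V2 *\<^sub>v unit_vec n j = V1 *\<^sub>v y" by auto
    have "col (rmat V2) j = rmat V1 *\<^sub>v rvec y"
      unfolding col_eq_mult_rvec[OF Vr(2) j] rmat_mult_rvec[OF V(2) unit_vec_carrier] y(2) rmat_mult_rvec[OF V(1) y(1)] ..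
    then show "\<exists>x\<in>carrier_vec n. col (rmat V2) j = rmat V1 *\<^sub>v rvec x" using y(1) by blast
  qed
  have "rmat V2 = rmat (V1 * W)" unfolding W(2) by (rule of_int_hom.mat_hom_mult[OF V(1) W(1), symmetric])
  then have "V2 = V1 * W" using V W(1) by (auto simp: mat_eq_iff)
  then show ?thesis using that W(1) by blast
qed

text \<open>Borrowed from the real case, where a left inverse of a square matrix is also a right
  inverse.\<close>

lemma int_orthogonal_right:
  assumes "T \<in> carrier_mat n n" "transpose_mat T * T = (1\<^sub>m n :: int mat)"
  shows "T * transpose_mat T = 1\<^sub>m n"
proof -
  have "orthonormal_mat n (rmat T)" using orthonormal_int[OF assms(1)] assms(2) by simp
  then have "orthonormal_mat n (transpose_mat (rmat T))" by (rule orthonormal_cancel(5))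
  then have "orthonormal_mat n (rmat (transpose_mat T))" by (simp add: map_mat_transpose)
  then show ?thesis using orthonormal_int[of "transpose_mat T" n] assms(1) by simp
qed

lemma full_lattice_orthogonal:
  assumes T: "T \<in> carrier_mat n n" "transpose_mat T * T = 1\<^sub>m n" and V: "V \<in> carrier_mat n n" "full_lattice q n V"
  shows "full_lattice q n (T * V)"
  unfolding full_lattice_def
proof
  fix x :: "int vec" assume x: "x \<in> carrier_vec n"
  have Tt: "transpose_mat T \<in> carrier_mat n n" "T * transpose_mat T = 1\<^sub>m n"
    using T int_orthogonal_right[OF T] by auto
  obtain z where z: "z \<in> carrier_vec n" "V *\<^sub>v z = q \<cdot>\<^sub>v (transpose_mat T *\<^sub>v x)"
    using V(2) x Tt unfolding full_lattice_def by (metis mult_mat_vec_carrier)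
  have "(T * V) *\<^sub>v z = T *\<^sub>v (V *\<^sub>v z)" using T V z by simp
  also have "\<dots> = q \<cdot>\<^sub>v (T *\<^sub>v (transpose_mat T *\<^sub>v x))"
    unfolding z(2) using T x by (intro eq_vecI) (auto simp: scalar_prod_def sum_distrib_left intro!: sum.cong)
  also have "T *\<^sub>v (transpose_mat T *\<^sub>v x) = x"
    using assoc_mult_mat_vec[OF T(1) Tt(1) x] Tt(2) x by simp
  finally show "\<exists>z\<in>carrier_vec n. (T * V) *\<^sub>v z = q \<cdot>\<^sub>v x" using z by blast
qed

text \<open>\<open>T2 T1^T\<close> carries \<open>T1 V1\<close> to \<open>T2 V1\<close>, which
  generates the same lattice as \<open>T2 V2\<close>. Uniqueness of the projector then makes the
  conjugate of \<open>P1\<close> congruent to \<open>P2\<close>, which is what an isomorphism of the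
  graphs requires.\<close>

lemma projector_graph_iso:
  assumes V: "V1 \<in> carrier_mat n n" "V2 \<in> carrier_mat n n"
    and img: "(\<lambda>z. V1 *\<^sub>v z) ` carrier_vec n = (\<lambda>z. V2 *\<^sub>v z) ` carrier_vec n"
    and T1: "T1 \<in> carrier_mat n n" "transpose_mat T1 * T1 = 1\<^sub>m n"
    and T2: "T2 \<in> carrier_mat n n" "transpose_mat T2 * T2 = 1\<^sub>m n"
    and P: "code_projector q n (T1 * V1) P1" "code_projector q n (T2 * V2) P2"
  shows "\<exists>\<pi>. \<pi> permutes {..<2 * n} \<and> (\<forall>a<2 * n. \<forall>b<2 * n. graph_weight q n P1 a b = graph_weight q n P2 (\<pi> a) (\<pi> b))"
proof -
  obtain W where W: "W \<in> carrier_mat n n" "V2 = V1 * W" using mat_factor_of_image[OF V] img by blast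
  obtain W' where W': "W' \<in> carrier_mat n n" "V1 = V2 * W'" using mat_factor_of_image[OF V(2,1)] img by blast
  define T where "T = T2 * transpose_mat T1"
  have T1t: "transpose_mat T1 \<in> carrier_mat n n" "T1 * transpose_mat T1 = 1\<^sub>m n" and T2t: "transpose_mat T2 \<in> carrier_mat n n"
    using T1 T2 int_orthogonal_right[OF T1] by auto
  have T: "T \<in> carrier_mat n n" "transpose_mat T \<in> carrier_mat n n" using T1 T2 by (auto simp: T_def)
  have "transpose_mat T * T = T1 * ((transpose_mat T2 * T2) * transpose_mat T1)"
    unfolding T_def using T1(1) T1t(1) T2(1) T2t
    by (simp add: transpose_mult[of _ n n _ n] sq_mat_simps[where n = n])
  then have TT: "transpose_mat T * T = 1\<^sub>m n" using T2(2) T1t by simp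
  have "T * (T1 * V1) = T2 * ((transpose_mat T1 * T1) * V1)"
    unfolding T_def using T1(1) T1t(1) T2(1) V by (simp add: sq_mat_simps[where n = n])
  then have TU: "T * (T1 * V1) = T2 * V1" using T1(2) V by simp
  have Pc: "P1 \<in> carrier_mat n n" "P2 \<in> carrier_mat n n" using P by (auto simp: code_projector_def)
  have "code_projector q n (T2 * V1) (T * P1 * transpose_mat T)"
    using code_projector_conj[OF P(1) T(1) TT] unfolding TU .
  moreover have "T2 * V2 = T2 * V1 * W" using W T2 V by (simp add: sq_mat_simps[where n = n])
  moreover have "T2 * V1 = T2 * V2 * W'"
  proof -
    have "T2 * V2 * W' = T2 * (V2 * W')" using W'(1) T2(1) V(2) by (simp add: sq_mat_simps[where n = n])
    then show ?thesis using W'(2) by simp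
  qed
  ultimately have "mdvd q (T * P1 * transpose_mat T - P2)"
    using code_projector_unique[OF _ P(2) W(1) _ W'(1)] by blast
  moreover have m: "T * P1 * transpose_mat T - P2 \<in> carrier_mat n n" using T Pc by auto
  ultimately have "mdvd q (transpose_mat T * (T * P1 * transpose_mat T - P2) * T)"
    using T by (intro mdvd_mult_right[of _ "transpose_mat T * _"] mdvd_mult_left[of _ "T * P1 * transpose_mat T - P2"]) auto
  also have "transpose_mat T * (T * P1 * transpose_mat T - P2) * T = P1 - transpose_mat T * P2 * T"
  proof -
    have "transpose_mat T * (T * P1 * transpose_mat T - P2) * T
      = transpose_mat T * T * P1 * (transpose_mat T * T) - transpose_mat T * P2 * T"
      using T Pc by (simp add: sq_mat_simps[where n = n])
    then show ?thesis unfolding TT using Pc by simp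
  qed
  finally show ?thesis by (intro graph_iso_of_orthogonal[OF T(1) TT Pc])
qed

text \<open>\<open>S\<close> is any signed permutation that matches the projectors, not necessarily
  the one that relates the two hidden rotations. Such an \<open>S\<close> maps the first lattice, in
  the coordinates given by \<open>Q1\<close>, onto the second in those given by \<open>Q2\<close>.
  The matrix of the claim reads from right to left: undo \<open>Q2\<close>, apply the inverse of
  \<open>S\<close>, apply \<open>Q1\<close>.\<close>

lemma lattice_iso_of_projectors:
  assumes B: "B1 = Q1 * rmat U1" "B2 = Q2 * rmat U2"
    and Q: "orthonormal_mat n Q1" "orthonormal_mat n Q2"
    and P: "code_projector q n U1 P1" "code_projector q n U2 P2"
    and full: "full_lattice q n U1" "full_lattice q n U2"
    and S: "S \<in> carrier_mat n n" "transpose_mat S * S = 1\<^sub>m n" "mdvd q (P1 - transpose_mat S * P2 * S)"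
  shows "lattice_iso_by n (Q1 * transpose_mat (rmat S) * transpose_mat Q2)
    ((\<lambda>z. B1 *\<^sub>v rvec z) ` carrier_vec n) ((\<lambda>z. B2 *\<^sub>v rvec z) ` carrier_vec n)"
proof -
  have Uc: "U1 \<in> carrier_mat n n" "U2 \<in> carrier_mat n n" "P1 \<in> carrier_mat n n" "P2 \<in> carrier_mat n n"
    using P by (auto simp: code_projector_def)
  have Qc: "Q1 \<in> carrier_mat n n" "Q2 \<in> carrier_mat n n" using Q by (auto simp: orthonormal_mat_def)
  have St: "transpose_mat S \<in> carrier_mat n n" "S * transpose_mat S = 1\<^sub>m n"
    using S int_orthogonal_right[OF S(1,2)] by auto
  have Sr: "orthonormal_mat n (rmat S)" using orthonormal_int[OF S(1)] S(2) by simp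
  have orth: "orthonormal_mat n (Q1 * transpose_mat (rmat S) * transpose_mat Q2)"
    by (intro orthonormal_mult orthonormal_cancel(5) Q Sr)
  \<comment> \<open>Both lattices in coordinates, described through their projectors only;
    generating matrices do not enter the comparison any more.\<close>
  define F1 where "F1 = {x \<in> carrier_vec n. vdvd q (P1 *\<^sub>v x - x)}"
  define F2 where "F2 = {x \<in> carrier_vec n. vdvd q (P2 *\<^sub>v x - x)}"
  have img: "(\<lambda>z. B *\<^sub>v rvec z) ` carrier_vec n = (\<lambda>x. Q *\<^sub>v rvec x) ` {x \<in> carrier_vec n. vdvd q (P *\<^sub>v x - x)}"
    if "B = Q * rmat U" "code_projector q n U P" "full_lattice q n U" "Q \<in> carrier_mat n n" "U \<in> carrier_mat n n" for B Q U P
  proof -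
    have "B *\<^sub>v rvec z = Q *\<^sub>v rvec (U *\<^sub>v z)" if z: "z \<in> carrier_vec n" for z
      unfolding \<open>B = Q * rmat U\<close> using z \<open>Q \<in> carrier_mat n n\<close> \<open>U \<in> carrier_mat n n\<close>
      by (simp add: rmat_mult_rvec[of U n n, symmetric])
    then have "(\<lambda>z. B *\<^sub>v rvec z) ` carrier_vec n = (\<lambda>x. Q *\<^sub>v rvec x) ` (\<lambda>z. U *\<^sub>v z) ` carrier_vec n"
      unfolding image_image by (intro image_cong) auto
    also have "(\<lambda>z. U *\<^sub>v z) ` carrier_vec n = {x \<in> carrier_vec n. vdvd q (P *\<^sub>v x - x)}"
    proof (intro equalityI subsetI)
      fix x assume "x \<in> (\<lambda>z. U *\<^sub>v z) ` carrier_vec n"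
      then obtain z where z: "z \<in> carrier_vec n" "x = U *\<^sub>v z" by auto
      then have "x \<in> carrier_vec n" using that(5) by simp
      then show "x \<in> {x \<in> carrier_vec n. vdvd q (P *\<^sub>v x - x)}"
        using code_projector_fixes_iff[OF that(2)] that(3) z unfolding full_lattice_def by blast
    next
      fix x assume "x \<in> {x \<in> carrier_vec n. vdvd q (P *\<^sub>v x - x)}"
      then show "x \<in> (\<lambda>z. U *\<^sub>v z) ` carrier_vec n"
        using code_projector_fixes_iff[OF that(2)] that(3) unfolding full_lattice_def by blast
    qed
    finally show ?thesis .
  qed
  have L1: "(\<lambda>z. B1 *\<^sub>v rvec z) ` carrier_vec n = (\<lambda>x. Q1 *\<^sub>v rvec x) ` F1"
    unfolding F1_def by (rule img[OF B(1) P(1) full(1) Qc(1) Uc(1)])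
  have L2: "(\<lambda>z. B2 *\<^sub>v rvec z) ` carrier_vec n = (\<lambda>x. Q2 *\<^sub>v rvec x) ` F2"
    unfolding F2_def by (rule img[OF B(2) P(2) full(2) Qc(2) Uc(2)])
  have SS: "transpose_mat S *\<^sub>v (S *\<^sub>v x) = x" "S *\<^sub>v (transpose_mat S *\<^sub>v x) = x" if "x \<in> carrier_vec n" for x
    using assoc_mult_mat_vec[OF St(1) S(1) that] assoc_mult_mat_vec[OF S(1) St(1) that] S(2) St(2) that by auto
  \<comment> \<open>\<open>P1 x - x\<close> is congruent to \<open>S^T (P2 S x - S x)\<close>, and
    multiplication by \<open>S^T\<close> neither creates nor destroys divisibility by
    \<open>q\<close>, as \<open>S\<close> is its inverse.\<close>
  have key: "x \<in> F1 \<longleftrightarrow> S *\<^sub>v x \<in> F2" if x: "x \<in> carrier_vec n" for x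
  proof -
    have "(P1 - transpose_mat S * P2 * S) *\<^sub>v x = P1 *\<^sub>v x - (transpose_mat S * P2 * S) *\<^sub>v x"
      using Uc S x by (intro minus_mult_distrib_mat_vec[of _ n n]) auto
    moreover have "(transpose_mat S * P2 * S) *\<^sub>v x = transpose_mat S *\<^sub>v (P2 *\<^sub>v (S *\<^sub>v x))"
      using Uc S(1) St(1) x by (simp add: assoc_mult_mat_vec[of _ n n _ n] mult_carrier_mat[of _ n n _ n])
    moreover have "transpose_mat S *\<^sub>v (P2 *\<^sub>v (S *\<^sub>v x) - S *\<^sub>v x) = transpose_mat S *\<^sub>v (P2 *\<^sub>v (S *\<^sub>v x)) - x"
      using Uc S(1) St(1) x SS by (simp add: mult_minus_distrib_mat_vec[of _ n n])
    moreover have "vdvd q ((P1 - transpose_mat S * P2 * S) *\<^sub>v x)"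
      by (rule mdvd_mult_vec[OF S(3)]) (use x S Uc in simp)
    ultimately have d: "vdvd q (P1 *\<^sub>v x - transpose_mat S *\<^sub>v (P2 *\<^sub>v (S *\<^sub>v x)))"
      and e: "transpose_mat S *\<^sub>v (P2 *\<^sub>v (S *\<^sub>v x) - S *\<^sub>v x) = transpose_mat S *\<^sub>v (P2 *\<^sub>v (S *\<^sub>v x)) - x" by auto
    define y where "y = transpose_mat S *\<^sub>v (P2 *\<^sub>v (S *\<^sub>v x))"
    have yc: "y \<in> carrier_vec n" "P1 *\<^sub>v x \<in> carrier_vec n" using Uc S St x by (auto simp: y_def)
    have 1: "vdvd q (P1 *\<^sub>v x - x) \<longleftrightarrow> vdvd q (y - x)"
    proof -
      have dd: "q dvd (P1 *\<^sub>v x) $ i - y $ i" if "i < n" for i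
        using d that yc x by (auto simp: vdvd_def y_def[symmetric])
      have "q dvd (P1 *\<^sub>v x) $ i - x $ i \<longleftrightarrow> q dvd y $ i - x $ i" if "i < n" for i
        using dvd_add_right_iff[OF dd[OF that], of "y $ i - x $ i"] by simp
      then show ?thesis using yc x by (simp add: vdvd_def del: index_mult_mat_vec)
    qed
    have 2: "vdvd q (y - x) \<longleftrightarrow> vdvd q (P2 *\<^sub>v (S *\<^sub>v x) - S *\<^sub>v x)"
    proof
      have wc: "P2 *\<^sub>v (S *\<^sub>v x) - S *\<^sub>v x \<in> carrier_vec n" using Uc S x by simp
      assume "vdvd q (y - x)"
      then have "vdvd q (transpose_mat S *\<^sub>v (P2 *\<^sub>v (S *\<^sub>v x) - S *\<^sub>v x))" unfolding e y_def .
      then have "vdvd q (S *\<^sub>v (transpose_mat S *\<^sub>v (P2 *\<^sub>v (S *\<^sub>v x) - S *\<^sub>v x)))"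
        by (rule vdvd_mult_vec) (use S in simp)
      then show "vdvd q (P2 *\<^sub>v (S *\<^sub>v x) - S *\<^sub>v x)" unfolding SS(2)[OF wc] .
    next
      assume "vdvd q (P2 *\<^sub>v (S *\<^sub>v x) - S *\<^sub>v x)"
      then have "vdvd q (transpose_mat S *\<^sub>v (P2 *\<^sub>v (S *\<^sub>v x) - S *\<^sub>v x))"
        by (rule vdvd_mult_vec) (use S Uc in simp)
      then show "vdvd q (y - x)" unfolding e y_def .
    qed
    show ?thesis unfolding F1_def F2_def using 1 2 x S by simp
  qed
  have Ov: "(Q1 * transpose_mat (rmat S) * transpose_mat Q2) *\<^sub>v (Q2 *\<^sub>v rvec x) = Q1 *\<^sub>v rvec (transpose_mat S *\<^sub>v x)"
    if x: "x \<in> carrier_vec n" for x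
  proof -
    have r: "rvec x \<in> carrier_vec n" "transpose_mat (rmat S) \<in> carrier_mat n n" "transpose_mat Q2 \<in> carrier_mat n n"
      using x S Qc by auto
    have "(Q1 * transpose_mat (rmat S) * transpose_mat Q2) *\<^sub>v (Q2 *\<^sub>v rvec x)
      = Q1 *\<^sub>v (transpose_mat (rmat S) *\<^sub>v (transpose_mat Q2 *\<^sub>v (Q2 *\<^sub>v rvec x)))"
      using Qc r
      by (simp add: assoc_mult_mat_vec[of _ n n _ n] mult_carrier_mat[of _ n n _ n])
    also have "\<dots> = Q1 *\<^sub>v (transpose_mat (rmat S) *\<^sub>v rvec x)"
      unfolding orthonormal_cancel(2)[OF Q(2) r(1)] ..
    also have "\<dots> = Q1 *\<^sub>v rvec (transpose_mat S *\<^sub>v x)"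
      using rmat_mult_rvec[OF St(1) x] by (simp add: map_mat_transpose)
    finally show ?thesis .
  qed
  have "(\<lambda>x. Q1 *\<^sub>v rvec x) ` F1 = (\<lambda>v. (Q1 * transpose_mat (rmat S) * transpose_mat Q2) *\<^sub>v v) ` (\<lambda>x. Q2 *\<^sub>v rvec x) ` F2"
  proof (intro equalityI subsetI)
    fix v assume "v \<in> (\<lambda>x. Q1 *\<^sub>v rvec x) ` F1"
    then obtain x where x: "x \<in> F1" "v = Q1 *\<^sub>v rvec x" by auto
    then have xc: "x \<in> carrier_vec n" by (simp add: F1_def)
    have "S *\<^sub>v x \<in> F2" using key[OF xc] x by simp
    moreover have "v = (Q1 * transpose_mat (rmat S) * transpose_mat Q2) *\<^sub>v (Q2 *\<^sub>v rvec (S *\<^sub>v x))"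
      unfolding Ov[OF mult_mat_vec_carrier[OF S(1) xc]] SS(1)[OF xc] x(2) ..
    ultimately show "v \<in> (\<lambda>v. (Q1 * transpose_mat (rmat S) * transpose_mat Q2) *\<^sub>v v) ` (\<lambda>x. Q2 *\<^sub>v rvec x) ` F2"
      by blast
  next
    fix v assume "v \<in> (\<lambda>v. (Q1 * transpose_mat (rmat S) * transpose_mat Q2) *\<^sub>v v) ` (\<lambda>x. Q2 *\<^sub>v rvec x) ` F2"
    then obtain x where x: "x \<in> F2" "v = (Q1 * transpose_mat (rmat S) * transpose_mat Q2) *\<^sub>v (Q2 *\<^sub>v rvec x)" by auto
    then have xc: "x \<in> carrier_vec n" by (simp add: F2_def)
    have "transpose_mat S *\<^sub>v x \<in> F1" using key[OF mult_mat_vec_carrier[OF St(1) xc]] SS(2)[OF xc] x by simp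
    then show "v \<in> (\<lambda>x. Q1 *\<^sub>v rvec x) ` F1" unfolding x(2) Ov[OF xc] by blast
  qed
  then show ?thesis unfolding lattice_iso_by_def mat_image_def L1 L2 using orth by blast
qed

section \<open>The reduction\<close>

definition copy_array :: "nexp \<Rightarrow> vname \<Rightarrow> vname \<Rightarrow> com" where
  "copy_array e Z Y = For2 ''k'' e ''l'' e (RAssign Z (NVar ''k'') (NVar ''l'') (RCell Y (NVar ''k'') (NVar ''l'')))"

lemma runs_copy_array:
  assumes "Z \<noteq> Y" "\<And>s'. same {''k'', ''l''} {Z} s s' \<Longrightarrow> nval e s' = m"
  shows "runs zl gi (copy_array e Z Y) s (\<lambda>t s'. t \<le> 2 + m * (m * 3 + 4) \<and> same {''k'', ''l''} {Z} s s' \<and>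
    (\<forall>a<m. \<forall>b<m. snd s' Z a b = snd s Y a b))"
  unfolding copy_array_def
  by (rule runs_mono[OF runs_assign_For2[where f = "snd s Y" and ?m1.0 = m and ?m2.0 = m]])
    (use assms in \<open>auto simp: same_snd\<close>)

text \<open>\<open>H\<close> is the permutation matrix of size \<open>2 n\<close> on the signed
  vertices. In the column of \<open>(j, +)\<close> its single 1 stands in row \<open>i\<close> or
  \<open>n + i\<close>, according to the sign of the image; the difference of the two rows is
  therefore the signed permutation matrix \<open>S\<close>.\<close>

definition recover :: com where
  "recover =
    Seq (For2 ''k'' (NVar ''n'') ''l'' (NVar ''n'') (RAssign ''S'' (NVar ''k'') (NVar ''l'')
      (RMinus (RCell ''H'' (NVar ''k'') (NVar ''l'')) (RCell ''H'' (NPlus (NVar ''n'') (NVar ''k'')) (NVar ''l'')))))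
    (Seq (dotprod ''T'' (RTimes (RCell ''Q1'' (NVar ''i'') (NVar ''k'')) (RCell ''S'' (NVar ''j'') (NVar ''k''))))
      (dotprod ''O'' (RTimes (RCell ''T'' (NVar ''i'') (NVar ''k'')) (RCell ''Q'' (NVar ''j'') (NVar ''k'')))))"

lemma runs_recover:
  assumes s: "fst s ''n'' = n" and Q: "Q1 \<in> carrier_mat n n" "Q2 \<in> carrier_mat n n"
      "\<And>i j. i < n \<Longrightarrow> j < n \<Longrightarrow> snd s ''Q1'' i j = Q1 $$ (i, j)"
      "\<And>i j. i < n \<Longrightarrow> j < n \<Longrightarrow> snd s ''Q'' i j = Q2 $$ (i, j)"
    and H: "\<And>i j. i < n \<Longrightarrow> j < n \<Longrightarrow> snd s ''H'' i j - snd s ''H'' (n + i) j = of_int (S $$ (i, j))"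
    and S: "S \<in> carrier_mat n n"
  shows "runs zl gi recover s (\<lambda>t s'.
    t \<le> (2 + n * (n * 3 + 4)) + (dot_time n + dot_time n) \<and>
    get_mat n ''O'' s' = Q1 * transpose_mat (rmat S) * transpose_mat Q2)"
  (is "runs _ _ _ _ ?Q")
  unfolding recover_def
proof (rule runs_SeqI)
  show "runs zl gi (For2 ''k'' (NVar ''n'') ''l'' (NVar ''n'') (RAssign ''S'' (NVar ''k'') (NVar ''l'')
      (RMinus (RCell ''H'' (NVar ''k'') (NVar ''l'')) (RCell ''H'' (NPlus (NVar ''n'') (NVar ''k'')) (NVar ''l''))))) s
    (\<lambda>t s'. t \<le> 2 + n * (n * 3 + 4) \<and> same {''k'', ''l''} {''S''} s s' \<and>
      (\<forall>a b. snd s' ''S'' a b = (if a < n \<and> b < n then snd s ''H'' a b - snd s ''H'' (n + a) b else snd s ''S'' a b)))"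
    by (rule runs_assign_For2) (auto simp: same_snd same_fst s)
  fix t1 :: nat and s1 assume *: "t1 \<le> 2 + n * (n * 3 + 4) \<and> same {''k'', ''l''} {''S''} s s1 \<and>
      (\<forall>a b. snd s1 ''S'' a b = (if a < n \<and> b < n then snd s ''H'' a b - snd s ''H'' (n + a) b else snd s ''S'' a b))"
  then have s1: "same {''k'', ''l''} {''S''} s s1" and S1: "\<And>a b. a < n \<Longrightarrow> b < n \<Longrightarrow> snd s1 ''S'' a b = of_int (S $$ (a, b))"
    using H by auto
  have n1: "fst s1 ''n'' = n" and Q1: "snd s1 ''Q1'' = snd s ''Q1''" "snd s1 ''Q'' = snd s ''Q''"
    using same_fst[OF s1, of "''n''"] same_snd[OF s1, of "''Q1''"] same_snd[OF s1, of "''Q''"] s by auto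
  have dotT: "runs zl gi (dotprod ''T'' (RTimes (RCell ''Q1'' (NVar ''i'') (NVar ''k'')) (RCell ''S'' (NVar ''j'') (NVar ''k'')))) s1
    (\<lambda>t s'. t \<le> dot_time n \<and> same {''i'', ''j'', ''k''} {''t'', ''T''} s1 s' \<and>
      (\<forall>a b. snd s' ''T'' a b = (if a < n \<and> b < n then \<Sum>k<n. snd s1 ''Q1'' a k * snd s1 ''S'' b k else snd s1 ''T'' a b)))"
    by (rule runs_dotprod[OF n1]) (auto simp: same_snd)
  show "runs zl gi (Seq (dotprod ''T'' (RTimes (RCell ''Q1'' (NVar ''i'') (NVar ''k'')) (RCell ''S'' (NVar ''j'') (NVar ''k''))))
      (dotprod ''O'' (RTimes (RCell ''T'' (NVar ''i'') (NVar ''k'')) (RCell ''Q'' (NVar ''j'') (NVar ''k''))))) s1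
    (\<lambda>t. ?Q (t1 + t))"
  proof (rule runs_SeqI[OF dotT], elim conjE)
    fix t2 :: nat and s2 assume t2: "t2 \<le> dot_time n" and s2: "same {''i'', ''j'', ''k''} {''t'', ''T''} s1 s2"
      and T2: "\<forall>a b. snd s2 ''T'' a b = (if a < n \<and> b < n then \<Sum>k<n. snd s1 ''Q1'' a k * snd s1 ''S'' b k else snd s1 ''T'' a b)"
    have n2: "fst s2 ''n'' = n" and Q2': "snd s2 ''Q'' = snd s ''Q''"
      using same_fst[OF s2, of "''n''"] same_snd[OF s2, of "''Q''"] n1 Q1 by auto
    define R where "R = Q1 * transpose_mat (rmat S)"
    have R: "R \<in> carrier_mat n n" using Q S by (simp add: R_def)
    have R2: "snd s2 ''T'' a b = R $$ (a, b)" if "a < n" "b < n" for a b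
      using T2 S1 Q1 Q S that by (auto simp: R_def scalar_prod_def lessThan_atLeast0 intro!: sum.cong)
    show "runs zl gi (dotprod ''O'' (RTimes (RCell ''T'' (NVar ''i'') (NVar ''k'')) (RCell ''Q'' (NVar ''j'') (NVar ''k'')))) s2
      (\<lambda>t. ?Q (t1 + (t2 + t)))"
    proof (rule runs_mono[OF runs_dotprod[OF n2, where f = "\<lambda>i j k. snd s2 ''T'' i k * snd s2 ''Q'' j k"]])
      fix t :: nat and s' assume t: "t \<le> dot_time n \<and> same {''i'', ''j'', ''k''} {''t'', ''O''} s2 s' \<and>
        (\<forall>a b. snd s' ''O'' a b = (if a < n \<and> b < n then \<Sum>k<n. snd s2 ''T'' a k * snd s2 ''Q'' b k else snd s2 ''O'' a b))"
      have "get_mat n ''O'' s' = R * transpose_mat Q2"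
        using t R2 Q2' Q R by (intro eq_matI) (auto simp: get_mat_def scalar_prod_def lessThan_atLeast0 intro!: sum.cong)
      moreover have "t1 + (t2 + t) \<le> (2 + n * (n * 3 + 4)) + (dot_time n + dot_time n)"
        by (intro add_mono t2) (use t * in auto)
      ultimately show "t1 + (t2 + t) \<le> (2 + n * (n * 3 + 4)) + (dot_time n + dot_time n) \<and>
        get_mat n ''O'' s' = Q1 * transpose_mat (rmat S) * transpose_mat Q2"
        by (simp add: R_def)
    qed (auto simp: same_snd)
  qed
qed

text \<open>\<open>core\<close> reads its basis from \<open>B\<close> and leaves its results in
  \<open>Q\<close> and \<open>A\<close>, so the results of the first run are saved in
  \<open>Q1\<close> and \<open>A1\<close> before the second. None of \<open>B1\<close>,
  \<open>B2\<close>, \<open>Q1\<close> and \<open>A1\<close> is among the arrays that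
  \<open>core\<close> overwrites.\<close>

definition reduction :: com where
  "reduction =
    Seq (copy_array (NVar ''n'') ''B'' ''B1'') (Seq core
    (Seq (copy_array (NVar ''n'') ''Q1'' ''Q'') (Seq (copy_array twice_n ''A1'' ''A'')
    (Seq (copy_array (NVar ''n'') ''B'' ''B2'') (Seq core
    (Seq (GI_Call twice_n ''A1'' ''A'' ''f'' ''H'') recover))))))"

text \<open>Bracketed like the sequential composition of the program, so that the total bound
  follows from the bounds of the parts by monotonicity of addition.\<close>

definition reduction_time :: "nat \<Rightarrow> nat \<Rightarrow> nat" where
  "reduction_time n N =
    (2 + n * (n * 3 + 4)) + (core_time n N + ((2 + n * (n * 3 + 4)) + ((2 + (n + n) * ((n + n) * 3 + 4)) +
    ((2 + n * (n * 3 + 4)) + (core_time n N +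
    ((1 + 2 * ((n + n) * ((n + n) * (N + 1 + 2)))) +
    ((2 + n * (n * 3 + 4)) + (dot_time n + dot_time n))))))))"

text \<open>The size of the graphs enters the cost of the oracle call, and \<open>2 q\<close> is
  below \<open>2^(N + 1)\<close>.\<close>

lemma graph_weight_bound:
  assumes "1 < q" shows "\<bar>graph_weight q n P a b\<bar> \<le> 2 * q"
proof -
  define u where "u = P $$ (vertex_index n a, vertex_index n a) mod q"
  define v where "v = (vertex_sign n a * vertex_sign n b * P $$ (vertex_index n a, vertex_index n b)) mod q"
  have "0 \<le> u" "u < q" "0 \<le> v" "v < q" using assms by (simp_all add: u_def v_def)
  then show ?thesis
    using assms unfolding graph_weight_def u_def[symmetric] v_def[symmetric] by auto
qed

lemma runs_reduction:
  fixes q p :: int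
  assumes zl: "ZLIP_oracle zl" and gi: "GI_oracle (2 * n) gi"
    and s: "fst s ''n'' = n" "snd s ''q'' 0 0 = of_int q"
    and B1: "B1 \<in> carrier_mat n n" "\<And>i j. i < n \<Longrightarrow> j < n \<Longrightarrow> snd s ''B1'' i j = B1 $$ (i, j) \<and> \<bar>B1 $$ (i, j)\<bar> \<le> 2 ^ N"
    and B2: "B2 \<in> carrier_mat n n" "\<And>i j. i < n \<Longrightarrow> j < n \<Longrightarrow> snd s ''B2'' i j = B2 $$ (i, j) \<and> \<bar>B2 $$ (i, j)\<bar> \<le> 2 ^ N"
    and q: "q = p ^ e" "prime p" "0 < e" "1 < q" "q < 2 ^ N" and n: "n \<le> 2 ^ N"
    and O1: "orthonormal_mat n O1" and V1: "trivial_hull q n V1" "full_lattice q n V1" "B1 = O1 * rmat V1"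
    and O2: "orthonormal_mat n O2" and V2: "trivial_hull q n V2" "full_lattice q n V2" "B2 = O2 * rmat V2"
    and img: "(\<lambda>z. V1 *\<^sub>v z) ` carrier_vec n = (\<lambda>z. V2 *\<^sub>v z) ` carrier_vec n"
  shows "runs zl gi reduction s (\<lambda>t s'. t \<le> reduction_time n N \<and>
    lattice_iso_by n (get_mat n ''O'' s') ((\<lambda>z. B1 *\<^sub>v rvec z) ` carrier_vec n) ((\<lambda>z. B2 *\<^sub>v rvec z) ` carrier_vec n))"
  (is "runs zl gi reduction s (\<lambda>t s'. t \<le> _ \<and> ?goal s')" is "runs _ _ _ _ ?Q")
  unfolding reduction_def
proof (rule runs_SeqI[OF runs_copy_array[where m = n]])
  show "nval (NVar ''n'') s' = n" if "same {''k'', ''l''} {''B''} s s'" for s'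
    using same_fst[OF that, of "''n''"] s by simp
  fix t1 :: nat and s1 assume a1: "t1 \<le> 2 + n * (n * 3 + 4) \<and> same {''k'', ''l''} {''B''} s s1 \<and>
    (\<forall>a<n. \<forall>b<n. snd s1 ''B'' a b = snd s ''B1'' a b)"
  then have s1: "same {''k'', ''l''} {''B''} s s1" by blast
  have n1: "fst s1 ''n'' = n" and q1: "snd s1 ''q'' 0 0 = of_int q"
    using same_fst[OF s1, of "''n''"] same_snd[OF s1, of "''q''"] s by auto
  have b1: "snd s1 ''B'' i j = B1 $$ (i, j) \<and> \<bar>B1 $$ (i, j)\<bar> \<le> 2 ^ N" if "i < n" "j < n" for i j
    using a1 B1(2) that by simp
  have V1c: "V1 \<in> carrier_mat n n" and V2c: "V2 \<in> carrier_mat n n" using V1 V2 by (auto simp: trivial_hull_def)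
  show "runs zl gi (Seq core (Seq (copy_array (NVar ''n'') ''Q1'' ''Q'') (Seq (copy_array twice_n ''A1'' ''A'')
    (Seq (copy_array (NVar ''n'') ''B'' ''B2'') (Seq core
    (Seq (GI_Call twice_n ''A1'' ''A'' ''f'' ''H'') recover)))))) s1 (\<lambda>t. ?Q (t1 + t))"
  proof (rule runs_SeqI[OF runs_core[OF zl n1 q1 B1(1) b1 q n O1 V1]], assumption, assumption, elim conjE exE)
    fix t2 :: nat and s2 T1 P1 Q1
    assume t2: "t2 \<le> core_time n N" and s2: "same core_vars core_arrays s1 s2"
      and T1: "T1 \<in> carrier_mat n n" "transpose_mat T1 * T1 = 1\<^sub>m n" and Q1: "orthonormal_mat n Q1"
      and Q1s: "\<forall>i<n. \<forall>j<n. snd s2 ''Q'' i j = Q1 $$ (i, j)" and BT1: "B1 = Q1 * rmat (T1 * V1)"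
      and P1: "code_projector q n (T1 * V1) P1"
      and A1: "\<forall>a<2 * n. \<forall>b<2 * n. snd s2 ''A'' a b = of_int (graph_weight q n P1 a b)"
    have n2: "fst s2 ''n'' = n" using same_fst[OF s2, of "''n''"] n1 by simp
    show "runs zl gi (Seq (copy_array (NVar ''n'') ''Q1'' ''Q'') (Seq (copy_array twice_n ''A1'' ''A'')
    (Seq (copy_array (NVar ''n'') ''B'' ''B2'') (Seq core
    (Seq (GI_Call twice_n ''A1'' ''A'' ''f'' ''H'') recover))))) s2 (\<lambda>t. ?Q (t1 + (t2 + t)))"
    proof (rule runs_SeqI[OF runs_copy_array[where m = n]])
      show "nval (NVar ''n'') s' = n" if "same {''k'', ''l''} {''Q1''} s2 s'" for s'
        using same_fst[OF that, of "''n''"] n2 by simp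
      fix t3 :: nat and s3 assume a3: "t3 \<le> 2 + n * (n * 3 + 4) \<and> same {''k'', ''l''} {''Q1''} s2 s3 \<and>
        (\<forall>a<n. \<forall>b<n. snd s3 ''Q1'' a b = snd s2 ''Q'' a b)"
      then have s3: "same {''k'', ''l''} {''Q1''} s2 s3" by blast
      have n3: "fst s3 ''n'' = n" using same_fst[OF s3, of "''n''"] n2 by simp
      show "runs zl gi (Seq (copy_array twice_n ''A1'' ''A'') (Seq (copy_array (NVar ''n'') ''B'' ''B2'') (Seq core
        (Seq (GI_Call twice_n ''A1'' ''A'' ''f'' ''H'') recover)))) s3 (\<lambda>t. ?Q (t1 + (t2 + (t3 + t))))"
      proof (rule runs_SeqI[OF runs_copy_array[where m = "n + n"]])
        show "nval twice_n s' = n + n" if "same {''k'', ''l''} {''A1''} s3 s'" for s'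
          using same_fst[OF that, of "''n''"] n3 by simp
        fix t4 :: nat and s4 assume a4: "t4 \<le> 2 + (n + n) * ((n + n) * 3 + 4) \<and> same {''k'', ''l''} {''A1''} s3 s4 \<and>
          (\<forall>a<n + n. \<forall>b<n + n. snd s4 ''A1'' a b = snd s3 ''A'' a b)"
        then have s4: "same {''k'', ''l''} {''A1''} s3 s4" by blast
        have n4: "fst s4 ''n'' = n" using same_fst[OF s4, of "''n''"] n3 by simp
        show "runs zl gi (Seq (copy_array (NVar ''n'') ''B'' ''B2'') (Seq core
          (Seq (GI_Call twice_n ''A1'' ''A'' ''f'' ''H'') recover))) s4 (\<lambda>t. ?Q (t1 + (t2 + (t3 + (t4 + t)))))"
        proof (rule runs_SeqI[OF runs_copy_array[where m = n]])
          show "nval (NVar ''n'') s' = n" if "same {''k'', ''l''} {''B''} s4 s'" for s'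
            using same_fst[OF that, of "''n''"] n4 by simp
          fix t5 :: nat and s5 assume a5: "t5 \<le> 2 + n * (n * 3 + 4) \<and> same {''k'', ''l''} {''B''} s4 s5 \<and>
            (\<forall>a<n. \<forall>b<n. snd s5 ''B'' a b = snd s4 ''B2'' a b)"
          then have s5: "same {''k'', ''l''} {''B''} s4 s5" by blast
          have n5: "fst s5 ''n'' = n" using same_fst[OF s5, of "''n''"] n4 by simp
          have q5: "snd s5 ''q'' 0 0 = of_int q" and B2': "snd s4 ''B2'' = snd s ''B2''"
            using same_snd[OF s5, of "''q''"] same_snd[OF s4, of "''q''"] same_snd[OF s3, of "''q''"] same_snd[OF s2, of "''q''"] q1
              same_snd[OF s4, of "''B2''"] same_snd[OF s3, of "''B2''"] same_snd[OF s2, of "''B2''"] same_snd[OF s1, of "''B2''"]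
            by auto
          have b5: "snd s5 ''B'' i j = B2 $$ (i, j) \<and> \<bar>B2 $$ (i, j)\<bar> \<le> 2 ^ N" if "i < n" "j < n" for i j
            using a5 B2(2) B2' that by simp
          have Q15: "\<forall>i<n. \<forall>j<n. snd s5 ''Q1'' i j = Q1 $$ (i, j)"
            using same_snd[OF s5, of "''Q1''"] same_snd[OF s4, of "''Q1''"] a3 Q1s by simp
          have A15: "\<forall>a<2 * n. \<forall>b<2 * n. snd s5 ''A1'' a b = of_int (graph_weight q n P1 a b)"
            using same_snd[OF s5, of "''A1''"] same_snd[OF s3, of "''A''"] a4 A1 by (simp add: mult_2)
          show "runs zl gi (Seq core (Seq (GI_Call twice_n ''A1'' ''A'' ''f'' ''H'') recover)) s5
            (\<lambda>t. ?Q (t1 + (t2 + (t3 + (t4 + (t5 + t))))))"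
          proof (rule runs_SeqI[OF runs_core[OF zl n5 q5 B2(1) b5 q n O2 V2]], assumption, assumption, elim conjE exE)
            fix t6 :: nat and s6 T2 P2 Q2
            assume t6: "t6 \<le> core_time n N" and s6: "same core_vars core_arrays s5 s6"
              and T2: "T2 \<in> carrier_mat n n" "transpose_mat T2 * T2 = 1\<^sub>m n" and Q2: "orthonormal_mat n Q2"
              and Q2s: "\<forall>i<n. \<forall>j<n. snd s6 ''Q'' i j = Q2 $$ (i, j)" and BT2: "B2 = Q2 * rmat (T2 * V2)"
              and P2: "code_projector q n (T2 * V2) P2"
              and A2: "\<forall>a<2 * n. \<forall>b<2 * n. snd s6 ''A'' a b = of_int (graph_weight q n P2 a b)"
            have n6: "fst s6 ''n'' = n" using same_fst[OF s6, of "''n''"] n5 by simp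
            have Q16: "snd s6 ''Q1'' i j = Q1 $$ (i, j)" if "i < n" "j < n" for i j
              using same_snd[OF s6, of "''Q1''"] Q15 that by simp
            define M1 :: "real mat" where "M1 = mat (2 * n) (2 * n) (\<lambda>(a, b). of_int (graph_weight q n P1 a b))"
            define M2 :: "real mat" where "M2 = mat (2 * n) (2 * n) (\<lambda>(a, b). of_int (graph_weight q n P2 a b))"
            have g1: "get_mat (n + n) ''A1'' s6 = M1"
              using same_snd[OF s6, of "''A1''"] A15 by (intro eq_matI) (auto simp: get_mat_def M1_def mult_2)
            have g2: "get_mat (n + n) ''A'' s6 = M2"
              using A2 by (intro eq_matI) (auto simp: get_mat_def M2_def mult_2)
            have size: "mat_size (mat (2 * n) (2 * n) (\<lambda>(a, b). real_of_int (graph_weight q n P a b))) \<le> (n + n) * ((n + n) * (N + 1 + 2))" for P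
            proof (rule mat_size_le)
              fix a b assume ab: "a < n + n" "b < n + n"
              have "\<bar>graph_weight q n P a b\<bar> \<le> 2 ^ (N + 1)" using graph_weight_bound[OF q(4), of n P a b] q(5) by simp
              then have "real_of_int \<bar>graph_weight q n P a b\<bar> \<le> of_int (2 ^ (N + 1))" by (simp only: of_int_le_iff)
              then show "\<bar>mat (2 * n) (2 * n) (\<lambda>(a, b). real_of_int (graph_weight q n P a b)) $$ (a, b)\<bar> \<le> 2 ^ (N + 1)"
                using ab by simp
            qed (simp add: mult_2)
            obtain \<pi> where \<pi>: "\<pi> permutes {..<2 * n}"
              "gi M1 M2 = Some (mat (2 * n) (2 * n) (\<lambda>(i, j). if i = \<pi> j then 1 else 0))"
              "\<And>a b. a < 2 * n \<Longrightarrow> b < 2 * n \<Longrightarrow> graph_weight q n P1 a b = graph_weight q n P2 (\<pi> a) (\<pi> b)"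
              using GI_answer[OF gi P1 P2 M1_def M2_def projector_graph_iso[OF V1c V2c img T1 T2 P1 P2]] by blast
            define S where "S = mat n n (\<lambda>(i, j). if i = vertex_index n (\<pi> j) then vertex_sign n (\<pi> j) else 0)"
            have S: "S \<in> carrier_mat n n" by (simp add: S_def)
            have Pc: "P1 \<in> carrier_mat n n" "P2 \<in> carrier_mat n n" using P1 P2 by (auto simp: code_projector_def)
            have q0: "0 < q" using q(4) by simp
            have So: "transpose_mat S * S = 1\<^sub>m n" "mdvd q (P1 - transpose_mat S * P2 * S)"
              using orthogonal_of_graph_iso[OF q0 \<pi>(1) \<pi>(3) Pc S_def] by blast+
            define s7 where "s7 = set_nvar ''f'' 1 (set_mat (n + n) ''H'' (mat (2 * n) (2 * n) (\<lambda>(i, j). if i = \<pi> j then 1 else 0)) s6)"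
            have s7: "fst s7 ''n'' = n" "snd s7 ''Q1'' = snd s6 ''Q1''" "snd s7 ''Q'' = snd s6 ''Q''"
              using n6 by (auto simp: s7_def set_mat_def)
            have H7: "snd s7 ''H'' i j - snd s7 ''H'' (n + i) j = of_int (S $$ (i, j))" if ij: "i < n" "j < n" for i j
            proof -
              have "\<pi> j < 2 * n" using permutes_in_image[OF \<pi>(1), of j] ij by simp
              then show ?thesis using ij by (auto simp: s7_def S_def vertex_index_def vertex_sign_def)
            qed
            have Qc: "Q1 \<in> carrier_mat n n" "Q2 \<in> carrier_mat n n" using Q1 Q2 by (auto simp: orthonormal_mat_def)
            have Q17: "snd s7 ''Q1'' i j = Q1 $$ (i, j)" and Q27: "snd s7 ''Q'' i j = Q2 $$ (i, j)" if "i < n" "j < n" for i j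
              using Q16 Q2s s7 that by auto
            note rec = runs_recover[OF s7(1) Qc Q17 Q27 H7 S]
            have call: "runs zl gi (GI_Call twice_n ''A1'' ''A'' ''f'' ''H'') s6 (\<lambda>t s'. t = 1 + mat_size M1 + mat_size M2 \<and> s' = s7)"
              by (rule runs_GI_Call_Some) (use n6 g1 g2 \<pi>(2) in \<open>auto simp: s7_def\<close>)
            have iso: "lattice_iso_by n (Q1 * transpose_mat (rmat S) * transpose_mat Q2)
              ((\<lambda>z. B1 *\<^sub>v rvec z) ` carrier_vec n) ((\<lambda>z. B2 *\<^sub>v rvec z) ` carrier_vec n)"
              by (rule lattice_iso_of_projectors[OF BT1 BT2 Q1 Q2 P1 P2
                  full_lattice_orthogonal[OF T1 V1c V1(2)] full_lattice_orthogonal[OF T2 V2c V2(2)] S So])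
            show "runs zl gi (Seq (GI_Call twice_n ''A1'' ''A'' ''f'' ''H'') recover) s6
              (\<lambda>t. ?Q (t1 + (t2 + (t3 + (t4 + (t5 + (t6 + t)))))))"
            proof (rule runs_SeqI[OF call], elim conjE)
              fix t7 :: nat and s7' assume t7: "t7 = 1 + mat_size M1 + mat_size M2" and e: "s7' = s7"
              have t7': "t7 \<le> 1 + 2 * ((n + n) * ((n + n) * (N + 1 + 2)))"
                using size[of P1] size[of P2] unfolding t7 M1_def M2_def by linarith
              show "runs zl gi recover s7' (\<lambda>t. ?Q (t1 + (t2 + (t3 + (t4 + (t5 + (t6 + (t7 + t))))))))"
                unfolding e
              proof (rule runs_mono[OF rec], assumption, assumption, assumption, assumption, assumption, assumption, elim conjE, intro conjI)
                fix t8 :: nat and s8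
                assume t8: "t8 \<le> (2 + n * (n * 3 + 4)) + (dot_time n + dot_time n)"
                  and out: "get_mat n ''O'' s8 = Q1 * transpose_mat (rmat S) * transpose_mat Q2"
                show "t1 + (t2 + (t3 + (t4 + (t5 + (t6 + (t7 + t8)))))) \<le> reduction_time n N"
                  unfolding reduction_time_def using a1 a3 a4 a5 by (intro add_mono t2 t6 t7' t8) blast+
                show "?goal s8" unfolding out by (rule iso)
              qed
            qed
          qed
        qed auto
      qed auto
    qed auto
  qed
qed auto

section \<open>The polynomial time bound\<close>

lemma poly_fun_intros:
  fixes f g :: "nat \<Rightarrow> nat"
  shows "\<exists>p. \<forall>x. poly p x = (c :: nat)" "\<exists>p. \<forall>x. poly p x = (x :: nat)"
    "\<exists>p. \<forall>x. poly p x = f x \<Longrightarrow> \<exists>p. \<forall>x. poly p x = g x \<Longrightarrow> \<exists>p. \<forall>x. poly p x = f x + g x"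
    "\<exists>p. \<forall>x. poly p x = f x \<Longrightarrow> \<exists>p. \<forall>x. poly p x = g x \<Longrightarrow> \<exists>p. \<forall>x. poly p x = f x * g x"
proof -
  show "\<exists>p. \<forall>x. poly p x = c" by (rule exI[of _ "[:c:]"]) simp
  show "\<exists>p. \<forall>x. poly p x = (x :: nat)" by (rule exI[of _ "[:0, 1:]"]) simp
  show "\<exists>p. \<forall>x. poly p x = f x \<Longrightarrow> \<exists>p. \<forall>x. poly p x = g x \<Longrightarrow> \<exists>p. \<forall>x. poly p x = f x + g x"
    by (metis poly_add)
  show "\<exists>p. \<forall>x. poly p x = f x \<Longrightarrow> \<exists>p. \<forall>x. poly p x = g x \<Longrightarrow> \<exists>p. \<forall>x. poly p x = f x * g x"
    by (metis poly_mult)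
qed

lemma reduction_time_poly: "\<exists>p. \<forall>N. poly p N = reduction_time N N"
  unfolding reduction_time_def core_time_def gram_time_def hull_time_def graph_time_def dot_time_def by (intro poly_fun_intros)

text \<open>The dimension is at most the input size. Replacing it by the size leaves a function of
  one variable, as a univariate polynomial requires.\<close>

lemma reduction_time_mono: "n \<le> N \<Longrightarrow> reduction_time n N \<le> reduction_time N N"
  unfolding reduction_time_def core_time_def gram_time_def hull_time_def graph_time_def dot_time_def by (intro add_mono mult_le_mono order_refl) auto

lemma entry_le_mat_size:
  assumes "A \<in> carrier_mat n n" "i < n" "j < n"
  shows "real_size (A $$ (i, j)) \<le> mat_size A"
proof -
  have d: "dim_row A = n" "dim_col A = n" using assms by auto
  have "real_size (A $$ (i, j)) \<le> (\<Sum>j<n. real_size (A $$ (i, j)))"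
    using assms by (intro member_le_sum) auto
  also have "\<dots> \<le> mat_size A"
    unfolding mat_size_def d using assms by (intro member_le_sum[of i _ "\<lambda>i. \<Sum>j<n. real_size (A $$ (i, j))"]) auto
  finally show ?thesis .
qed

theorem corollary4p10:
  shows "LIP_reducible
    (\<lambda>n q L1 L2.
       odd q \<and> primepow q \<and>
       (\<exists>C O1 O2.
          LCD_code q n C \<and> orthonormal_mat n O1 \<and> orthonormal_mat n O2 \<and>
          L1 = mat_image O1 (construction_A q n C) \<and>
          L2 = mat_image O2 (construction_A q n C)))
    (\<lambda>n. 2 * n)"
proof -
  obtain pol where pol: "\<And>N. poly pol N = reduction_time N N" using reduction_time_poly by blast
  show ?thesis
    unfolding LIP_reducible_def
  proof (rule exI[of _ reduction], rule exI[of _ pol], intro allI impI, elim conjE exE)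
    fix n q L1 L2 B1 B2 zl gi C O1 O2
    assume pp: "primepow q" and C: "LCD_code q n C" and O1: "orthonormal_mat n O1" and O2: "orthonormal_mat n O2"
      and L: "L1 = mat_image O1 (construction_A q n C)" "L2 = mat_image O2 (construction_A q n C)"
      and B: "lattice_basis n B1 L1" "lattice_basis n B2 L2" and zl: "ZLIP_oracle zl" and gi: "GI_oracle (2 * n) gi"
    \<comment> \<open>The input size itself serves as the bit length in all bounds: it is at least
      \<open>n\<close>, the size of \<open>q\<close> and the size of every entry of both
      bases.\<close>
    define N where "N = LIP_input_size n q B1 B2"
    have Bc: "B1 \<in> carrier_mat n n" "B2 \<in> carrier_mat n n" using B by (auto simp: lattice_basis_def)
    have BL: "(\<lambda>z. B1 *\<^sub>v rvec z) ` carrier_vec n = L1" "(\<lambda>z. B2 *\<^sub>v rvec z) ` carrier_vec n = L2"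
      using B lattice_of_cols[OF Bc(1)] lattice_of_cols[OF Bc(2)] by (auto simp: lattice_basis_def)
    have q1: "1 < q" using primepow_gt_Suc_0[OF pp] by simp
    obtain p e where pe: "prime p" "0 < e" "q = p ^ e" using pp by (auto simp: primepow_def)
    obtain V1 where V1: "V1 \<in> carrier_mat n n" "B1 = O1 * rmat V1" "trivial_hull (int q) n V1"
      "(\<lambda>z. V1 *\<^sub>v z) ` carrier_vec n = code_lattice q n C"
      "\<And>x. x \<in> carrier_vec n \<Longrightarrow> \<exists>z\<in>carrier_vec n. V1 *\<^sub>v z = int q \<cdot>\<^sub>v x"
      using LCD_basis_trivial_hull[OF q1 C O1 Bc(1) BL(1)[unfolded L(1)]] by blast
    obtain V2 where V2: "V2 \<in> carrier_mat n n" "B2 = O2 * rmat V2" "trivial_hull (int q) n V2"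
      "(\<lambda>z. V2 *\<^sub>v z) ` carrier_vec n = code_lattice q n C"
      "\<And>x. x \<in> carrier_vec n \<Longrightarrow> \<exists>z\<in>carrier_vec n. V2 *\<^sub>v z = int q \<cdot>\<^sub>v x"
      using LCD_basis_trivial_hull[OF q1 C O2 Bc(2) BL(2)[unfolded L(2)]] by blast
    have full: "full_lattice (int q) n V1" "full_lattice (int q) n V2"
      using V1(5) V2(5) by (auto simp: full_lattice_def)
    define s where "s = LIP_input n q B1 B2"
    have s: "fst s ''n'' = n" "snd s ''q'' 0 0 = of_int (int q)"
      "\<And>i j. i < n \<Longrightarrow> j < n \<Longrightarrow> snd s ''B1'' i j = B1 $$ (i, j)"
      "\<And>i j. i < n \<Longrightarrow> j < n \<Longrightarrow> snd s ''B2'' i j = B2 $$ (i, j)"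
      by (auto simp: s_def LIP_input_def)
    have small: "\<bar>x\<bar> \<le> 2 ^ N" if "real_size x \<le> N" for x
    proof -
      have "\<bar>x\<bar> < 2 ^ real_size x" by (rule le_real_size)
      also have "\<dots> \<le> 2 ^ N" using that by (intro power_increasing) auto
      finally show ?thesis by simp
    qed
    have b1: "snd s ''B1'' i j = B1 $$ (i, j) \<and> \<bar>B1 $$ (i, j)\<bar> \<le> 2 ^ N" if "i < n" "j < n" for i j
    proof -
      have "real_size (B1 $$ (i, j)) \<le> N"
        using entry_le_mat_size[OF Bc(1) that] by (simp add: N_def LIP_input_size_def)
      then show ?thesis using small s(3) that by blast
    qed
    have b2: "snd s ''B2'' i j = B2 $$ (i, j) \<and> \<bar>B2 $$ (i, j)\<bar> \<le> 2 ^ N" if "i < n" "j < n" for i j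
    proof -
      have "real_size (B2 $$ (i, j)) \<le> N"
        using entry_le_mat_size[OF Bc(2) that] by (simp add: N_def LIP_input_size_def)
      then show ?thesis using small s(4) that by blast
    qed
    have "real q < 2 ^ real_size (real q)" using le_real_size[of "real q"] by simp
    also have "\<dots> \<le> 2 ^ N" by (intro power_increasing) (auto simp: N_def LIP_input_size_def)
    finally have "real_of_int (int q) < of_int (2 ^ N)" by simp
    then have qN: "int q < 2 ^ N" by (simp only: of_int_less_iff)
    have nN: "n \<le> N" by (simp add: N_def LIP_input_size_def)
    then have nN2: "n \<le> 2 ^ N" using less_exp[of N] by linarith
    have q': "int q = int p ^ e" "prime (int p)" "1 < int q" using pe(1,3) q1 by (simp, simp, linarith)
    from runs_reduction[OF zl gi s(1,2) Bc(1) b1 Bc(2) b2 q'(1,2) pe(2) q'(3) qN nN2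
        O1 V1(3) full(1) V1(2) O2 V2(3) full(2) V2(2)] V1(4) V2(4)
    have "runs zl gi reduction s (\<lambda>t s'. t \<le> reduction_time n N \<and> lattice_iso_by n (get_mat n ''O'' s') L1 L2)"
      unfolding BL by simp
    then obtain t s' where ts: "steps zl gi reduction s t s'" "t \<le> reduction_time n N"
      "lattice_iso_by n (get_mat n ''O'' s') L1 L2"
      unfolding runs_def by blast
    have "t \<le> poly pol N" using ts(2) reduction_time_mono[OF nN] pol[of N] by linarith
    then show "\<exists>t s. steps zl gi reduction (LIP_input n q B1 B2) t s \<and> t \<le> poly pol (LIP_input_size n q B1 B2) \<and>
        lattice_iso_by n (get_mat n ''O'' s) L1 L2"
      using ts unfolding s_def N_def by blast
  qed
qed

end
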